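(* Let $q=e^{-\omega}$ with $\omega>0$, and let $a,b,c,d,e,f$ be complex parameters with $\max\{|q^f|,|q^{c+f}|,|q^{d+f}|\}<1$. Then $$\frac{1}{2\pi i}\int_{-i\infty}^{i\infty}\frac{(q^{1-c+s},q^{1-d+s},q^{e+f+s};q)_\infty}{(q^{a+s},q^{b+s},q^{f+s};q)_\infty}\,\frac{\pi q^s\,ds}{\sin \pi(c-s)\,\sin\pi(d-s)}$$ $$=\frac{q^c}{\sin \pi(c-d)}\,\frac{(q,q^{1+c-d},q^{d-c},q^{a+b+c+d},q^{c+e+f};q)_{\infty}}{(q^{a+c},q^{a+d},q^{b+c},q^{b+d},q^{c+f};q)_{\infty}}\;{}_{3}\phi_2\left[\begin{array}{c}q^e,\ q^{a+c},\ q^{b+c}\\ q^{c+e+f},\ q^{a+b+c+d}\end{array};q,q^{d+f}\right],$$ where the contour of integration runs from $-i\infty$ to $i\infty$ so that the increasing sequences of poles of the integrand lie to its right and the decreasing sequences of poles lie to its left.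
   Context: The $q$-shifted factorials are $(x;q)_\infty=\prod_{k=0}^{\infty}(1-xq^k)$ and $(x;q)_n=(x;q)_\infty/(xq^n;q)_\infty$, with $(x_1,\ldots,x_m;q)_n=(x_1;q)_n\cdots(x_m;q)_n$ for $n$ an integer or $\infty$. The basic hypergeometric series ${}_3\phi_2$ is ${}_{3}\phi_2\left[\begin{array}{c}a_1,a_2,a_3\\ b_1,b_2\end{array};q,z\right]=\sum_{k=0}^\infty\frac{(a_1,a_2,a_3;q)_k}{(q,b_1,b_2;q)_k}z^k$. Here $q^x=e^{-\omega x}$, and in exponents $e$ is a parameter. As is standard for basic hypergeometric series, parameters are assumed to be such that no denominator vanishes (and that a contour separating the poles as described exists).
   Formalization: The prefactor is q^c/sin π(d−c) instead of the printed q^c/sin π(c−d): with the stated integrand and upward contour the printed identity is off by a factor −1 (e.g. e=0, a=1−c, b=1−d, c slightly above d=1/2 gives a positive left side and a negative right side). *)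

theory Defs
  imports "HOL-Complex_Analysis.Complex_Analysis"
begin

text \<open>The base is \<open>q = exp (- \<omega>)\<close>, and \<open>q\<^sup>x\<close> means \<open>exp (- \<omega> x)\<close> for every complex \<open>x\<close>.\<close>

definition qexp :: "real \<Rightarrow> complex \<Rightarrow> complex" where
  "qexp \<omega> x = exp (- of_real \<omega> * x)"

definition qpoch_inf :: "complex \<Rightarrow> complex \<Rightarrow> complex" where
  "qpoch_inf q x = (\<Prod>k. 1 - x * q ^ k)"

definition qpochs_inf :: "complex \<Rightarrow> complex list \<Rightarrow> complex" where
  "qpochs_inf q xs = prod_list (map (qpoch_inf q) xs)"

text \<open>
  For \<open>n \<ge> 0\<close> the quotient \<open>(x;q)\<^sub>\<infinity> / (x q\<^sup>n;q)\<^sub>\<infinity>\<close> is the finite product below. The product is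
  taken as the definition because the quotient reads 0/0 at \<open>x = q\<^sup>-\<^sup>m\<close> with \<open>m \<ge> n\<close>, a case
  that occurs in terminating series. The lemma \<open>qpoch_eq_quotient\<close> gives the agreement elsewhere.
\<close>

definition qpoch :: "complex \<Rightarrow> complex \<Rightarrow> nat \<Rightarrow> complex" where
  "qpoch q x n = (\<Prod>k<n. 1 - x * q ^ k)"

lemma qpoch_eq_quotient:
  assumes "norm q < 1" "qpoch_inf q (x * q ^ n) \<noteq> 0"
  shows "qpoch q x n = qpoch_inf q x / qpoch_inf q (x * q ^ n)"
proof -
  have conv: "convergent_prod (\<lambda>k. 1 - y * q ^ k)" for y
  proof -
    have "summable (\<lambda>k. norm (y * q ^ k))"
      using assms(1) by (simp add: norm_mult norm_power summable_mult summable_geometric)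
    hence "summable (\<lambda>k. norm ((1 - y * q ^ k) - 1))"
      by simp
    thus ?thesis
      using abs_convergent_prod_conv_summable abs_convergent_prod_imp_convergent_prod by blast
  qed
  have "qpoch_inf q x = qpoch q x n * qpoch_inf q (x * q ^ n)"
  proof (cases "\<exists>k<n. 1 - x * q ^ k = 0")
    case True
    then obtain k where k: "k < n" "1 - x * q ^ k = 0"
      by blast
    have "qpoch q x n = 0"
      unfolding qpoch_def using k by (auto intro!: prod_zero)
    moreover have "qpoch_inf q x = 0"
      unfolding qpoch_inf_def
      using has_prod_eq_0_iff[OF convergent_prod_has_prod[OF conv[of x]]] k(2)
      by (metis rangeI)
    ultimately show ?thesis
      by simp
  next
    case False
    have "prodinf (\<lambda>k. 1 - x * q ^ k) =
            prodinf (\<lambda>k. 1 - x * q ^ (k + n)) * (\<Prod>k<n. 1 - x * q ^ k)"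
      by (rule prodinf_split_initial_segment[OF conv]) (use False in auto)
    thus ?thesis
      by (simp add: qpoch_inf_def qpoch_def power_add mult_ac)
  qed
  thus ?thesis
    using assms(2) by simp
qed

definition qpochs :: "complex \<Rightarrow> complex list \<Rightarrow> nat \<Rightarrow> complex" where
  "qpochs q xs n = prod_list (map (\<lambda>x. qpoch q x n) xs)"

definition phi32 ::
  "complex \<Rightarrow> complex \<Rightarrow> complex \<Rightarrow> complex \<Rightarrow> complex \<Rightarrow> complex \<Rightarrow> complex \<Rightarrow> complex"
where
  "phi32 a\<^sub>1 a\<^sub>2 a\<^sub>3 b\<^sub>1 b\<^sub>2 q z = (\<Sum>k. qpochs q [a\<^sub>1, a\<^sub>2, a\<^sub>3] k / qpochs q [q, b\<^sub>1, b\<^sub>2] k * z ^ k)"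

definition barnes_integrand ::
  "real \<Rightarrow> complex \<Rightarrow> complex \<Rightarrow> complex \<Rightarrow> complex \<Rightarrow> complex \<Rightarrow> complex \<Rightarrow> complex \<Rightarrow> complex"
where
  "barnes_integrand \<omega> a b c d e f s =
     qpochs_inf (qexp \<omega> 1) [qexp \<omega> (1 - c + s), qexp \<omega> (1 - d + s), qexp \<omega> (e + f + s)] /
     qpochs_inf (qexp \<omega> 1) [qexp \<omega> (a + s), qexp \<omega> (b + s), qexp \<omega> (f + s)] *
     (of_real pi * qexp \<omega> s / (sin (of_real pi * (c - s)) * sin (of_real pi * (d - s))))"

text \<open>
  On sign conventions: with this integrand and the contour oriented upwards, the closed form has
  the prefactor \<open>q\<^sup>c / sin \<pi>(d - c)\<close>. The form \<open>q\<^sup>c / sin \<pi>(c - d)\<close> found in print has the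
  opposite sign and is not correct: for real \<open>c, d\<close> close together and a vertical line as contour,
  the integral tends to a positive limit as \<open>q \<rightarrow> 1\<close> (up to positive factors), whereas
  \<open>(q\<^bsup>1+c-d\<^esup>, q\<^bsup>d-c\<^esup>; q)\<^sub>\<infinity> / sin \<pi>(c - d)\<close> behaves like a positive multiple of
  \<open>sin \<pi>(d - c) / sin \<pi>(c - d) = -1\<close>.
\<close>

text \<open>
  The zeros of the two sines are \<open>c + n\<close> and \<open>d + n\<close> with \<open>n\<close> an integer; those with \<open>n < 0\<close>
  are compensated by zeros of \<open>(q\<^bsup>1-c+s\<^esup>, q\<^bsup>1-d+s\<^esup>; q)\<^sub>\<infinity>\<close>. The factor \<open>(q\<^bsup>x+s\<^esup>; q)\<^sub>\<infinity>\<close> vanishes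
  where \<open>x + s + n\<close> is an integral multiple of the period \<open>2 \<pi> i / \<omega>\<close> for some \<open>n \<ge> 0\<close>, so
  each of \<open>a, b, f\<close> contributes one decreasing sequence for every integer \<open>m\<close>.
\<close>

definition increasing_poles ::
  "real \<Rightarrow> complex \<Rightarrow> complex \<Rightarrow> complex \<Rightarrow> complex \<Rightarrow> complex \<Rightarrow> complex \<Rightarrow> complex set"
where
  "increasing_poles \<omega> a b c d e f =
     {p. is_pole (barnes_integrand \<omega> a b c d e f) p \<and>
         (\<exists>x\<in>{c, d}. \<exists>n::nat. p = x + of_nat n)}"

definition decreasing_poles ::
  "real \<Rightarrow> complex \<Rightarrow> complex \<Rightarrow> complex \<Rightarrow> complex \<Rightarrow> complex \<Rightarrow> complex \<Rightarrow> complex set"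
where
  "decreasing_poles \<omega> a b c d e f =
     {p. is_pole (barnes_integrand \<omega> a b c d e f) p \<and>
         (\<exists>x\<in>{a, b, f}. \<exists>(n::nat) (m::int).
            p = - x - of_nat n + 2 * of_real pi * \<i> * of_int m / of_real \<omega>)}"

text \<open>
  A contour from \<open>-i\<infinity>\<close> to \<open>i\<infinity>\<close> is parametrised by the whole real line. It is piecewise
  continuously differentiable and runs up vertical lines outside a bounded set; in between it may
  be indented arbitrarily.
\<close>

definition vertical_contour :: "(real \<Rightarrow> complex) \<Rightarrow> bool" where
  "vertical_contour \<gamma> \<longleftrightarrow>
     (\<exists>T>0. \<exists>\<sigma>\<^sub>1 \<sigma>\<^sub>2. \<gamma> piecewise_C1_differentiable_on {-T..T} \<and>
        (\<forall>t\<le>-T. \<gamma> t = Complex \<sigma>\<^sub>1 t) \<and> (\<forall>t\<ge>T. \<gamma> t = Complex \<sigma>\<^sub>2 t))"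

text \<open>
  Points on the left (right) of such a contour are those in the component of its complement that
  contains a left (right) half-plane. In particular they do not lie on the contour.
\<close>

definition left_of_contour :: "(real \<Rightarrow> complex) \<Rightarrow> complex set" where
  "left_of_contour \<gamma> =
     {z. \<exists>w. connected_component (- range \<gamma>) z w \<and> (\<forall>t. Re w < Re (\<gamma> t))}"

definition right_of_contour :: "(real \<Rightarrow> complex) \<Rightarrow> complex set" where
  "right_of_contour \<gamma> =
     {z. \<exists>w. connected_component (- range \<gamma>) z w \<and> (\<forall>t. Re (\<gamma> t) < Re w)}"

text \<open>
  The counterpart of the library's \<open>has_contour_integral\<close> for contours parametrised by the whole
  real line. The gauge integral over \<open>UNIV\<close> includes the improper integral.
\<close>

definition has_line_integral ::
  "(complex \<Rightarrow> complex) \<Rightarrow> complex \<Rightarrow> (real \<Rightarrow> complex) \<Rightarrow> bool"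
where
  "has_line_integral F I \<gamma> \<longleftrightarrow>
     ((\<lambda>t. F (\<gamma> t) * vector_derivative \<gamma> (at t)) has_integral I) UNIV"

end

theory Submission
  imports Defs "HOL-Real_Asymp.Real_Asymp"
begin

text \<open>
  Put \<open>u = q\<^sup>s\<close> and write \<open>A, ..., F\<close> for \<open>q\<^sup>a, ..., q\<^sup>f\<close>. The integrand is the product of
  \<open>g(u) = (qu/C, qu/D, EFu; q)\<^sub>\<infinity> / (Au, Bu, Fu; q)\<^sub>\<infinity>\<close>, which is periodic in the vertical direction,
  and of \<open>\<pi> u / (sin \<pi>(c - s) sin \<pi>(d - s))\<close>, which decays exponentially in that direction. To the
  right \<open>g(u)\<close> stays bounded and \<open>u\<close> tends to 0. Closing the contour by ever larger rectangles on
  its right therefore turns the integral into the sum over the residues at \<open>c + n\<close> and \<open>d + n\<close>. These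
  residues are multiples of \<open>u g(u)\<close> at \<open>u = C q\<^sup>n\<close> and \<open>u = D q\<^sup>n\<close>, so that the integral, divided by
  \<open>2\<pi>\<i>\<close>, is the Jackson integral of \<open>g\<close> from \<open>D\<close> to \<open>C\<close>, divided by \<open>(1 - q) sin \<pi>(d - c)\<close>
  (\<open>has_line_integral_barnes\<close>).

  The Jackson integral is a nonterminating three-term relation for \<open>\<^sub>3\<phi>\<^sub>2\<close> in disguise
  (\<open>jackson_between_eq_phi32\<close>). The q-Gauss sum expands \<open>(EFu;q)\<^sub>\<infinity> / (Fu;q)\<^sub>\<infinity>\<close> in the Newton
  polynomials \<open>(u - C)(u - Cq)...(u - Cq\<^bsup>k-1\<^esup>)\<close>; at the points \<open>u = C q\<^sup>n\<close> and \<open>u = D q\<^sup>n\<close> it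
  converges because \<open>|CF| < 1\<close> and \<open>|DF| < 1\<close>. What remains are the Jackson integrals of these
  polynomials against \<open>(qu/C, qu/D; q)\<^sub>\<infinity> / (Au, Bu; q)\<^sub>\<infinity>\<close>. One telescoping sum relates the first
  two moments of this weight. It gives a first order recurrence in \<open>k\<close>, which produces the terms of
  the \<open>\<^sub>3\<phi>\<^sub>2\<close>, and also the value for \<open>k = 0\<close>, the theorem of Andrews and Askey (\<open>andrews_askey\<close>).

  The contour need be neither simple nor close to a straight line, and "left" and "right" refer to
  components of its complement. The winding number of the closed path about a point is constant on
  such a component, hence it can be computed far to the left, where it is 0, and far to the right,
  where it is -1 (\<open>winding_left_of_contour\<close>, \<open>winding_right_of_contour\<close>). The contour may also
  pass through removable singularities of the integrand, where the quotient that defines the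
  integrand has the conventional value 0. The residue theorem is applied to the function with
  these singularities removed; the two line integrals agree by \<open>line_integrand_spike\<close>.
\<close>

section \<open>Infinite q-shifted factorials\<close>

lemma qpoch_inf_convergent_prod:
  assumes "norm q < 1"
  shows "convergent_prod (\<lambda>k. 1 - x * q ^ k :: complex)"
proof -
  have "summable (\<lambda>k. norm (x * q ^ k))"
    using assms by (simp add: norm_mult norm_power summable_mult summable_geometric)
  hence "summable (\<lambda>k. norm ((1 - x * q ^ k) - 1))"
    by simp
  thus ?thesis
    using abs_convergent_prod_conv_summable abs_convergent_prod_imp_convergent_prod by blast
qed

lemma qpoch_inf_eq_0_iff:
  assumes "norm q < 1"
  shows "qpoch_inf q x = 0 \<longleftrightarrow> (\<exists>k. x * q ^ k = 1)"
proof -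
  have "qpoch_inf q x = 0 \<longleftrightarrow> 0 \<in> range (\<lambda>k. 1 - x * q ^ k)"
    unfolding qpoch_inf_def
    using has_prod_eq_0_iff[OF convergent_prod_has_prod[OF qpoch_inf_convergent_prod[OF assms]]] .
  thus ?thesis
    by (auto simp: image_iff)
qed

lemma qpoch_0 [simp]: "qpoch q x 0 = 1"
  and qpoch_Suc: "qpoch q x (Suc n) = qpoch q x n * (1 - x * q ^ n)"
  by (simp_all add: qpoch_def)

text \<open>
  The product splits at every index, also when some factor vanishes: a zero of the tail is a zero of
  the whole product.
\<close>

lemma qpoch_inf_split:
  assumes "norm q < 1"
  shows "qpoch_inf q x = qpoch q x n * qpoch_inf q (x * q ^ n)"
proof (cases "qpoch_inf q (x * q ^ n) = 0")
  case True
  then obtain k where "x * q ^ n * q ^ k = 1"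
    using qpoch_inf_eq_0_iff[OF assms] by blast
  hence "x * q ^ (n + k) = 1"
    by (simp add: power_add mult_ac)
  hence "qpoch_inf q x = 0"
    using qpoch_inf_eq_0_iff[OF assms] by blast
  with True show ?thesis
    by simp
qed (use qpoch_eq_quotient[OF assms] in \<open>simp add: field_simps\<close>)

lemma qpoch_inf_rec:
  assumes "norm q < 1"
  shows "qpoch_inf q x = (1 - x) * qpoch_inf q (x * q)"
  using qpoch_inf_split[OF assms, of x 1] by (simp add: qpoch_def)

lemma qpoch_inf_0 [simp]: "qpoch_inf q 0 = 1"
  by (simp add: qpoch_inf_def)

lemma qpoch_inf_shift_nonzero:
  assumes "norm q < 1" "qpoch_inf q x \<noteq> 0"
  shows "qpoch_inf q (x * q ^ n) \<noteq> 0"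
  using assms qpoch_inf_split[of q x n] by auto

lemma qpoch_nonzero:
  assumes "norm q < 1" "qpoch_inf q x \<noteq> 0"
  shows "qpoch q x n \<noteq> 0"
  using assms qpoch_inf_split[of q x n] by auto

lemma qpoch_inf_nonzero:
  assumes "norm q < 1" "norm x < 1"
  shows "qpoch_inf q x \<noteq> 0"
proof
  assume "qpoch_inf q x = 0"
  then obtain k where "x * q ^ k = 1"
    using qpoch_inf_eq_0_iff[OF assms(1)] by blast
  hence "norm x * norm q ^ k = 1"
    by (metis norm_mult norm_one norm_power)
  moreover have "norm x * norm q ^ k \<le> norm x * 1"
    using assms by (intro mult_left_mono power_le_one) auto
  ultimately show False
    using assms by simp
qed

text \<open>
  The partial products converge uniformly on bounded sets by the M-test with
  the geometric series as majorant.
\<close>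

lemma qpoch_inf_holomorphic:
  assumes "norm q < 1"
  shows "qpoch_inf q holomorphic_on UNIV"
proof (rule holomorphic_uniform_sequence[where f = "\<lambda>N x. \<Prod>k<N. 1 - x * q ^ k"])
  fix x :: complex
  have *: "uniformly_convergent_on (cball x 1) (\<lambda>N y. \<Prod>k<N. 1 - y * q ^ k)"
  proof (rule uniformly_convergent_on_prod')
    show "uniformly_convergent_on (cball x 1) (\<lambda>N y. \<Sum>n<N. norm (1 - y * q ^ n - 1))"
    proof (rule Weierstrass_m_test')
      show "norm (norm (1 - y * q ^ n - 1)) \<le> (norm x + 1) * norm q ^ n" if "y \<in> cball x 1" for n y
      proof -
        have "norm y \<le> norm x + 1"
          using that norm_triangle_sub[of y x] by (simp add: dist_norm norm_minus_commute)
        thus ?thesis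
          by (simp add: norm_mult norm_power mult_right_mono)
      qed
      show "summable (\<lambda>n. (norm x + 1) * norm q ^ n)"
        using assms by (intro summable_mult summable_geometric) auto
    qed
  qed (auto intro!: continuous_intros)
  have "uniform_limit (cball x 1) (\<lambda>N y. \<Prod>k<N. 1 - y * q ^ k) (qpoch_inf q) sequentially"
  proof -
    have "lim (\<lambda>N. \<Prod>k<N. 1 - y * q ^ k) = qpoch_inf q y" for y
    proof -
      have "(\<lambda>N. \<Prod>k\<le>N. 1 - y * q ^ k) \<longlonglongrightarrow> qpoch_inf q y"
        unfolding qpoch_inf_def by (rule convergent_prod_LIMSEQ[OF qpoch_inf_convergent_prod[OF assms]])
      hence "(\<lambda>N. \<Prod>k<N. 1 - y * q ^ k) \<longlonglongrightarrow> qpoch_inf q y"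
        unfolding lessThan_Suc_atMost[symmetric] by (rule LIMSEQ_imp_Suc)
      thus ?thesis
        by (rule limI)
    qed
    thus ?thesis
      using * by (simp add: uniformly_convergent_uniform_limit_iff)
  qed
  thus "\<exists>d>0. cball x d \<subseteq> UNIV \<and>
          uniform_limit (cball x d) (\<lambda>N y. \<Prod>k<N. 1 - y * q ^ k) (qpoch_inf q) sequentially"
    by (intro exI[of _ 1]) auto
qed (auto intro!: holomorphic_intros)

lemma qpoch_inf_analytic [analytic_intros]:
  assumes "norm q < 1" "f analytic_on A"
  shows "(\<lambda>z. qpoch_inf q (f z)) analytic_on A"
proof -
  have "qpoch_inf q analytic_on UNIV"
    using qpoch_inf_holomorphic[OF assms(1)] by (simp add: analytic_on_open)
  hence "(qpoch_inf q \<circ> f) analytic_on A"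
    by (intro analytic_on_compose[OF assms(2)]) (auto intro: analytic_on_subset)
  thus ?thesis
    by (simp add: o_def)
qed

lemma tendsto_qpoch_inf [tendsto_intros]:
  assumes "norm q < 1" "(f \<longlongrightarrow> x) F"
  shows "((\<lambda>n. qpoch_inf q (f n)) \<longlongrightarrow> qpoch_inf q x) F"
proof -
  have "isCont (qpoch_inf q) x"
    using qpoch_inf_holomorphic[OF assms(1)] holomorphic_on_imp_continuous_on
    by (metis UNIV_I continuous_on_eq_continuous_at open_UNIV)
  thus ?thesis
    using assms(2) isCont_tendsto_compose by blast
qed

lemma tendsto_mult_qpower_zero:
  assumes "norm q < 1"
  shows "(\<lambda>n. x * q ^ n :: complex) \<longlonglongrightarrow> 0"
  using tendsto_mult[OF tendsto_const LIMSEQ_power_zero[OF assms], of x] by simp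

lemma qpoch_tendsto:
  assumes "norm q < 1"
  shows "qpoch q x \<longlonglongrightarrow> qpoch_inf q x"
proof -
  have "(\<lambda>n. qpoch_inf q (x * q ^ n)) \<longlonglongrightarrow> qpoch_inf q 0"
    by (intro tendsto_intros assms tendsto_mult_qpower_zero)
  hence lim: "(\<lambda>n. qpoch_inf q (x * q ^ n)) \<longlonglongrightarrow> 1"
    by simp
  have "(\<lambda>n. qpoch_inf q x / qpoch_inf q (x * q ^ n)) \<longlonglongrightarrow> qpoch_inf q x / 1"
    by (intro tendsto_intros lim) auto
  moreover have "eventually (\<lambda>n. qpoch_inf q (x * q ^ n) \<noteq> 0) sequentially"
    using tendsto_imp_eventually_ne[OF lim, of 0] by simp
  hence "eventually (\<lambda>n. qpoch_inf q x / qpoch_inf q (x * q ^ n) = qpoch q x n) sequentially"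
    by eventually_elim (use qpoch_inf_split[OF assms, of x] in \<open>simp add: field_simps\<close>)
  ultimately show ?thesis
    by (simp add: Lim_transform_eventually)
qed

section \<open>A form of the q-Gauss sum\<close>

text \<open>
  The coefficients of the expansion of \<open>(EFu;q)\<^sub>\<infinity> / (Fu;q)\<^sub>\<infinity>\<close> in Newton polynomials, up to the
  constant factor \<open>(CEF;q)\<^sub>\<infinity> / (CF;q)\<^sub>\<infinity>\<close>.
\<close>

definition qgauss_coeff :: "complex \<Rightarrow> complex \<Rightarrow> complex \<Rightarrow> complex \<Rightarrow> nat \<Rightarrow> complex" where
  "qgauss_coeff q C E F k = qpoch q E k * F ^ k / (qpoch q q k * qpoch q (C * E * F) k)"

text \<open>
  This is \<open>(C/u;q)\<^sub>k u\<^sup>k\<close>, written so that \<open>u = 0\<close> is allowed. With it the series below is the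
  \<open>\<^sub>2\<phi>\<^sub>1\<close> of the q-Gauss sum with upper parameters \<open>E\<close> and \<open>C/u\<close>, lower parameter \<open>CEF\<close> and
  argument \<open>Fu\<close>.
\<close>

definition qnewton :: "complex \<Rightarrow> complex \<Rightarrow> nat \<Rightarrow> complex \<Rightarrow> complex" where
  "qnewton q C k u = (\<Prod>j<k. u - C * q ^ j)"

text \<open>
  Bounds the terms of the series for all \<open>|u| \<le> r\<close> at once. The uniformity is what permits to let \<open>u\<close>
  tend to 0 and to exchange the series with a Jackson sum.
\<close>

definition qgauss_majorant ::
  "complex \<Rightarrow> complex \<Rightarrow> complex \<Rightarrow> complex \<Rightarrow> real \<Rightarrow> nat \<Rightarrow> real" where
  "qgauss_majorant q C E F r k = norm (qgauss_coeff q C E F k) * (\<Prod>j<k. r + norm C * norm q ^ j)"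

lemma qnewton_0 [simp]: "qnewton q C 0 u = 1"
  and qnewton_Suc: "qnewton q C (Suc k) u = qnewton q C k u * (u - C * q ^ k)"
  by (simp_all add: qnewton_def)

lemma norm_qgauss_term_le:
  assumes "norm u \<le> r"
  shows "norm (qgauss_coeff q C E F k * qnewton q C k u) \<le> qgauss_majorant q C E F r k"
proof -
  have "norm (u - C * q ^ j) \<le> r + norm C * norm q ^ j" for j
    using norm_triangle_ineq4[of u "C * q ^ j"] assms by (simp add: norm_mult norm_power)
  thus ?thesis
    unfolding norm_mult qgauss_majorant_def qnewton_def prod_norm[symmetric]
    by (intro mult_left_mono prod_mono) auto
qed

context
  fixes q C E F :: complex
  assumes q: "norm q < 1" and CEF: "\<And>k. qpoch q (C * E * F) k \<noteq> 0"
begin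

lemma qpoch_q_nonzero: "qpoch q q k \<noteq> 0"
  using qpoch_nonzero[OF q qpoch_inf_nonzero[OF q q]] .

lemma one_minus_CEF_qpower_nonzero: "1 - C * E * F * q ^ k \<noteq> 0"
  using CEF[of "Suc k"] by (simp add: qpoch_Suc)

lemma one_minus_q_qpower_nonzero: "1 - q * q ^ k \<noteq> 0"
  using qpoch_q_nonzero[of "Suc k"] by (simp add: qpoch_Suc)

lemma qgauss_coeff_Suc:
  "qgauss_coeff q C E F (Suc k) =
     qgauss_coeff q C E F k * (F * (1 - E * q ^ k) / ((1 - q * q ^ k) * (1 - C * E * F * q ^ k)))"
  by (simp add: qgauss_coeff_def qpoch_Suc mult_ac)

lemma summable_qgauss_majorant:
  assumes "r \<ge> 0" "norm F * r < 1"
  shows "summable (qgauss_majorant q C E F r)"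
proof -
  define t where "t k = norm (F * (1 - E * q ^ k) / ((1 - q * q ^ k) * (1 - C * E * F * q ^ k)))
                          * (r + norm C * norm q ^ k)" for k
  have "t \<longlonglongrightarrow> norm (F * (1 - 0) / ((1 - 0) * (1 - 0))) * (r + norm C * 0)"
    unfolding t_def
    by (intro tendsto_intros tendsto_mult_qpower_zero q LIMSEQ_power_zero) (use q in auto)
  hence "t \<longlonglongrightarrow> norm F * r"
    by simp
  moreover obtain c where c: "norm F * r < c" "c < 1"
    using dense[OF assms(2)] by blast
  ultimately have "eventually (\<lambda>k. t k < c) sequentially"
    using order_tendstoD(2) by blast
  then obtain N where N: "\<And>k. k \<ge> N \<Longrightarrow> t k < c"
    by (auto simp: eventually_at_top_linorder)
  have pos: "qgauss_majorant q C E F r k \<ge> 0" for k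
    unfolding qgauss_majorant_def using assms by (intro mult_nonneg_nonneg prod_nonneg) auto
  have rec: "qgauss_majorant q C E F r (Suc k) = qgauss_majorant q C E F r k * t k" for k
    by (simp only: qgauss_majorant_def t_def qgauss_coeff_Suc norm_mult prod.lessThan_Suc mult_ac)
  show ?thesis
  proof (rule summable_ratio_test[OF c(2)])
    fix k assume "N \<le> k"
    hence "qgauss_majorant q C E F r k * t k \<le> qgauss_majorant q C E F r k * c"
      using N[of k] pos[of k] by (intro mult_left_mono) auto
    thus "norm (qgauss_majorant q C E F r (Suc k)) \<le> c * norm (qgauss_majorant q C E F r k)"
      using pos[of k] pos[of "Suc k"] rec[of k] by (simp add: mult.commute)
  qed
qed

lemma summable_qgauss:
  assumes "norm (F * u) < 1"
  shows "summable (\<lambda>k. qgauss_coeff q C E F k * qnewton q C k u)"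
proof (rule summable_comparison_test)
  show "summable (qgauss_majorant q C E F (norm u))"
    using assms by (intro summable_qgauss_majorant) (auto simp: norm_mult)
qed (use norm_qgauss_term_le[of u "norm u"] in auto)

text \<open>
  As a function of \<open>u\<close> both sides of the q-Gauss sum satisfy the same first order q-difference
  equation. For the series it holds because the difference of the two sides is a telescoping sum.
\<close>

lemma qgauss_functional_equation:
  assumes u: "norm (F * u) < 1"
  shows "(1 - F * u) * (\<Sum>k. qgauss_coeff q C E F k * qnewton q C k u) =
         (1 - E * F * u) * (\<Sum>k. qgauss_coeff q C E F k * qnewton q C k (u * q))"
proof -
  define c where "c = qgauss_coeff q C E F"
  \<comment> \<open>For \<open>k > 0\<close> this is \<open>c\<^sub>k (1 - q\<^sup>k) (1 - C E F q\<^bsup>k-1\<^esup>)\<close> times the Newton polynomial of degree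
      \<open>k - 1\<close>; written with \<open>c\<^bsub>k-1\<^esub>\<close> it visibly tends to 0.\<close>
  define y where "y k = (case k of 0 \<Rightarrow> 0 | Suc m \<Rightarrow> F * (c m * qnewton q C m u) * (1 - E * q ^ m))" for k
  have u': "norm (F * (u * q)) < 1"
  proof -
    have "norm (F * u) * norm q \<le> norm (F * u) * 1"
      using q by (intro mult_left_mono) auto
    thus ?thesis
      using u by (simp add: norm_mult mult_ac)
  qed
  note sm = summable_qgauss[OF u, folded c_def] summable_qgauss[OF u', folded c_def]
  have shift: "qnewton q C (Suc m) (u * q) = qnewton q C m u * (q * q ^ m * u - C * q ^ m)" for m
  proof (induction m)
    case (Suc m)
    have "qnewton q C (Suc (Suc m)) (u * q) =
            qnewton q C m u * (q * q ^ m * u - C * q ^ m) * (u * q - C * (q * q ^ m))"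
      by (subst qnewton_Suc, subst Suc.IH) simp
    thus ?case
      by (simp add: qnewton_Suc algebra_simps)
  qed (simp add: qnewton_Suc algebra_simps)
  have y: "c k * qnewton q C k u - c k * qnewton q C k (u * q) -
             F * u * (c k * qnewton q C k u - E * (c k * qnewton q C k (u * q))) = u * (y k - y (Suc k))"
    for k
  proof (cases k)
    case 0
    thus ?thesis
      by (simp add: y_def algebra_simps)
  next
    case (Suc m)
    define p x where "p = qnewton q C m u" and "x = q ^ m"
    have "c m * F * (1 - E * x) = c k * (1 - q * x) * (1 - C * E * F * x)"
      using one_minus_CEF_qpower_nonzero[of m] one_minus_q_qpower_nonzero[of m] by (simp add: Suc c_def qgauss_coeff_Suc x_def)
    hence y1: "y k = c k * (1 - q * x) * (1 - C * E * F * x) * p"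
      by (simp add: y_def Suc p_def x_def mult_ac)
    have y2: "y (Suc k) = F * (c k * (p * (u - C * x))) * (1 - E * (q * x))"
      by (simp add: y_def Suc p_def x_def qnewton_Suc)
    have P1: "qnewton q C k u = p * (u - C * x)"
      by (simp add: Suc p_def x_def qnewton_Suc)
    have P2: "qnewton q C k (u * q) = p * (q * x * u - C * x)"
      by (simp add: Suc p_def x_def shift)
    show ?thesis
      unfolding y1 y2 P1 P2 by (simp add: algebra_simps)
  qed
  have "(\<lambda>k. y (Suc k)) \<longlonglongrightarrow> F * 0 * (1 - 0)"
    unfolding y_def nat.case
    by (intro tendsto_intros summable_LIMSEQ_zero sm tendsto_mult_qpower_zero q)
  hence "y \<longlonglongrightarrow> 0"
    by (simp add: LIMSEQ_imp_Suc)
  hence "(\<lambda>k. u * (y k - y (Suc k))) sums (u * (y 0 - 0))"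
    by (intro sums_mult telescope_sums')
  hence *: "(\<lambda>k. u * (y k - y (Suc k))) sums 0"
    by (simp add: y_def)
  have "(\<lambda>k. u * (y k - y (Suc k))) sums
     ((\<Sum>k. c k * qnewton q C k u) - (\<Sum>k. c k * qnewton q C k (u * q)) -
      F * u * ((\<Sum>k. c k * qnewton q C k u) - E * (\<Sum>k. c k * qnewton q C k (u * q))))"
    unfolding y[symmetric] by (intro sums_diff sums_mult summable_sums sm)
  from sums_unique2[OF * this] show ?thesis
    unfolding c_def by (simp add: algebra_simps)
qed

text \<open>
  Iterating the q-difference equation moves \<open>u\<close> to 0, so the series is
  \<open>(EFu;q)\<^sub>\<infinity> / (Fu;q)\<^sub>\<infinity>\<close> times its value at 0. That value is found at \<open>u = C\<close>, where
  all Newton polynomials but the first vanish.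
\<close>

lemma qgauss_sum:
  assumes C: "norm (F * C) < 1" and u: "norm (F * u) < 1"
  shows "(\<Sum>k. qgauss_coeff q C E F k * qnewton q C k u) * qpoch_inf q (C * E * F) / qpoch_inf q (F * C)
           = qpoch_inf q (E * F * u) / qpoch_inf q (F * u)"
proof -
  define h where "h v = (\<Sum>k. qgauss_coeff q C E F k * qnewton q C k v)" for v
  have key: "h v * qpoch_inf q (F * v) = h 0 * qpoch_inf q (E * F * v)" if v: "norm (F * v) < 1" for v
  proof -
    have small: "norm (v * q ^ n) \<le> norm v" for n
      using q power_le_one[of "norm q" n] by (simp add: norm_mult norm_power mult_left_le)
    have it: "h v * qpoch q (F * v) n = h (v * q ^ n) * qpoch q (E * F * v) n" for n
    proof (induction n)
      case (Suc n)
      have "norm (F * (v * q ^ n)) \<le> norm (F * v)"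
        using mult_left_mono[OF small[of n], of "norm F"] by (simp add: norm_mult)
      hence "(1 - F * (v * q ^ n)) * h (v * q ^ n) = (1 - E * F * (v * q ^ n)) * h (v * q ^ n * q)"
        using qgauss_functional_equation[of "v * q ^ n"] v by (simp add: h_def)
      thus ?case
        using Suc by (simp add: qpoch_Suc mult_ac) (metis mult.assoc mult.left_commute)
    qed simp
    have "(\<lambda>n. h (v * q ^ n)) \<longlonglongrightarrow> h 0"
    proof -
      have "(\<lambda>n. qnewton q C k (v * q ^ n)) \<longlonglongrightarrow> qnewton q C k 0" for k
        unfolding qnewton_def by (intro tendsto_intros tendsto_mult_qpower_zero q)
      moreover have "summable (qgauss_majorant q C E F (norm v))"
        using v by (intro summable_qgauss_majorant) (auto simp: norm_mult)
      ultimately show ?thesis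
        unfolding h_def
        using norm_qgauss_term_le[OF small]
        by (intro conjunct2[OF conjunct2[OF tannerys_theorem[where M = "qgauss_majorant q C E F (norm v)"]]])
           (auto intro!: tendsto_intros always_eventually)
    qed
    hence "(\<lambda>n. h (v * q ^ n) * qpoch q (E * F * v) n) \<longlonglongrightarrow> h 0 * qpoch_inf q (E * F * v)"
      by (intro tendsto_intros qpoch_tendsto q)
    moreover have "(\<lambda>n. h v * qpoch q (F * v) n) \<longlonglongrightarrow> h v * qpoch_inf q (F * v)"
      by (intro tendsto_intros qpoch_tendsto q)
    ultimately show ?thesis
      using it LIMSEQ_unique by (simp add: it)
  qed
  have "h C = 1"
  proof -
    have "qnewton q C (Suc k) C = 0" for k
      by (induction k) (simp_all add: qnewton_Suc)
    hence "qgauss_coeff q C E F k * qnewton q C k C = 0" if "k \<notin> {0}" for k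
      using that by (cases k) auto
    hence "h C = (\<Sum>k\<in>{0}. qgauss_coeff q C E F k * qnewton q C k C)"
      unfolding h_def by (intro suminf_finite) auto
    thus ?thesis
      by (simp add: qgauss_coeff_def)
  qed
  hence "qpoch_inf q (F * C) = h 0 * qpoch_inf q (C * E * F)"
    using key[OF C] by (simp add: mult_ac)
  moreover have "qpoch_inf q (F * C) \<noteq> 0" "qpoch_inf q (F * u) \<noteq> 0"
    using qpoch_inf_nonzero[OF q] C u by auto
  moreover note key[OF u]
  ultimately show ?thesis
    unfolding h_def[symmetric] by (auto simp: field_simps)
qed

end

section \<open>Jackson sums and the Andrews-Askey integral\<close>

text \<open>
  Up to the factor \<open>1 - q\<close> this is the Jackson integral of \<open>f\<close> from 0 to \<open>C\<close>.
\<close>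

definition jackson :: "complex \<Rightarrow> (complex \<Rightarrow> complex) \<Rightarrow> complex \<Rightarrow> complex" where
  "jackson q f C = (\<Sum>n. C * q ^ n * f (C * q ^ n))"

definition jackson_between ::
  "complex \<Rightarrow> (complex \<Rightarrow> complex) \<Rightarrow> complex \<Rightarrow> complex \<Rightarrow> complex" where
  "jackson_between q f C D = jackson q f C - jackson q f D"

text \<open>
  The integrand of Andrews and Askey has \<open>X = 1/C\<close> and \<open>Y = 1/D\<close> for the end points \<open>C, D\<close>
  of the integral. With \<open>X\<close> as a separate parameter the weight may be multiplied by a Newton
  polynomial: this replaces \<open>1/C\<close> by \<open>1/(C q\<^sup>k)\<close> and leaves the end points unchanged.
\<close>

definition aa_weight ::
  "complex \<Rightarrow> complex \<Rightarrow> complex \<Rightarrow> complex \<Rightarrow> complex \<Rightarrow> complex \<Rightarrow> complex" where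
  "aa_weight q X Y A B u =
     qpoch_inf q (q * X * u) * qpoch_inf q (q * Y * u) / (qpoch_inf q (A * u) * qpoch_inf q (B * u))"

text \<open>
  Convergence along \<open>C q\<^sup>n\<close> suffices for the convergence of the Jackson sum and, unlike summability,
  is preserved by products.
\<close>

definition jconv :: "complex \<Rightarrow> (complex \<Rightarrow> complex) \<Rightarrow> complex \<Rightarrow> bool" where
  "jconv q f C \<longleftrightarrow> convergent (\<lambda>n. f (C * q ^ n))"

lemma aa_weight_commute: "aa_weight q X Y A B = aa_weight q X Y B A"
    and aa_weight_swap: "aa_weight q X Y A B = aa_weight q Y X A B"
  by (auto simp: aa_weight_def mult_ac fun_eq_iff)

lemma summable_geometric_times_Bseq:
  fixes x :: "nat \<Rightarrow> complex"
  assumes "norm q < 1" "Bseq x"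
  shows "summable (\<lambda>n. C * q ^ n * x n)"
proof -
  obtain K where K: "\<And>n. norm (x n) \<le> K"
    using assms(2) by (auto simp: Bseq_def)
  show ?thesis
  proof (rule summable_comparison_test)
    show "\<exists>N. \<forall>n\<ge>N. norm (C * q ^ n * x n) \<le> norm C * K * norm q ^ n"
    proof (intro exI[of _ 0] allI impI)
      fix n
      have "norm C * norm q ^ n * norm (x n) \<le> norm C * norm q ^ n * K"
        using K by (intro mult_left_mono) auto
      thus "norm (C * q ^ n * x n) \<le> norm C * K * norm q ^ n"
        by (simp add: norm_mult norm_power mult_ac)
    qed
    show "summable (\<lambda>n. norm C * K * norm q ^ n)"
      using assms(1) by (intro summable_mult summable_geometric) auto
  qed
qed

context
  fixes q :: complex
  assumes q: "norm q < 1" and q0: "q \<noteq> 0"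
begin

lemma jackson_summable:
  assumes "jconv q f C"
  shows "summable (\<lambda>n. C * q ^ n * f (C * q ^ n))"
  using assms convergent_imp_Bseq unfolding jconv_def
  by (intro summable_geometric_times_Bseq q) blast

lemma jconv_mult: "jconv q f C \<Longrightarrow> jconv q g C \<Longrightarrow> jconv q (\<lambda>u. f u * g u) C"
  by (auto simp: jconv_def intro: convergent_mult)

lemma jconv_id: "jconv q (\<lambda>u. u) C"
  unfolding jconv_def using tendsto_mult_qpower_zero[OF q] convergent_def by blast

lemma aa_weight_tendsto:
  assumes "u \<longlonglongrightarrow> 0"
  shows "(\<lambda>n. aa_weight q X Y A B (u n)) \<longlonglongrightarrow> 1"
proof -
  have "(\<lambda>n. aa_weight q X Y A B (u n)) \<longlonglongrightarrow>
          qpoch_inf q (q * X * 0) * qpoch_inf q (q * Y * 0) / (qpoch_inf q (A * 0) * qpoch_inf q (B * 0))"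
    unfolding aa_weight_def by (intro tendsto_intros q assms) auto
  thus ?thesis
    by simp
qed

lemma jconv_aa_weight: "jconv q (aa_weight q X Y A B) C"
  unfolding jconv_def using aa_weight_tendsto[OF tendsto_mult_qpower_zero[OF q]] convergent_def by blast

lemma jconv_qnewton: "jconv q (qnewton q c k) C"
proof -
  have "(\<lambda>n. qnewton q c k (C * q ^ n)) \<longlonglongrightarrow> qnewton q c k 0"
    unfolding qnewton_def by (intro tendsto_intros tendsto_mult_qpower_zero q)
  thus ?thesis
    unfolding jconv_def convergent_def by blast
qed

lemma jackson_linear:
  assumes "jconv q f C" "jconv q g C"
  shows "jackson q (\<lambda>u. a * f u + b * g u) C = a * jackson q f C + b * jackson q g C"
proof -
  note s = assms[THEN jackson_summable]
  have "a * jackson q f C + b * jackson q g C =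
          (\<Sum>n. a * (C * q ^ n * f (C * q ^ n)) + b * (C * q ^ n * g (C * q ^ n)))"
    unfolding jackson_def
    by (simp only: suminf_mult[OF s(1)] suminf_mult[OF s(2)] suminf_add[OF s[THEN summable_mult], symmetric])
  also have "\<dots> = jackson q (\<lambda>u. a * f u + b * g u) C"
    unfolding jackson_def by (intro suminf_cong) (simp add: algebra_simps)
  finally show ?thesis ..
qed

lemma jackson_between_linear:
  assumes "jconv q f C" "jconv q g C" "jconv q f D" "jconv q g D"
  shows "jackson_between q (\<lambda>u. a * f u + b * g u) C D =
           a * jackson_between q f C D + b * jackson_between q g C D"
  unfolding jackson_between_def using assms by (simp add: jackson_linear algebra_simps)

lemma jackson_cong:
  assumes "\<And>n. f (C * q ^ n) = g (C * q ^ n)"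
  shows "jackson q f C = jackson q g C"
  unfolding jackson_def using assms by simp

lemma jackson_telescope:
  assumes "(\<lambda>n. H (C * q ^ n)) \<longlonglongrightarrow> h"
    and "\<And>n. C * q ^ n * f (C * q ^ n) = H (C * q ^ n) - H (C * q ^ n * q)"
  shows "jackson q f C = H C - h"
proof -
  have "(\<lambda>n. H (C * q ^ n) - H (C * q ^ Suc n)) sums (H (C * q ^ 0) - h)"
    by (rule telescope_sums'[OF assms(1)])
  thus ?thesis
    unfolding jackson_def assms(2) by (simp add: sums_iff mult_ac)
qed

text \<open>
  The function \<open>H(u) = (Xu, Yu; q)\<^sub>\<infinity> / (Au, Bu; q)\<^sub>\<infinity>\<close> satisfies
  \<open>H(u) - H(qu) = u w(u) (A + B - X - Y + u (XY - AB))\<close> with the weight \<open>w\<close>. Summing along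
  \<open>C q\<^sup>n\<close> telescopes to \<open>H(C) - H(0)\<close>.
\<close>

lemma jackson_aa_weight_moments:
  assumes "qpoch_inf q (A * C) \<noteq> 0" "qpoch_inf q (B * C) \<noteq> 0"
  shows "(A + B - X - Y) * jackson q (aa_weight q X Y A B) C +
         (X * Y - A * B) * jackson q (\<lambda>u. u * aa_weight q X Y A B u) C =
         qpoch_inf q (X * C) * qpoch_inf q (Y * C) / (qpoch_inf q (A * C) * qpoch_inf q (B * C)) - 1"
proof -
  let ?G = "aa_weight q X Y A B"
  define H where "H u = qpoch_inf q (X * u) * qpoch_inf q (Y * u) / (qpoch_inf q (A * u) * qpoch_inf q (B * u))" for u
  have "(\<lambda>n. H (C * q ^ n)) \<longlonglongrightarrow> 
          qpoch_inf q (X * 0) * qpoch_inf q (Y * 0) / (qpoch_inf q (A * 0) * qpoch_inf q (B * 0))"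
    unfolding H_def by (intro tendsto_intros tendsto_mult_qpower_zero q) auto
  hence lim: "(\<lambda>n. H (C * q ^ n)) \<longlonglongrightarrow> 1"
    by simp
  have "jackson q (\<lambda>u. (A + B - X - Y) * ?G u + (X * Y - A * B) * (u * ?G u)) C = H C - 1"
  proof (rule jackson_telescope[OF lim])
    fix n
    define v where "v = C * q ^ n"
    have "qpoch_inf q (A * v) \<noteq> 0" "qpoch_inf q (B * v) \<noteq> 0"
      using assms[THEN qpoch_inf_shift_nonzero[OF q], of n] by (simp_all add: v_def mult_ac)
    moreover have r: "qpoch_inf q (z * v) = (1 - z * v) * qpoch_inf q (z * (v * q))" for z
      using qpoch_inf_rec[OF q, of "z * v"] by (simp add: mult_ac)
    ultimately have nz: "1 - A * v \<noteq> 0" "1 - B * v \<noteq> 0"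
         "qpoch_inf q (A * (v * q)) \<noteq> 0" "qpoch_inf q (B * (v * q)) \<noteq> 0"
      by auto
    define x y a b where "x = qpoch_inf q (X * (v * q))" and "y = qpoch_inf q (Y * (v * q))"
      and "a = qpoch_inf q (A * (v * q))" and "b = qpoch_inf q (B * (v * q))"
    define g where "g = x * y / ((1 - A * v) * a * ((1 - B * v) * b))"
    have G: "?G v = g"
      unfolding aa_weight_def r[of A] r[of B] x_def y_def a_def b_def g_def by (simp add: mult_ac)
    have H1: "H v = (1 - X * v) * (1 - Y * v) * g"
      unfolding H_def r x_def y_def a_def b_def g_def by (simp add: mult_ac)
    have H2: "H (v * q) = (1 - A * v) * (1 - B * v) * g"
      using nz unfolding H_def g_def x_def[symmetric] y_def[symmetric] a_def[symmetric] b_def[symmetric]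
      by (simp add: divide_simps)
    have "v * ((A + B - X - Y) * ?G v + (X * Y - A * B) * (v * ?G v)) = H v - H (v * q)"
      unfolding G H1 H2 by (simp add: algebra_simps)
    thus "C * q ^ n * ((A + B - X - Y) * ?G (C * q ^ n) + (X * Y - A * B) * (C * q ^ n * ?G (C * q ^ n))) =
            H (C * q ^ n) - H (C * q ^ n * q)"
      by (simp add: v_def)
  qed
  thus ?thesis
    by (subst (asm) jackson_linear) (auto simp: H_def intro: jconv_mult jconv_id jconv_aa_weight)
qed

text \<open>
  If \<open>H\<close> vanishes at both end points then only the contributions of \<open>H(0)\<close> remain, and they
  cancel. This determines the ratio of the first two moments.
\<close>

lemma jackson_between_aa_weight_moments:
  assumes "qpoch_inf q (A * C) \<noteq> 0" "qpoch_inf q (B * C) \<noteq> 0"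
    and "qpoch_inf q (A * D) \<noteq> 0" "qpoch_inf q (B * D) \<noteq> 0"
    and "qpoch_inf q (X * C) * qpoch_inf q (Y * C) = 0" "qpoch_inf q (X * D) * qpoch_inf q (Y * D) = 0"
  shows "(A + B - X - Y) * jackson_between q (aa_weight q X Y A B) C D +
         (X * Y - A * B) * jackson_between q (\<lambda>u. u * aa_weight q X Y A B u) C D = 0"
proof -
  have "(A + B - X - Y) * jackson q (aa_weight q X Y A B) C +
         (X * Y - A * B) * jackson q (\<lambda>u. u * aa_weight q X Y A B u) C =
        (A + B - X - Y) * jackson q (aa_weight q X Y A B) D +
         (X * Y - A * B) * jackson q (\<lambda>u. u * aa_weight q X Y A B u) D"
    using assms by (subst (1 2) jackson_aa_weight_moments) auto
  thus ?thesis
    unfolding jackson_between_def by (simp add: algebra_simps)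
qed

lemma moment_relation_clear_denominators:
  fixes A B c D m0 m1 :: complex
  assumes "c \<noteq> 0" "D \<noteq> 0"
    and "(A + B - 1 / c - 1 / D) * m0 + ((1 / c) * (1 / D) - A * B) * m1 = 0"
  shows "((A + B) * c * D - D - c) * m0 + (1 - A * B * c * D) * m1 = 0"
proof -
  have "((A + B) * c * D - D - c) * m0 + (1 - A * B * c * D) * m1 =
          c * D * ((A + B - 1 / c - 1 / D) * m0 + ((1 / c) * (1 / D) - A * B) * m1)"
    using assms(1,2) by (simp add: field_simps)
  thus ?thesis
    using assms(3) by simp
qed

lemma qpoch_inf_1 [simp]: "qpoch_inf q 1 = 0"
  using qpoch_inf_rec[OF q, of 1] by simp

text \<open>
  Replacing \<open>A\<close> by \<open>Aq\<close> multiplies the weight by \<open>1 - Au\<close>, so the new integral is a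
  combination of the first two moments of the old one.
\<close>

lemma jackson_between_aa_weight_step:
  assumes "C \<noteq> 0" "D \<noteq> 0"
    and nz: "qpoch_inf q (A * C) \<noteq> 0" "qpoch_inf q (B * C) \<noteq> 0"
            "qpoch_inf q (A * D) \<noteq> 0" "qpoch_inf q (B * D) \<noteq> 0"
  shows "(1 - A * C) * (1 - A * D) * jackson_between q (aa_weight q (1 / C) (1 / D) A B) C D =
         (1 - A * B * C * D) * jackson_between q (aa_weight q (1 / C) (1 / D) (A * q) B) C D"
proof -
  let ?G = "aa_weight q (1 / C) (1 / D) A B"
  let ?J = "\<lambda>f. jackson_between q f C D"
  have *: "jackson q (aa_weight q (1 / C) (1 / D) (A * q) B) c =
             jackson q (\<lambda>u. 1 * ?G u + (- A) * (u * ?G u)) c"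
    if "qpoch_inf q (A * c) \<noteq> 0" for c
  proof (rule jackson_cong)
    fix n
    define v where "v = c * q ^ n"
    have "qpoch_inf q (A * v) \<noteq> 0"
      using qpoch_inf_shift_nonzero[OF q that, of n] by (simp add: v_def mult_ac)
    moreover have r: "qpoch_inf q (A * v) = (1 - A * v) * qpoch_inf q (A * q * v)"
      using qpoch_inf_rec[OF q, of "A * v"] by (simp add: mult_ac)
    ultimately have nz: "1 - A * v \<noteq> 0" "qpoch_inf q (A * q * v) \<noteq> 0"
      by auto
    have "?G v = aa_weight q (1 / C) (1 / D) (A * q) B v / (1 - A * v)"
      unfolding aa_weight_def r by (simp add: mult_ac)
    hence "(1 - A * v) * ?G v = aa_weight q (1 / C) (1 / D) (A * q) B v"
      using nz by simp
    thus "aa_weight q (1 / C) (1 / D) (A * q) B (c * q ^ n) =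
            1 * ?G (c * q ^ n) + (- A) * (c * q ^ n * ?G (c * q ^ n))"
      by (simp add: v_def algebra_simps)
  qed
  have "?J (aa_weight q (1 / C) (1 / D) (A * q) B) = ?J (\<lambda>u. 1 * ?G u + (- A) * (u * ?G u))"
    unfolding jackson_between_def *[OF nz(1)] *[OF nz(3)] ..
  also have "\<dots> = 1 * ?J ?G + (- A) * ?J (\<lambda>u. u * ?G u)"
    by (intro jackson_between_linear jconv_mult jconv_id jconv_aa_weight)
  finally have m1: "?J (aa_weight q (1 / C) (1 / D) (A * q) B) = ?J ?G - A * ?J (\<lambda>u. u * ?G u)"
    by simp
  have "(A + B - 1 / C - 1 / D) * ?J ?G + ((1 / C) * (1 / D) - A * B) * ?J (\<lambda>u. u * ?G u) = 0"
    using assms by (intro jackson_between_aa_weight_moments) auto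
  hence "((A + B) * C * D - D - C) * ?J ?G + (1 - A * B * C * D) * ?J (\<lambda>u. u * ?G u) = 0"
    by (rule moment_relation_clear_denominators[OF assms(1,2)])
  thus ?thesis
    unfolding m1 by algebra
qed

text \<open>
  The factor \<open>1 / (A q\<^sup>m u; q)\<^sub>\<infinity>\<close> at \<open>u = C q\<^sup>n\<close> depends on \<open>m + n\<close> only. This makes the bound
  that dominated convergence needs uniform in \<open>m\<close>.
\<close>

lemma jackson_aa_weight_tendsto:
  assumes "qpoch_inf q (A * C) \<noteq> 0" "qpoch_inf q (B * C) \<noteq> 0"
  shows "(\<lambda>m. jackson q (aa_weight q X Y (A * q ^ m) B) C) \<longlonglongrightarrow> jackson q (aa_weight q X Y 0 B) C"
proof -
  obtain K where K: "\<And>n. norm (qpoch_inf q (q * X * (C * q ^ n)) * qpoch_inf q (q * Y * (C * q ^ n)) / qpoch_inf q (B * (C * q ^ n))) \<le> K"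
  proof -
    have "(\<lambda>n. qpoch_inf q (q * X * (C * q ^ n)) * qpoch_inf q (q * Y * (C * q ^ n)) / qpoch_inf q (B * (C * q ^ n)))
            \<longlonglongrightarrow> qpoch_inf q (q * X * 0) * qpoch_inf q (q * Y * 0) / qpoch_inf q (B * 0)"
      by (intro tendsto_intros tendsto_mult_qpower_zero q) auto
    from convergent_imp_Bseq[OF convergentI[OF this]] show ?thesis
      using that by (auto elim!: BseqE)
  qed
  obtain L where L: "\<And>n. norm (inverse (qpoch_inf q (A * C * q ^ n))) \<le> L"
  proof -
    have "(\<lambda>n. inverse (qpoch_inf q (A * C * q ^ n))) \<longlonglongrightarrow> inverse (qpoch_inf q 0)"
      by (intro tendsto_intros tendsto_mult_qpower_zero q) auto
    from convergent_imp_Bseq[OF convergentI[OF this]] show ?thesis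
      using that by (auto elim!: BseqE)
  qed
  have bound: "norm (aa_weight q X Y (A * q ^ m) B (C * q ^ n)) \<le> K * L" for m n
  proof -
    have "aa_weight q X Y (A * q ^ m) B (C * q ^ n) =
            (qpoch_inf q (q * X * (C * q ^ n)) * qpoch_inf q (q * Y * (C * q ^ n)) / qpoch_inf q (B * (C * q ^ n)))
            * inverse (qpoch_inf q (A * C * q ^ (m + n)))"
      unfolding aa_weight_def by (simp add: power_add divide_inverse mult_ac)
    hence "norm (aa_weight q X Y (A * q ^ m) B (C * q ^ n)) =
            norm (qpoch_inf q (q * X * (C * q ^ n)) * qpoch_inf q (q * Y * (C * q ^ n)) / qpoch_inf q (B * (C * q ^ n)))
            * norm (inverse (qpoch_inf q (A * C * q ^ (m + n))))"
      by (simp only: norm_mult)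
    also have "\<dots> \<le> K * L"
      by (rule mult_mono[OF K L order_trans[OF norm_ge_zero K[of n]]]) simp
    finally show ?thesis .
  qed
  show ?thesis
    unfolding jackson_def
  proof (rule conjunct2[OF conjunct2[OF tannerys_theorem[where M = "\<lambda>n. norm C * (K * L) * norm q ^ n"]]])
    fix n
    have "(\<lambda>m. aa_weight q X Y (A * q ^ m) B (C * q ^ n)) \<longlonglongrightarrow> aa_weight q X Y 0 B (C * q ^ n)"
    proof (cases "qpoch_inf q (B * (C * q ^ n)) = 0")
      case False
      have "(\<lambda>m. aa_weight q X Y (A * q ^ m) B (C * q ^ n)) \<longlonglongrightarrow>
              qpoch_inf q (q * X * (C * q ^ n)) * qpoch_inf q (q * Y * (C * q ^ n)) /
              (qpoch_inf q (0 * (C * q ^ n)) * qpoch_inf q (B * (C * q ^ n)))"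
        unfolding aa_weight_def by (intro tendsto_intros tendsto_mult_qpower_zero q) (use False in auto)
      thus ?thesis
        by (simp add: aa_weight_def)
    qed (simp add: aa_weight_def)
    thus "(\<lambda>m. C * q ^ n * aa_weight q X Y (A * q ^ m) B (C * q ^ n)) \<longlonglongrightarrow>
            C * q ^ n * aa_weight q X Y 0 B (C * q ^ n)"
      by (intro tendsto_intros)
  next
    show "summable (\<lambda>n. norm C * (K * L) * norm q ^ n)"
      using q by (intro summable_mult summable_geometric) auto
    have "norm (C * q ^ n * aa_weight q X Y (A * q ^ m) B (C * q ^ n)) \<le> norm C * (K * L) * norm q ^ n" for n m
      using mult_left_mono[OF bound[of m n], of "norm C * norm q ^ n"]
      by (simp add: norm_mult norm_power mult_ac)
    thus "\<forall>\<^sub>F (n, m) in sequentially \<times>\<^sub>F sequentially.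
            norm (C * q ^ n * aa_weight q X Y (A * q ^ m) B (C * q ^ n)) \<le> norm C * (K * L) * norm q ^ n"
      by (intro always_eventually) auto
  qed simp
qed

lemma jackson_between_aa_weight_reduce:
  assumes "C \<noteq> 0" "D \<noteq> 0"
    and nz: "qpoch_inf q (A * C) \<noteq> 0" "qpoch_inf q (B * C) \<noteq> 0"
            "qpoch_inf q (A * D) \<noteq> 0" "qpoch_inf q (B * D) \<noteq> 0"
  shows "qpoch_inf q (A * C) * qpoch_inf q (A * D) *
           jackson_between q (aa_weight q (1 / C) (1 / D) A B) C D =
         qpoch_inf q (A * B * C * D) * jackson_between q (aa_weight q (1 / C) (1 / D) 0 B) C D"
proof -
  let ?I = "\<lambda>A. jackson_between q (aa_weight q (1 / C) (1 / D) A B) C D"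
  have it: "qpoch q (A * C) n * qpoch q (A * D) n * ?I A = qpoch q (A * B * C * D) n * ?I (A * q ^ n)" for n
  proof (induction n)
    case (Suc n)
    have "(1 - A * q ^ n * C) * (1 - A * q ^ n * D) * ?I (A * q ^ n) =
            (1 - A * q ^ n * B * C * D) * ?I (A * q ^ n * q)"
      using qpoch_inf_shift_nonzero[OF q nz(1), of n] qpoch_inf_shift_nonzero[OF q nz(3), of n]
      by (intro jackson_between_aa_weight_step assms) (simp_all add: mult_ac)
    note step = this
    have "qpoch q (A * C) (Suc n) * qpoch q (A * D) (Suc n) * ?I A =
       (1 - A * q ^ n * C) * (1 - A * q ^ n * D) * (qpoch q (A * C) n * qpoch q (A * D) n * ?I A)"
      by (simp add: qpoch_Suc mult_ac)
    also have "\<dots> = qpoch q (A * B * C * D) n * ((1 - A * q ^ n * C) * (1 - A * q ^ n * D) * ?I (A * q ^ n))"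
      unfolding Suc.IH by (simp only: mult_ac)
    also have "\<dots> = qpoch q (A * B * C * D) (Suc n) * ?I (A * q ^ Suc n)"
      unfolding step by (simp add: qpoch_Suc mult_ac)
    finally show ?case .
  qed simp
  have "(\<lambda>n. ?I (A * q ^ n)) \<longlonglongrightarrow> ?I 0"
    unfolding jackson_between_def by (intro tendsto_diff jackson_aa_weight_tendsto nz)
  hence "(\<lambda>n. qpoch q (A * B * C * D) n * ?I (A * q ^ n)) \<longlonglongrightarrow> qpoch_inf q (A * B * C * D) * ?I 0"
    by (intro tendsto_intros qpoch_tendsto q)
  moreover have "(\<lambda>n. qpoch q (A * C) n * qpoch q (A * D) n * ?I A) \<longlonglongrightarrow>
                   qpoch_inf q (A * C) * qpoch_inf q (A * D) * ?I A"
    by (intro tendsto_intros qpoch_tendsto q)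
  ultimately show ?thesis
    unfolding it using LIMSEQ_unique by blast
qed

text \<open>
  Both parameters \<open>A, B\<close> equal to 0. The evaluation goes backwards through the reduction
  from \<open>A = q/D\<close>, because there the weight collapses to \<open>(qu/C;q)\<^sub>\<infinity>\<close>, whose Jackson sum
  telescopes. The condition on \<open>qC/D\<close> keeps the denominator of that weight away from 0.
\<close>

lemma jackson_between_base_aux:
  assumes "C \<noteq> 0" "D \<noteq> 0" "qpoch_inf q (q * C / D) \<noteq> 0"
  shows "jackson_between q (aa_weight q (1 / C) (1 / D) 0 0) C D =
         C * qpoch_inf q q * qpoch_inf q (D / C) * qpoch_inf q (q * C / D)"
proof -
  let ?G = "aa_weight q (1 / C) (1 / D) (q / D) 0"
  have *: "jackson q ?G c = C * (1 - qpoch_inf q (c / C))" if "qpoch_inf q (q * c / D) \<noteq> 0" for c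
  proof -
    have "jackson q ?G c = (- C * qpoch_inf q (c / C)) - (- C)"
    proof (rule jackson_telescope)
      have "(\<lambda>n. - C * qpoch_inf q (c * q ^ n / C)) \<longlonglongrightarrow> - C * qpoch_inf q (0 / C)"
        by (intro tendsto_intros tendsto_mult_qpower_zero q assms)
      thus "(\<lambda>n. - C * qpoch_inf q (c * q ^ n / C)) \<longlonglongrightarrow> - C"
        by simp
      fix n
      define v where "v = c * q ^ n"
      have "qpoch_inf q (q * v / D) \<noteq> 0"
        using qpoch_inf_shift_nonzero[OF q that, of n] by (simp add: v_def mult_ac)
      hence "?G v = qpoch_inf q (v * q / C)"
        by (simp add: aa_weight_def mult_ac)
      moreover have "qpoch_inf q (v / C) = (1 - v / C) * qpoch_inf q (v * q / C)"
        using qpoch_inf_rec[OF q, of "v / C"] by simp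
      ultimately have "v * ?G v = - C * qpoch_inf q (v / C) - (- C * qpoch_inf q (v * q / C))"
        using assms(1) by (simp add: field_simps)
      thus "c * q ^ n * ?G (c * q ^ n) = - C * qpoch_inf q (c * q ^ n / C) - (- C * qpoch_inf q (c * q ^ n * q / C))"
        by (simp add: v_def)
    qed
    thus ?thesis
      by (simp add: algebra_simps)
  qed
  have qq: "qpoch_inf q q \<noteq> 0"
    by (rule qpoch_inf_nonzero[OF q q])
  have "jackson_between q ?G C D = C * qpoch_inf q (D / C)"
    unfolding jackson_between_def using assms qq by (subst (1 2) *) (auto simp: algebra_simps)
  moreover have "qpoch_inf q (q / D * C) * qpoch_inf q (q / D * D) * jackson_between q ?G C D =
          qpoch_inf q (q / D * 0 * C * D) * jackson_between q (aa_weight q (1 / C) (1 / D) 0 0) C D"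
    using assms qq by (intro jackson_between_aa_weight_reduce) auto
  ultimately show ?thesis
    using assms(2) by (simp add: mult_ac)
qed

text \<open>
  If the condition of the previous lemma fails for the pair \<open>C, D\<close>, it holds for \<open>D, C\<close>, since
  otherwise a positive power of \<open>q\<close> would be 1. In that case both sides are 0.
\<close>

lemma jackson_between_base:
  assumes "C \<noteq> 0" "D \<noteq> 0"
  shows "jackson_between q (aa_weight q (1 / C) (1 / D) 0 0) C D =
         C * qpoch_inf q q * qpoch_inf q (D / C) * qpoch_inf q (q * C / D)"
proof (cases "qpoch_inf q (q * C / D) = 0")
  case True
  then obtain k where k: "q * C / D * q ^ k = 1"
    using qpoch_inf_eq_0_iff[OF q] by blast
  have "qpoch_inf q (q * D / C) \<noteq> 0"
  proof
    assume "qpoch_inf q (q * D / C) = 0"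
    then obtain j where "q * D / C * q ^ j = 1"
      using qpoch_inf_eq_0_iff[OF q] by blast
    hence "(q * C / D * q ^ k) * (q * D / C * q ^ j) = 1"
      using k by simp
    hence "q ^ (Suc (Suc (k + j))) = 1"
      using assms q0 by (simp add: power_add field_simps)
    moreover have "norm (q ^ Suc (Suc (k + j))) < 1"
      unfolding norm_power using q q0 by (intro power_Suc_less_one) auto
    ultimately show False
      by simp
  qed
  hence "jackson_between q (aa_weight q (1 / D) (1 / C) 0 0) D C =
         D * qpoch_inf q q * qpoch_inf q (C / D) * qpoch_inf q (q * D / C)"
    using assms by (intro jackson_between_base_aux)
  also have "qpoch_inf q (C / D) = (1 - C / D) * qpoch_inf q (q * C / D)"
    using qpoch_inf_rec[OF q, of "C / D"] by (simp add: mult_ac)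
  finally have "jackson_between q (aa_weight q (1 / C) (1 / D) 0 0) C D = 0"
    using True by (simp add: jackson_between_def aa_weight_swap[of q "1 / D"])
  thus ?thesis
    using True by simp
qed (rule jackson_between_base_aux[OF assms])

theorem andrews_askey:
  assumes "C \<noteq> 0" "D \<noteq> 0"
    and nz: "qpoch_inf q (A * C) \<noteq> 0" "qpoch_inf q (B * C) \<noteq> 0"
            "qpoch_inf q (A * D) \<noteq> 0" "qpoch_inf q (B * D) \<noteq> 0"
  shows "jackson_between q (aa_weight q (1 / C) (1 / D) A B) C D =
         C * qpoch_inf q q * qpoch_inf q (D / C) * qpoch_inf q (q * C / D) * qpoch_inf q (A * B * C * D) /
         (qpoch_inf q (A * C) * qpoch_inf q (A * D) * qpoch_inf q (B * C) * qpoch_inf q (B * D))"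
proof -
  let ?I = "\<lambda>A B. jackson_between q (aa_weight q (1 / C) (1 / D) A B) C D"
  have 1: "qpoch_inf q (A * C) * qpoch_inf q (A * D) * ?I A B = qpoch_inf q (A * B * C * D) * ?I 0 B"
    using assms by (rule jackson_between_aa_weight_reduce)
  have "qpoch_inf q (B * C) * qpoch_inf q (B * D) * ?I B 0 = qpoch_inf q (B * 0 * C * D) * ?I 0 0"
    using assms by (intro jackson_between_aa_weight_reduce) auto
  moreover have "?I B 0 = ?I 0 B"
    by (subst aa_weight_commute) rule
  ultimately have 2: "qpoch_inf q (B * C) * qpoch_inf q (B * D) * ?I 0 B = ?I 0 0"
    by simp
  have "qpoch_inf q (A * C) * qpoch_inf q (A * D) * (qpoch_inf q (B * C) * qpoch_inf q (B * D)) * ?I A B =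
          qpoch_inf q (B * C) * qpoch_inf q (B * D) * (qpoch_inf q (A * C) * qpoch_inf q (A * D) * ?I A B)"
    by (simp only: mult_ac)
  also have "\<dots> = qpoch_inf q (A * B * C * D) * (qpoch_inf q (B * C) * qpoch_inf q (B * D) * ?I 0 B)"
    unfolding 1 by (simp only: mult_ac)
  finally have "qpoch_inf q (A * C) * qpoch_inf q (A * D) * (qpoch_inf q (B * C) * qpoch_inf q (B * D)) * ?I A B =
      qpoch_inf q (A * B * C * D) * ?I 0 0"
    unfolding 2 .
  thus ?thesis
    unfolding jackson_between_base[OF assms(1,2)] using nz by (simp add: divide_simps mult_ac)
qed

lemma qnewton_aa_weight:
  assumes "C \<noteq> 0"
  shows "\<exists>\<kappa>. \<forall>u. qnewton q C k u * aa_weight q (1 / C) Y A B u = \<kappa> * aa_weight q (1 / (C * q ^ k)) Y A B u"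
proof (induction k)
  case 0
  show ?case
    by (intro exI[of _ 1]) simp
next
  case (Suc k)
  then obtain \<kappa> where \<kappa>: "\<And>u. qnewton q C k u * aa_weight q (1 / C) Y A B u = \<kappa> * aa_weight q (1 / (C * q ^ k)) Y A B u"
    by blast
  have "qnewton q C (Suc k) u * aa_weight q (1 / C) Y A B u =
          (- C * q ^ k * \<kappa>) * aa_weight q (1 / (C * q ^ Suc k)) Y A B u" for u
  proof -
    have "q * (1 / (C * q ^ Suc k)) * u = u / (C * q ^ k)"
      using q0 by simp
    hence "qpoch_inf q (q * (1 / (C * q ^ Suc k)) * u) =
            (1 - u / (C * q ^ k)) * qpoch_inf q (q * (1 / (C * q ^ k)) * u)"
      using qpoch_inf_rec[OF q, of "u / (C * q ^ k)"] by (simp add: mult_ac)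
    hence "aa_weight q (1 / (C * q ^ Suc k)) Y A B u =
            (1 - u / (C * q ^ k)) * aa_weight q (1 / (C * q ^ k)) Y A B u"
      unfolding aa_weight_def by simp
    hence "(- C * q ^ k * \<kappa>) * aa_weight q (1 / (C * q ^ Suc k)) Y A B u =
        (- C * q ^ k * (1 - u / (C * q ^ k))) * (\<kappa> * aa_weight q (1 / (C * q ^ k)) Y A B u)"
      by (simp only: mult_ac)
    also have "- C * q ^ k * (1 - u / (C * q ^ k)) = u - C * q ^ k"
      using assms q0 by (simp add: field_simps)
    finally have "(- C * q ^ k * \<kappa>) * aa_weight q (1 / (C * q ^ Suc k)) Y A B u =
        (u - C * q ^ k) * (\<kappa> * aa_weight q (1 / (C * q ^ k)) Y A B u)" .
    thus ?thesis
      unfolding \<kappa>[symmetric] qnewton_Suc by (simp add: mult_ac)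
  qed
  thus ?case
    by blast
qed

text \<open>
  The moment relation for the end points \<open>C, D\<close> and \<open>X = 1/(C q\<^sup>k)\<close>. It applies because
  \<open>(XC;q)\<^sub>\<infinity> = (q\<^bsup>-k\<^esup>;q)\<^sub>\<infinity> = 0\<close>.
\<close>

lemma jackson_between_qnewton_step:
  assumes "C \<noteq> 0" "D \<noteq> 0"
    and nz: "qpoch_inf q (A * C) \<noteq> 0" "qpoch_inf q (B * C) \<noteq> 0"
            "qpoch_inf q (A * D) \<noteq> 0" "qpoch_inf q (B * D) \<noteq> 0"
  shows "(1 - A * B * C * D * q ^ k) *
           jackson_between q (\<lambda>u. qnewton q C (Suc k) u * aa_weight q (1 / C) (1 / D) A B u) C D =
         D * (1 - A * C * q ^ k) * (1 - B * C * q ^ k) *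
           jackson_between q (\<lambda>u. qnewton q C k u * aa_weight q (1 / C) (1 / D) A B u) C D"
proof -
  define c where "c = C * q ^ k"
  let ?G = "aa_weight q (1 / c) (1 / D) A B"
  let ?J = "\<lambda>f. jackson_between q f C D"
  obtain \<kappa> where \<kappa>: "\<And>u. qnewton q C k u * aa_weight q (1 / C) (1 / D) A B u = \<kappa> * ?G u"
    using qnewton_aa_weight[OF assms(1)] unfolding c_def by blast
  have M0: "?J (\<lambda>u. qnewton q C k u * aa_weight q (1 / C) (1 / D) A B u) = \<kappa> * ?J ?G"
    unfolding \<kappa> using jackson_between_linear[where a = \<kappa> and b = 0 and f = ?G and g = ?G] jconv_aa_weight by simp
  have "qnewton q C (Suc k) u * aa_weight q (1 / C) (1 / D) A B u = \<kappa> * (u * ?G u) + (- \<kappa> * c) * ?G u" for u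
  proof -
    have "qnewton q C (Suc k) u * aa_weight q (1 / C) (1 / D) A B u =
            (u - c) * (qnewton q C k u * aa_weight q (1 / C) (1 / D) A B u)"
      by (simp add: qnewton_Suc c_def)
    thus ?thesis
      unfolding \<kappa> by (simp add: algebra_simps)
  qed
  hence "?J (\<lambda>u. qnewton q C (Suc k) u * aa_weight q (1 / C) (1 / D) A B u) =
           ?J (\<lambda>u. \<kappa> * (u * ?G u) + (- \<kappa> * c) * ?G u)"
    by presburger
  also have "\<dots> = \<kappa> * ?J (\<lambda>u. u * ?G u) + (- \<kappa> * c) * ?J ?G"
    by (intro jackson_between_linear jconv_mult jconv_id jconv_aa_weight)
  finally have M1: "?J (\<lambda>u. qnewton q C (Suc k) u * aa_weight q (1 / C) (1 / D) A B u) =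
           \<kappa> * ?J (\<lambda>u. u * ?G u) - \<kappa> * c * ?J ?G"
    by simp
  have "1 / c * C * q ^ k = 1"
    using assms q0 by (simp add: c_def)
  hence "qpoch_inf q (1 / c * C) = 0"
    using qpoch_inf_eq_0_iff[OF q] by blast
  hence "(A + B - 1 / c - 1 / D) * ?J ?G + ((1 / c) * (1 / D) - A * B) * ?J (\<lambda>u. u * ?G u) = 0"
    using assms by (intro jackson_between_aa_weight_moments) auto
  hence "((A + B) * c * D - D - c) * ?J ?G + (1 - A * B * c * D) * ?J (\<lambda>u. u * ?G u) = 0"
    using assms(1) q0 by (intro moment_relation_clear_denominators[OF _ assms(2)]) (auto simp: c_def)
  hence "(1 - A * B * c * D) * (\<kappa> * ?J (\<lambda>u. u * ?G u) - \<kappa> * c * ?J ?G) =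
           D * (1 - A * c) * (1 - B * c) * (\<kappa> * ?J ?G)"
    by algebra
  thus ?thesis
    unfolding M0 M1 by (simp add: c_def mult_ac)
qed

lemma jackson_between_qnewton:
  assumes "C \<noteq> 0" "D \<noteq> 0"
    and nz: "qpoch_inf q (A * C) \<noteq> 0" "qpoch_inf q (B * C) \<noteq> 0"
            "qpoch_inf q (A * D) \<noteq> 0" "qpoch_inf q (B * D) \<noteq> 0"
    and ABCD: "\<And>k. qpoch q (A * B * C * D) k \<noteq> 0"
  shows "jackson_between q (\<lambda>u. qnewton q C k u * aa_weight q (1 / C) (1 / D) A B u) C D =
         D ^ k * qpoch q (A * C) k * qpoch q (B * C) k / qpoch q (A * B * C * D) k *
           jackson_between q (aa_weight q (1 / C) (1 / D) A B) C D"
proof (induction k)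
  case (Suc k)
  have "1 - A * B * C * D * q ^ k \<noteq> 0" "qpoch q (A * B * C * D) k \<noteq> 0"
    using ABCD[of "Suc k"] ABCD[of k] by (auto simp: qpoch_Suc)
  thus ?case
    using jackson_between_qnewton_step[OF assms(1-6), of k] unfolding Suc.IH
    by (simp add: qpoch_Suc divide_simps) (simp add: mult_ac)
qed simp

text \<open>
  Integration of the Newton series term by term, for an arbitrary weight. The end point \<open>c\<close> is kept
  apart from the base point \<open>C\<close> of the Newton polynomials, as the lemma is used at both end points.
\<close>

lemma jackson_qgauss_sums:
  assumes CEF: "\<And>k. qpoch q (C * E * F) k \<noteq> 0" and c: "norm (F * c) < 1"
    and w: "jconv q w c"
  shows "(\<lambda>k. qgauss_coeff q C E F k * jackson q (\<lambda>u. qnewton q C k u * w u) c) sums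
           jackson q (\<lambda>u. (\<Sum>k. qgauss_coeff q C E F k * qnewton q C k u) * w u) c"
proof -
  define a where "a k u = qgauss_coeff q C E F k * qnewton q C k u" for k u
  define Mj where "Mj = qgauss_majorant q C E F (norm c)"
  obtain K where K: "\<And>n. norm (w (c * q ^ n)) \<le> K"
    using convergent_imp_Bseq[OF w[unfolded jconv_def]] by (auto simp: Bseq_def)
  have small: "norm (c * q ^ n) \<le> norm c" for n
    using q power_le_one[of "norm q" n] by (simp add: norm_mult norm_power mult_left_le)
  have sM: "summable Mj"
    unfolding Mj_def using c by (intro summable_qgauss_majorant q CEF) (auto simp: norm_mult)
  have a_le: "norm (a k (c * q ^ n)) \<le> Mj k" for k n
    unfolding a_def Mj_def by (rule norm_qgauss_term_le[OF small])
  have sa: "summable (\<lambda>k. a k (c * q ^ n))" for n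
    by (rule summable_comparison_test[OF _ sM]) (use a_le in auto)
  have lin: "(\<Sum>k<m. qgauss_coeff q C E F k * jackson q (\<lambda>u. qnewton q C k u * w u) c) =
         jackson q (\<lambda>u. (\<Sum>k<m. a k u) * w u) c" for m
  proof (induction m)
    case (Suc m)
    have cv: "jconv q (\<lambda>u. (\<Sum>k<m. a k u) * w u) c"
    proof (intro jconv_mult w)
      show "jconv q (\<lambda>u. \<Sum>k<m. a k u) c"
        using jconv_qnewton unfolding jconv_def a_def
        by (intro convergent_sum convergent_mult convergent_const)
    qed
    have "jackson q (\<lambda>u. 1 * ((\<Sum>k<m. a k u) * w u) + qgauss_coeff q C E F m * (qnewton q C m u * w u)) c =
            1 * jackson q (\<lambda>u. (\<Sum>k<m. a k u) * w u) c +
            qgauss_coeff q C E F m * jackson q (\<lambda>u. qnewton q C m u * w u) c"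
      by (rule jackson_linear[OF cv jconv_mult[OF jconv_qnewton w]])
    thus ?case
      unfolding sum.lessThan_Suc Suc.IH by (simp add: a_def algebra_simps)
  qed (simp add: jackson_def)
  have "(\<lambda>m. jackson q (\<lambda>u. (\<Sum>k<m. a k u) * w u) c) \<longlonglongrightarrow>
          jackson q (\<lambda>u. (\<Sum>k. a k u) * w u) c"
    unfolding jackson_def
  proof (rule conjunct2[OF conjunct2[OF tannerys_theorem[where M = "\<lambda>n. norm c * (suminf Mj * K) * norm q ^ n"]]])
    show "(\<lambda>m. c * q ^ n * ((\<Sum>k<m. a k (c * q ^ n)) * w (c * q ^ n))) \<longlonglongrightarrow>
            c * q ^ n * ((\<Sum>k. a k (c * q ^ n)) * w (c * q ^ n))" for n
      by (intro tendsto_intros summable_LIMSEQ sa)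
    have "norm ((\<Sum>k<m. a k (c * q ^ n)) * w (c * q ^ n)) \<le> suminf Mj * K" for m n
    proof -
      have "norm (\<Sum>k<m. a k (c * q ^ n)) \<le> (\<Sum>k<m. Mj k)"
        by (intro sum_norm_le a_le)
      also have "\<dots> \<le> suminf Mj"
        using a_le order_trans[OF norm_ge_zero] by (intro sum_le_suminf sM) blast+
      finally have "norm (\<Sum>k<m. a k (c * q ^ n)) \<le> suminf Mj" .
      moreover from order_trans[OF norm_ge_zero this] have "0 \<le> suminf Mj" .
      ultimately show ?thesis
        unfolding norm_mult by (intro mult_mono K) auto
    qed
    hence "norm (c * q ^ n * ((\<Sum>k<m. a k (c * q ^ n)) * w (c * q ^ n))) \<le> norm c * (suminf Mj * K) * norm q ^ n" for n m
      using mult_left_mono[of "norm ((\<Sum>k<m. a k (c * q ^ n)) * w (c * q ^ n))" "suminf Mj * K" "norm c * norm q ^ n"]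
      by (simp add: norm_mult norm_power mult_ac)
    thus "\<forall>\<^sub>F (n, m) in sequentially \<times>\<^sub>F sequentially.
            norm (c * q ^ n * ((\<Sum>k<m. a k (c * q ^ n)) * w (c * q ^ n))) \<le> norm c * (suminf Mj * K) * norm q ^ n"
      by (intro always_eventually) auto
    show "summable (\<lambda>n. norm c * (suminf Mj * K) * norm q ^ n)"
      using q by (intro summable_mult summable_geometric) auto
  qed simp
  thus ?thesis
    unfolding sums_def lin by (simp add: a_def)
qed

text \<open>
  Term by term integration of the q-Gauss expansion. The recurrence in \<open>k\<close> supplies the factors
  \<open>(AC, BC; q)\<^sub>k D\<^sup>k / (ABCD; q)\<^sub>k\<close>, the coefficients of the expansion supply the others.
\<close>

theorem jackson_between_eq_phi32:
  assumes C: "C \<noteq> 0" and D: "D \<noteq> 0"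
    and nz: "qpoch_inf q (A * C) \<noteq> 0" "qpoch_inf q (B * C) \<noteq> 0"
            "qpoch_inf q (A * D) \<noteq> 0" "qpoch_inf q (B * D) \<noteq> 0"
    and ABCD: "\<And>k. qpoch q (A * B * C * D) k \<noteq> 0"
    and CEF: "\<And>k. qpoch q (C * E * F) k \<noteq> 0"
    and FC: "norm (F * C) < 1" and FD: "norm (F * D) < 1"
  shows "jackson_between q (\<lambda>u. aa_weight q (1 / C) (1 / D) A B u * (qpoch_inf q (E * F * u) / qpoch_inf q (F * u))) C D =
     C * qpoch_inf q q * qpoch_inf q (D / C) * qpoch_inf q (q * C / D) * qpoch_inf q (A * B * C * D) * qpoch_inf q (C * E * F) /
     (qpoch_inf q (A * C) * qpoch_inf q (A * D) * qpoch_inf q (B * C) * qpoch_inf q (B * D) * qpoch_inf q (F * C)) *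
     phi32 E (A * C) (B * C) (C * E * F) (A * B * C * D) q (F * D)"
proof -
  let ?w = "aa_weight q (1 / C) (1 / D) A B"
  define K where "K = qpoch_inf q (C * E * F) / qpoch_inf q (F * C)"
  define h where "h u = (\<Sum>k. qgauss_coeff q C E F k * qnewton q C k u)" for u
  define t where "t k = qpochs q [E, A * C, B * C] k / qpochs q [q, C * E * F, A * B * C * D] k * (F * D) ^ k" for k
  define M where "M = jackson_between q ?w C D"
  have half: "jackson q (\<lambda>u. ?w u * (qpoch_inf q (E * F * u) / qpoch_inf q (F * u))) c =
                K * jackson q (\<lambda>u. h u * ?w u) c" if "norm (F * c) < 1" for c
  proof -
    have "norm (F * (c * q ^ n)) < 1" for n
    proof -
      have "norm (F * (c * q ^ n)) \<le> norm (F * c)"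
        using q power_le_one[of "norm q" n] by (simp add: norm_mult norm_power mult_left_le mult.assoc[symmetric])
      thus ?thesis
        using that by simp
    qed
    hence *: "qpoch_inf q (E * F * (c * q ^ n)) / qpoch_inf q (F * (c * q ^ n)) = K * h (c * q ^ n)" for n
      using qgauss_sum[OF q CEF FC, of "c * q ^ n"] by (simp add: h_def K_def mult_ac)
    have "K * jackson q (\<lambda>u. h u * ?w u) c = (\<Sum>n. K * (c * q ^ n * (h (c * q ^ n) * ?w (c * q ^ n))))"
    proof -
      have "jconv q h c"
      proof -
        have "(\<lambda>n. K * h (c * q ^ n)) \<longlonglongrightarrow> qpoch_inf q (E * F * 0) / qpoch_inf q (F * 0)"
          unfolding *[symmetric] by (intro tendsto_intros tendsto_mult_qpower_zero q) auto
        hence "convergent (\<lambda>n. K * h (c * q ^ n))"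
          by (auto simp: convergent_def)
        moreover have "K \<noteq> 0"
        proof -
          have "C * E * F * q ^ k \<noteq> 1" for k
            using CEF[of "Suc k"] by (auto simp: qpoch_Suc)
          thus ?thesis
            using qpoch_inf_nonzero[OF q FC] by (simp add: K_def qpoch_inf_eq_0_iff[OF q])
        qed
        ultimately show ?thesis
          unfolding jconv_def by (simp add: convergent_mult_const_iff)
      qed
      thus ?thesis
        unfolding jackson_def by (intro suminf_mult[symmetric] jackson_summable jconv_mult jconv_aa_weight)
    qed
    thus ?thesis
      unfolding jackson_def * by (simp add: mult_ac)
  qed
  have "(\<lambda>k. qgauss_coeff q C E F k * jackson q (\<lambda>u. qnewton q C k u * ?w u) C -
             qgauss_coeff q C E F k * jackson q (\<lambda>u. qnewton q C k u * ?w u) D) sums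
          (jackson q (\<lambda>u. h u * ?w u) C - jackson q (\<lambda>u. h u * ?w u) D)"
    unfolding h_def by (intro sums_diff jackson_qgauss_sums CEF FC FD jconv_aa_weight)
  hence "(\<lambda>k. qgauss_coeff q C E F k * jackson_between q (\<lambda>u. qnewton q C k u * ?w u) C D) sums
           jackson_between q (\<lambda>u. h u * ?w u) C D"
    unfolding jackson_between_def by (simp add: algebra_simps)
  moreover have "qgauss_coeff q C E F k * jackson_between q (\<lambda>u. qnewton q C k u * ?w u) C D = t k * M" for k
    unfolding jackson_between_qnewton[OF C D nz ABCD]
    by (simp add: t_def M_def qgauss_coeff_def qpochs_def power_mult_distrib mult_ac)
  ultimately have "(\<lambda>k. t k * M) sums jackson_between q (\<lambda>u. h u * ?w u) C D"
    by simp
  hence "jackson_between q (\<lambda>u. h u * ?w u) C D = suminf t * M"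
  \<comment> \<open>If the integral \<open>M\<close> vanishes, nothing is known about the convergence of \<open>t\<close>, but
      both sides are 0.\<close>
  proof (cases "M = 0")
    case False
    have "(\<lambda>k. t k * M / M) sums (jackson_between q (\<lambda>u. h u * ?w u) C D / M)"
      by (intro sums_divide) fact
    hence "t sums (jackson_between q (\<lambda>u. h u * ?w u) C D / M)"
      using False by simp
    thus ?thesis
      using False by (simp add: sums_iff)
  qed (auto simp: sums_iff)
  hence "jackson_between q (\<lambda>u. ?w u * (qpoch_inf q (E * F * u) / qpoch_inf q (F * u))) C D = K * (suminf t * M)"
    unfolding jackson_between_def half[OF FC] half[OF FD] by (simp add: algebra_simps)
  moreover have "suminf t = phi32 E (A * C) (B * C) (C * E * F) (A * B * C * D) q (F * D)"
    unfolding phi32_def t_def ..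
  ultimately show ?thesis
    unfolding M_def andrews_askey[OF C D nz] K_def by (simp add: mult_ac)
qed

end

section \<open>Vertical contours\<close>

lemma closed_segment_Re_Im:
  assumes "z \<in> closed_segment a b"
  shows "min (Re a) (Re b) \<le> Re z \<and> Re z \<le> max (Re a) (Re b) \<and>
         min (Im a) (Im b) \<le> Im z \<and> Im z \<le> max (Im a) (Im b)"
proof -
  obtain u where u: "0 \<le> u" "u \<le> 1" and z: "z = (1 - u) *\<^sub>R a + u *\<^sub>R b"
    using assms by (auto simp: in_segment)
  have convex_comb: "min x y \<le> (1 - u) * x + u * y \<and> (1 - u) * x + u * y \<le> max x y" for x y :: real
  proof
    have "(1 - u) * min x y + u * min x y \<le> (1 - u) * x + u * y"
      using u by (intro add_mono mult_left_mono) auto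
    thus "min x y \<le> (1 - u) * x + u * y"
      by (simp add: algebra_simps)
    have "(1 - u) * x + u * y \<le> (1 - u) * max x y + u * max x y"
      using u by (intro add_mono mult_left_mono) auto
    thus "(1 - u) * x + u * y \<le> max x y"
      by (simp add: algebra_simps)
  qed
  show ?thesis
    using convex_comb[of "Re a" "Re b"] convex_comb[of "Im a" "Im b"] by (simp_all add: z)
qed

text \<open>
  The constant \<open>B\<close> bounds the horizontal extent of the contour and the height of its part between the
  rays, so that outside the strip \<open>|Im z| \<le> B\<close> the contour consists of two vertical rays. It is a parameter
  and not the least such bound because later it must also exceed the coordinates of \<open>c\<close> and \<open>d\<close>.
\<close>

locale vcontour =
  fixes \<gamma> :: "real \<Rightarrow> complex" and T B \<sigma>\<^sub>1 \<sigma>\<^sub>2 :: real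
  assumes T: "0 < T" "T \<le> B"
    and pw: "\<gamma> piecewise_C1_differentiable_on {-T..T}"
    and lo: "\<And>t. t \<le> -T \<Longrightarrow> \<gamma> t = Complex \<sigma>\<^sub>1 t"
    and hi: "\<And>t. t \<ge> T \<Longrightarrow> \<gamma> t = Complex \<sigma>\<^sub>2 t"
    and Re_bound: "\<And>t. \<bar>Re (\<gamma> t)\<bar> \<le> B"
    and Im_bound: "\<And>t. \<bar>t\<bar> \<le> T \<Longrightarrow> \<bar>Im (\<gamma> t)\<bar> \<le> B"

lemma vertical_contour_imp_vcontour:
  assumes "vertical_contour \<gamma>"
  shows "\<exists>T \<sigma>\<^sub>1 \<sigma>\<^sub>2 B\<^sub>0. \<forall>B\<ge>B\<^sub>0. vcontour \<gamma> T B \<sigma>\<^sub>1 \<sigma>\<^sub>2"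
proof -
  obtain T \<sigma>\<^sub>1 \<sigma>\<^sub>2 where T: "T > 0" "\<gamma> piecewise_C1_differentiable_on {-T..T}"
    "\<And>t. t \<le> -T \<Longrightarrow> \<gamma> t = Complex \<sigma>\<^sub>1 t" "\<And>t. t \<ge> T \<Longrightarrow> \<gamma> t = Complex \<sigma>\<^sub>2 t"
    using assms unfolding vertical_contour_def by blast
  have "compact (\<gamma> ` {-T..T})"
    using T(2) by (intro compact_continuous_image) (auto simp: piecewise_C1_differentiable_on_def)
  then obtain K where K: "\<And>t. t \<in> {-T..T} \<Longrightarrow> norm (\<gamma> t) \<le> K"
    using compact_imp_bounded bounded_iff by (metis image_eqI)
  define B\<^sub>0 where "B\<^sub>0 = T + \<bar>K\<bar> + \<bar>\<sigma>\<^sub>1\<bar> + \<bar>\<sigma>\<^sub>2\<bar>"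
  have B0: "T \<le> B\<^sub>0" "K \<le> B\<^sub>0" "\<bar>\<sigma>\<^sub>1\<bar> \<le> B\<^sub>0" "\<bar>\<sigma>\<^sub>2\<bar> \<le> B\<^sub>0"
    using T(1) by (simp_all add: B\<^sub>0_def)
  have "vcontour \<gamma> T B \<sigma>\<^sub>1 \<sigma>\<^sub>2" if "B \<ge> B\<^sub>0" for B
  proof
    show "\<bar>Im (\<gamma> t)\<bar> \<le> B" if "\<bar>t\<bar> \<le> T" for t
    proof -
      have "norm (\<gamma> t) \<le> K"
        using that by (intro K) auto
      thus ?thesis
        using abs_Im_le_cmod[of "\<gamma> t"] \<open>B \<ge> B\<^sub>0\<close> B0 by linarith
    qed
    show "\<bar>Re (\<gamma> t)\<bar> \<le> B" for t
    proof (cases "\<bar>t\<bar> \<le> T")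
      case True
      hence "norm (\<gamma> t) \<le> K"
        by (intro K) auto
      thus ?thesis
        using abs_Re_le_cmod[of "\<gamma> t"] that B0 by linarith
    next
      case False
      thus ?thesis
        using T(3,4)[of t] that B0 by (cases "t \<ge> 0") auto
    qed
  qed (use T B0 that in auto)
  thus ?thesis
    by blast
qed

context vcontour
begin

lemma sigma_bound: "\<bar>\<sigma>\<^sub>1\<bar> \<le> B" "\<bar>\<sigma>\<^sub>2\<bar> \<le> B"
  using Re_bound[of "-T"] Re_bound[of T] lo[of "-T"] hi[of T] by auto

lemma Im_bound': "\<bar>t\<bar> \<le> N \<Longrightarrow> B \<le> N \<Longrightarrow> \<bar>Im (\<gamma> t)\<bar> \<le> N"
  using Im_bound[of t] lo[of t] hi[of t] by (cases "\<bar>t\<bar> \<le> T"; cases "t \<ge> T"; cases "t \<le> -T") auto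

lemma contour_above: "Im (\<gamma> t) > B \<Longrightarrow> Re (\<gamma> t) = \<sigma>\<^sub>2"
  and contour_below: "Im (\<gamma> t) < -B \<Longrightarrow> Re (\<gamma> t) = \<sigma>\<^sub>1"
proof -
  consider "\<bar>t\<bar> \<le> T" | "t \<ge> T" | "t \<le> - T"
    by linarith
  hence "(Im (\<gamma> t) > B \<longrightarrow> Re (\<gamma> t) = \<sigma>\<^sub>2) \<and> (Im (\<gamma> t) < -B \<longrightarrow> Re (\<gamma> t) = \<sigma>\<^sub>1)"
    using Im_bound[of t] lo[of t] hi[of t] T by cases auto
  thus "Im (\<gamma> t) > B \<Longrightarrow> Re (\<gamma> t) = \<sigma>\<^sub>2" "Im (\<gamma> t) < -B \<Longrightarrow> Re (\<gamma> t) = \<sigma>\<^sub>1"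
    by auto
qed

lemma continuous_contour: "continuous_on UNIV \<gamma>"
proof -
  have "continuous_on {..-T} \<gamma>"
    by (rule continuous_on_eq[of _ "\<lambda>t. Complex \<sigma>\<^sub>1 t"]) (auto simp: lo Complex_eq intro!: continuous_intros)
  moreover have "continuous_on {T..} \<gamma>"
    by (rule continuous_on_eq[of _ "\<lambda>t. Complex \<sigma>\<^sub>2 t"]) (auto simp: hi Complex_eq intro!: continuous_intros)
  moreover have "continuous_on {-T..T} \<gamma>"
    using pw by (simp add: piecewise_C1_differentiable_on_def)
  ultimately have "continuous_on ({..-T} \<union> ({-T..T} \<union> {T..})) \<gamma>"
    by (intro continuous_on_closed_Un) auto
  moreover have "{..-T} \<union> ({-T..T} \<union> {T..}) = UNIV"
    by auto
  ultimately show ?thesis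
    by simp
qed

lemma vertical_ray_derivative:
  assumes "\<bar>t\<bar> > T"
  shows "(\<gamma> has_vector_derivative \<i>) (at t)"
proof (cases "t > 0")
  case True
  have "((\<lambda>t. Complex \<sigma>\<^sub>2 t) has_vector_derivative \<i>) (at t)"
    unfolding Complex_eq by (auto intro!: derivative_eq_intros)
  thus ?thesis
    by (rule has_vector_derivative_transform_within_open[where S = "{T<..}"])
       (use assms True in \<open>auto simp: hi\<close>)
next
  case False
  have "((\<lambda>t. Complex \<sigma>\<^sub>1 t) has_vector_derivative \<i>) (at t)"
    unfolding Complex_eq by (auto intro!: derivative_eq_intros)
  thus ?thesis
    by (rule has_vector_derivative_transform_within_open[where S = "{..<-T}"])
       (use assms False in \<open>auto simp: lo\<close>)
qed

lemma C1_contour: "\<exists>S. finite S \<and> \<gamma> C1_differentiable_on (-S)"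
proof -
  obtain S where S: "finite S" "\<gamma> C1_differentiable_on ({-T..T} - S)"
    using pw unfolding piecewise_C1_differentiable_on_def by blast
  have fin: "finite (S \<union> {-T, T})"
    using S by simp
  have d1: "\<gamma> differentiable at t" if "t \<in> {-T<..<T} - S" for t
    using S(2) that unfolding C1_differentiable_on_eq by auto
  have d2: "\<gamma> differentiable at t" if "\<bar>t\<bar> > T" for t
    using vertical_ray_derivative[OF that] differentiableI_vector by blast
  have c1: "continuous_on ({-T<..<T} - S) (\<lambda>t. vector_derivative \<gamma> (at t))"
    using S(2) unfolding C1_differentiable_on_eq by (auto elim: continuous_on_subset)
  have c2: "continuous_on ({..<-T} \<union> {T<..}) (\<lambda>t. vector_derivative \<gamma> (at t))"
    by (rule continuous_on_eq[OF continuous_on_const[of _ "\<i>"]])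
       (use T in \<open>auto intro!: vector_derivative_at[symmetric] vertical_ray_derivative\<close>)
  have "open ({-T<..<T} - S)"
    using S(1) by (intro open_Diff finite_imp_closed) auto
  hence "continuous_on (({-T<..<T} - S) \<union> ({..<-T} \<union> {T<..})) (\<lambda>t. vector_derivative \<gamma> (at t))"
    by (intro continuous_on_open_Un c1 c2 open_Un) auto
  hence "continuous_on (- (S \<union> {-T, T})) (\<lambda>t. vector_derivative \<gamma> (at t))"
    by (rule continuous_on_subset) auto
  moreover have "\<gamma> differentiable at t" if "t \<in> - (S \<union> {-T, T})" for t
    using that d1[of t] d2[of t] by (cases "\<bar>t\<bar> > T") (auto simp: abs_if split: if_splits)
  ultimately show ?thesis
    using fin unfolding C1_differentiable_on_eq by blast
qed

definition segment_path :: "real \<Rightarrow> real \<Rightarrow> complex" where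
  "segment_path N = \<gamma> \<circ> (\<lambda>x. (2 * N) *\<^sub>R x + (- N))"

definition return_path :: "real \<Rightarrow> real \<Rightarrow> real \<Rightarrow> complex" where
  "return_path N \<rho> = linepath (\<gamma> N) (Complex \<rho> N) +++ linepath (Complex \<rho> N) (Complex \<rho> (-N)) +++
                     linepath (Complex \<rho> (-N)) (\<gamma> (-N))"

text \<open>
  The part \<open>|t| \<le> N\<close> of the contour, closed by three sides of a rectangle on its right. The
  resulting loop runs clockwise around the points between the contour and the line \<open>Re z = \<rho>\<close>.
\<close>

definition boxed_path :: "real \<Rightarrow> real \<Rightarrow> real \<Rightarrow> complex" where
  "boxed_path N \<rho> = segment_path N +++ return_path N \<rho>"

lemma segment_path_ends [simp]:
  "pathstart (segment_path N) = \<gamma> (- N)" "pathfinish (segment_path N) = \<gamma> N"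
  by (simp_all add: pathstart_def pathfinish_def segment_path_def)

lemma return_path_ends [simp]:
  "pathstart (return_path N \<rho>) = \<gamma> N" "pathfinish (return_path N \<rho>) = \<gamma> (- N)"
  by (simp_all add: return_path_def)

lemma boxed_path_loop: "pathfinish (boxed_path N \<rho>) = pathstart (boxed_path N \<rho>)"
  by (simp add: boxed_path_def)

lemma affine_image: "N > 0 \<Longrightarrow> (\<lambda>x. 2 * N * x + (- N)) ` {0..1} = {-N..N::real}"
  by (subst image_affinity_atLeastAtMost) auto

lemma path_image_segment_path: "N > 0 \<Longrightarrow> path_image (segment_path N) = \<gamma> ` {-N..N}"
  by (auto simp: path_image_def segment_path_def image_image simp flip: affine_image)

lemma valid_segment_path:
  assumes "N > 0"
  shows "valid_path (segment_path N)"
proof -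
  obtain S where S: "finite S" "\<gamma> C1_differentiable_on (-S)"
    using C1_contour by blast
  have "\<gamma> piecewise_C1_differentiable_on {-N..N}"
    unfolding piecewise_C1_differentiable_on_def
  proof (intro conjI exI[of _ S] S)
    show "continuous_on {-N..N} \<gamma>"
      using continuous_contour continuous_on_subset by blast
    show "\<gamma> C1_differentiable_on ({-N..N} - S)"
      using S(2) by (rule C1_differentiable_on_subset) auto
  qed
  thus ?thesis
    unfolding valid_path_def segment_path_def
    by (intro piecewise_C1_differentiable_affine) (simp only: affine_image[OF assms])
qed

lemma valid_return_path: "valid_path (return_path N \<rho>)"
  unfolding return_path_def by (intro valid_path_join) auto

lemma valid_boxed_path: "N > 0 \<Longrightarrow> valid_path (boxed_path N \<rho>)"
  unfolding boxed_path_def by (intro valid_path_join valid_segment_path valid_return_path) auto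

lemma contour_ends:
  assumes "N \<ge> B"
  shows "\<gamma> N = Complex \<sigma>\<^sub>2 N" "\<gamma> (-N) = Complex \<sigma>\<^sub>1 (-N)"
  using assms T lo[of "-N"] hi[of N] by auto

lemma path_image_return_path:
  "path_image (return_path N \<rho>) = closed_segment (\<gamma> N) (Complex \<rho> N) \<union>
     closed_segment (Complex \<rho> N) (Complex \<rho> (-N)) \<union> closed_segment (Complex \<rho> (-N)) (\<gamma> (-N))"
  unfolding return_path_def by (simp add: path_image_join Un_assoc)

lemma return_path_cases:
  assumes "N \<ge> B" "\<rho> \<ge> B" "z \<in> path_image (return_path N \<rho>)"
  shows "(Im z = N \<and> \<sigma>\<^sub>2 \<le> Re z \<and> Re z \<le> \<rho>) \<or> (Re z = \<rho> \<and> \<bar>Im z\<bar> \<le> N) \<or>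
         (Im z = -N \<and> \<sigma>\<^sub>1 \<le> Re z \<and> Re z \<le> \<rho>)"
proof -
  have N: "N > 0"
    using T assms by linarith
  have "\<sigma>\<^sub>1 \<le> \<rho>" "\<sigma>\<^sub>2 \<le> \<rho>"
    using sigma_bound assms by auto
  thus ?thesis
    using assms(3) N unfolding path_image_return_path contour_ends[OF assms(1)]
    by (auto dest!: closed_segment_Re_Im)
qed

lemma boxed_path_cases:
  assumes "N \<ge> B" "\<rho> \<ge> B" "z \<in> path_image (boxed_path N \<rho>)"
  shows "(\<exists>t. \<bar>t\<bar> \<le> N \<and> z = \<gamma> t) \<or> (Im z = N \<and> \<sigma>\<^sub>2 \<le> Re z \<and> Re z \<le> \<rho>) \<or> (Re z = \<rho> \<and> \<bar>Im z\<bar> \<le> N) \<or>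
         (Im z = -N \<and> \<sigma>\<^sub>1 \<le> Re z \<and> Re z \<le> \<rho>)"
proof -
  have "N > 0"
    using T assms by linarith
  hence "z \<in> \<gamma> ` {-N..N} \<or> z \<in> path_image (return_path N \<rho>)"
    using assms(3) unfolding boxed_path_def by (subst (asm) path_image_join) (auto simp: path_image_segment_path)
  thus ?thesis
  proof
    assume "z \<in> \<gamma> ` {-N..N}"
    thus ?thesis
      by (intro disjI1) force
  qed (use return_path_cases[OF assms(1,2)] in blast)
qed

lemma boxed_path_bounds:
  assumes "N \<ge> B" "\<rho> \<ge> B" "z \<in> path_image (boxed_path N \<rho>)"
  shows "\<bar>Im z\<bar> \<le> N" "Re z \<le> \<rho>" "\<And>x. (\<And>t. x < Re (\<gamma> t)) \<Longrightarrow> x < Re z"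
proof -
  have N: "N > 0"
    using T assms by linarith
  have "\<bar>Im (\<gamma> t)\<bar> \<le> N" if "\<bar>t\<bar> \<le> N" for t
    using that Im_bound' assms by blast
  moreover have "Re (\<gamma> t) \<le> \<rho>" for t
    using Re_bound[of t] assms by auto
  ultimately show "\<bar>Im z\<bar> \<le> N" "Re z \<le> \<rho>"
    using boxed_path_cases[OF assms] N by auto
  fix x assume x: "\<And>t. x < Re (\<gamma> t)"
  have "x < \<sigma>\<^sub>1" "x < \<sigma>\<^sub>2" "x < \<rho>"
    using x[of N] x[of "-N"] contour_ends[OF assms(1)] sigma_bound assms by auto
  thus "x < Re z"
    using boxed_path_cases[OF assms] x by auto
qed

lemma winding_boxed_path_left:
  assumes "N \<ge> B" "\<rho> \<ge> B" "\<And>t. Re z < Re (\<gamma> t)"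
  shows "winding_number (boxed_path N \<rho>) z = 0"
proof (rule winding_number_zero_outside)
  have "N > 0"
    using T assms by linarith
  thus "path (boxed_path N \<rho>)"
    by (intro valid_path_imp_path valid_boxed_path)
  show "path_image (boxed_path N \<rho>) \<subseteq> {w. Re z < Re w}"
    using boxed_path_bounds(3)[OF assms(1,2)] assms(3) by blast
qed (auto simp: boxed_path_loop convex_halfspace_Re_gt)

lemma winding_boxed_path_far_right:
  assumes "N \<ge> B" "\<rho> \<ge> B" "\<rho> < Re z"
  shows "winding_number (boxed_path N \<rho>) z = 0"
proof (rule winding_number_zero_outside)
  have "N > 0"
    using T assms by linarith
  thus "path (boxed_path N \<rho>)"
    by (intro valid_path_imp_path valid_boxed_path)
  show "path_image (boxed_path N \<rho>) \<subseteq> {w. Re w \<le> \<rho>}"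
    using boxed_path_bounds(2)[OF assms(1,2)] by blast
qed (use assms in \<open>auto simp: boxed_path_loop convex_halfspace_Re_le\<close>)

text \<open>
  Along the contour \<open>Ln (z - s)\<close> is a primitive of \<open>1/(s - z)\<close>, as the contour lies to the left of \<open>z\<close>;
  along the rest of the loop \<open>Ln (s - z)\<close> is one, as the loop avoids the horizontal ray from \<open>z\<close> to the
  left there. The two branches differ by \<open>\<i>\<pi>\<close> at the upper and by \<open>-\<i>\<pi>\<close> at the lower
  junction, which adds up to \<open>-2\<pi>\<i>\<close>.
\<close>

lemma winding_boxed_path_inside:
  assumes "N \<ge> B" "\<rho> \<ge> B" "\<And>t. Re (\<gamma> t) < Re z" "Re z < \<rho>" "\<bar>Im z\<bar> < N"
  shows "winding_number (boxed_path N \<rho>) z = -1" "z \<notin> path_image (boxed_path N \<rho>)"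
proof -
  have N: "N > 0"
    using T assms by linarith
  define p q where "p = \<gamma> (-N)" and "q = \<gamma> N"
  have \<sigma>: "\<sigma>\<^sub>1 < Re z" "\<sigma>\<^sub>2 < Re z"
    using assms(3)[of N] assms(3)[of "-N"] unfolding contour_ends[OF assms(1)] by simp_all
  hence pq: "Re p < Re z" "Re q < Re z" "Im p = -N" "Im q = N"
    using contour_ends[OF assms(1)] by (auto simp: p_def q_def)
  have "z \<noteq> \<gamma> t" for t
    using assms(3)[of t] by auto
  thus notin: "z \<notin> path_image (boxed_path N \<rho>)"
    using \<sigma> boxed_path_cases[OF assms(1,2), of z] assms(4,5) by auto
  have int1: "((\<lambda>s. 1 / (s - z)) has_contour_integral (Ln (z - q) - Ln (z - p))) (segment_path N)"
  proof -
    have "((\<lambda>s. 1 / (s - z)) has_contour_integral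
            (Ln (z - pathfinish (segment_path N)) - Ln (z - pathstart (segment_path N)))) (segment_path N)"
    proof (rule contour_integral_primitive[where S = "{s. Re s < Re z}" and f = "\<lambda>s. Ln (z - s)"])
      fix s assume s: "s \<in> {s. Re s < Re z}"
      hence "z - s \<notin> \<real>\<^sub>\<le>\<^sub>0"
        by (auto simp: complex_nonpos_Reals_iff)
      moreover have "s \<noteq> z"
        using s by auto
      ultimately show "((\<lambda>s. Ln (z - s)) has_field_derivative 1 / (s - z)) (at s within {s. Re s < Re z})"
        by (auto intro!: derivative_eq_intros simp: field_simps)
    next
      show "path_image (segment_path N) \<subseteq> {s. Re s < Re z}"
        using assms(3) by (auto simp: path_image_segment_path[OF N])
    qed (rule valid_segment_path[OF N])
    thus ?thesis
      by (simp add: p_def q_def)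
  qed
  have int2: "((\<lambda>s. 1 / (s - z)) has_contour_integral (Ln (p - z) - Ln (q - z))) (return_path N \<rho>)"
  proof -
    have "((\<lambda>s. 1 / (s - z)) has_contour_integral
            (Ln (pathfinish (return_path N \<rho>) - z) - Ln (pathstart (return_path N \<rho>) - z))) (return_path N \<rho>)"
    proof (rule contour_integral_primitive[where S = "{s. s - z \<notin> \<real>\<^sub>\<le>\<^sub>0}" and f = "\<lambda>s. Ln (s - z)"])
      fix s assume s: "s \<in> {s. s - z \<notin> \<real>\<^sub>\<le>\<^sub>0}"
      thus "((\<lambda>s. Ln (s - z)) has_field_derivative 1 / (s - z)) (at s within {s. s - z \<notin> \<real>\<^sub>\<le>\<^sub>0})"
        by (auto intro!: derivative_eq_intros simp: inverse_eq_divide)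
    next
      show "path_image (return_path N \<rho>) \<subseteq> {s. s - z \<notin> \<real>\<^sub>\<le>\<^sub>0}"
        using return_path_cases[OF assms(1,2)] assms(4,5) by (fastforce simp: complex_nonpos_Reals_iff)
    qed (rule valid_return_path)
    thus ?thesis
      by (simp add: p_def q_def)
  qed
  have "((\<lambda>s. 1 / (s - z)) has_contour_integral
          ((Ln (z - q) - Ln (z - p)) + (Ln (p - z) - Ln (q - z)))) (boxed_path N \<rho>)"
    unfolding boxed_path_def
    by (intro has_contour_integral_join int1 int2 valid_segment_path[OF N] valid_return_path)
  moreover have "Ln (q - z) = Ln (z - q) + \<i> * pi"
    using pq assms(5) Ln_minus[of "z - q"] by (simp add: complex_eq_iff)
  moreover have "Ln (p - z) = Ln (z - p) - \<i> * pi"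
    using pq assms(5) Ln_minus[of "z - p"] by (simp add: complex_eq_iff)
  ultimately have "((\<lambda>s. 1 / (s - z)) has_contour_integral (- (2 * pi * \<i>))) (boxed_path N \<rho>)"
    by (simp add: algebra_simps)
  hence "contour_integral (boxed_path N \<rho>) (\<lambda>s. 1 / (s - z)) = - (2 * pi * \<i>)"
    by (rule contour_integral_unique)
  thus "winding_number (boxed_path N \<rho>) z = -1"
    by (subst winding_number_valid_path[OF valid_boxed_path[OF N] notin]) simp
qed

lemma closed_range: "closed (range \<gamma>)"
proof -
  have "range \<gamma> = \<gamma> ` {-T..T} \<union> {z. Re z = \<sigma>\<^sub>2 \<and> Im z \<ge> T} \<union> {z. Re z = \<sigma>\<^sub>1 \<and> Im z \<le> -T}" (is "?L = ?R")
  proof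
    show "?L \<subseteq> ?R"
    proof (rule image_subsetI)
      fix t
      consider "\<bar>t\<bar> \<le> T" | "t \<ge> T" | "t \<le> - T"
        by linarith
      thus "\<gamma> t \<in> ?R"
      proof cases
        case 1
        hence "t \<in> {-T..T}"
          by auto
        thus ?thesis
          by blast
      qed (use lo[of t] hi[of t] in auto)
    qed
    have "z = \<gamma> (Im z)" if "Re z = \<sigma>\<^sub>2 \<and> Im z \<ge> T \<or> Re z = \<sigma>\<^sub>1 \<and> Im z \<le> -T" for z
      using that lo[of "Im z"] hi[of "Im z"] by (auto simp: complex_eq_iff)
    thus "?R \<subseteq> ?L"
      by blast
  qed
  moreover have "compact (\<gamma> ` {-T..T})"
    using pw by (intro compact_continuous_image) (auto simp: piecewise_C1_differentiable_on_def)
  moreover have "closed {z. Re z = \<sigma>\<^sub>2 \<and> Im z \<ge> T}" "closed {z. Re z = \<sigma>\<^sub>1 \<and> Im z \<le> -T}"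
    by (intro closed_Collect_conj closed_Collect_eq closed_Collect_le continuous_intros)+
  ultimately show ?thesis
    by (simp only: closed_Un compact_imp_closed)
qed

text \<open>
  A connection of \<open>z\<close> and \<open>w\<close> in the complement of the contour can be chosen as a path, hence
  bounded; a sufficiently large rectangle does not meet it either.
\<close>

lemma winding_boxed_path_connected:
  assumes "connected_component (- range \<gamma>) z w"
  shows "\<exists>R. \<forall>N \<rho>. N > R \<longrightarrow> \<rho> > R \<longrightarrow> N \<ge> B \<and> \<rho> \<ge> B \<and> \<bar>Im w\<bar> < N \<and> Re w < \<rho> \<and> z \<notin> path_image (boxed_path N \<rho>) \<and>
           winding_number (boxed_path N \<rho>) z = winding_number (boxed_path N \<rho>) w"
proof -
  have "path_component (- range \<gamma>) z w"
    using assms closed_range open_path_connected_component[of "- range \<gamma>" z] by (simp add: open_Compl)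
  then obtain g where g: "path g" "path_image g \<subseteq> - range \<gamma>" "pathstart g = z" "pathfinish g = w"
    unfolding path_component_def by blast
  have "bounded (path_image g)"
    using g by (intro bounded_path_image)
  then obtain K where K: "\<And>s. s \<in> path_image g \<Longrightarrow> norm s \<le> K"
    unfolding bounded_iff by blast
  have zw: "z \<in> path_image g" "w \<in> path_image g"
    using g pathstart_in_path_image pathfinish_in_path_image by blast+
  show ?thesis
  proof (rule exI[of _ "max B K"], intro allI impI)
    fix N \<rho> assume "max B K < N" "max B K < \<rho>"
    hence NB: "N \<ge> B" "\<rho> \<ge> B" and NK: "N > K" "\<rho> > K"
      by auto
    have N: "N > 0"
      using T NB by linarith
    have s: "\<bar>Im s\<bar> < N" "Re s < \<rho>" if "s \<in> path_image g" for s
      using K[OF that] abs_Im_le_cmod[of s] abs_Re_le_cmod[of s] NK by auto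
    have disj: "path_image g \<inter> path_image (boxed_path N \<rho>) = {}"
    proof (rule ccontr)
      assume "path_image g \<inter> path_image (boxed_path N \<rho>) \<noteq> {}"
      then obtain s where s': "s \<in> path_image g" "s \<in> path_image (boxed_path N \<rho>)"
        by blast
      have "s \<notin> range \<gamma>"
        using s'(1) g(2) by blast
      thus False
        using boxed_path_cases[OF NB s'(2)] s[OF s'(1)] by auto
    qed
    have "winding_number (boxed_path N \<rho>) z = winding_number (boxed_path N \<rho>) w"
      using g zw disj
      by (intro winding_number_eq[OF valid_path_imp_path[OF valid_boxed_path[OF N]] boxed_path_loop,
            of z "path_image g"] connected_path_image) auto
    thus "N \<ge> B \<and> \<rho> \<ge> B \<and> \<bar>Im w\<bar> < N \<and> Re w < \<rho> \<and> z \<notin> path_image (boxed_path N \<rho>) \<and>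
           winding_number (boxed_path N \<rho>) z = winding_number (boxed_path N \<rho>) w"
      using NB s[OF zw(2)] disj zw by blast
  qed
qed

lemma winding_left_of_contour:
  assumes "z \<in> left_of_contour \<gamma>"
  shows "\<exists>R. \<forall>N \<rho>. N > R \<longrightarrow> \<rho> > R \<longrightarrow>
           z \<notin> path_image (boxed_path N \<rho>) \<and> winding_number (boxed_path N \<rho>) z = 0"
proof -
  obtain w where w: "connected_component (- range \<gamma>) z w" "\<And>t. Re w < Re (\<gamma> t)"
    using assms unfolding left_of_contour_def by blast
  show ?thesis
    using winding_boxed_path_connected[OF w(1)] winding_boxed_path_left[OF _ _ w(2)] by metis
qed

lemma winding_right_of_contour:
  assumes "z \<in> right_of_contour \<gamma>"
  shows "\<exists>R. \<forall>N \<rho>. N > R \<longrightarrow> \<rho> > R \<longrightarrow>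
           z \<notin> path_image (boxed_path N \<rho>) \<and> winding_number (boxed_path N \<rho>) z = -1"
proof -
  obtain w where w: "connected_component (- range \<gamma>) z w" "\<And>t. Re (\<gamma> t) < Re w"
    using assms unfolding right_of_contour_def by blast
  show ?thesis
    using winding_boxed_path_connected[OF w(1)] winding_boxed_path_inside(1)[OF _ _ w(2)] by metis
qed

lemma left_right_disjoint:
  assumes "z \<in> left_of_contour \<gamma>" "z \<in> right_of_contour \<gamma>"
  shows False
proof -
  obtain R where R: "\<And>N \<rho>. N > R \<Longrightarrow> \<rho> > R \<Longrightarrow> winding_number (boxed_path N \<rho>) z = 0"
    using winding_left_of_contour[OF assms(1)] by blast
  obtain R' where R': "\<And>N \<rho>. N > R' \<Longrightarrow> \<rho> > R' \<Longrightarrow> winding_number (boxed_path N \<rho>) z = -1"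
    using winding_right_of_contour[OF assms(2)] by blast
  have "max R R' + 1 > R" "max R R' + 1 > R'"
    by auto
  thus False
    using R[of "max R R' + 1" "max R R' + 1"] R'[of "max R R' + 1" "max R R' + 1"] by simp
qed

lemma left_not_on_contour: "z \<in> left_of_contour \<gamma> \<Longrightarrow> z \<notin> range \<gamma>"
  unfolding left_of_contour_def using connected_component_in by fastforce

text \<open>
  High up, the points to the right of the ray belong to the right side of the contour.
\<close>

lemma left_high_imp_Re_less:
  assumes "z \<in> left_of_contour \<gamma>" "Im z > B"
  shows "Re z < \<sigma>\<^sub>2"
proof (rule ccontr)
  assume "\<not> Re z < \<sigma>\<^sub>2"
  moreover have "Re z \<noteq> \<sigma>\<^sub>2"
  proof
    assume "Re z = \<sigma>\<^sub>2"
    hence "z = \<gamma> (Im z)"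
      using assms T hi[of "Im z"] by (auto simp: complex_eq_iff)
    thus False
      using left_not_on_contour[OF assms(1)] by blast
  qed
  ultimately have Re: "Re z > \<sigma>\<^sub>2"
    by linarith
  define w where "w = Complex (max (Re z) (B + 1)) (Im z)"
  have "closed_segment z w \<subseteq> - range \<gamma>"
  proof
    fix s assume "s \<in> closed_segment z w"
    hence "Re s > \<sigma>\<^sub>2" "Im s = Im z"
      using Re by (auto dest!: closed_segment_Re_Im simp: w_def)
    thus "s \<in> - range \<gamma>"
      using contour_above assms(2) by force
  qed
  hence "connected_component (- range \<gamma>) z w"
    unfolding connected_component_def by (intro exI[of _ "closed_segment z w"]) auto
  moreover have "Re (\<gamma> t) < Re w" for t
    using Re_bound[of t] by (auto simp: w_def)
  ultimately have "z \<in> right_of_contour \<gamma>"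
    unfolding right_of_contour_def by blast
  thus False
    using left_right_disjoint assms by blast
qed

lemma left_low_imp_Re_less:
  assumes "z \<in> left_of_contour \<gamma>" "Im z < -B"
  shows "Re z < \<sigma>\<^sub>1"
proof (rule ccontr)
  assume "\<not> Re z < \<sigma>\<^sub>1"
  moreover have "Re z \<noteq> \<sigma>\<^sub>1"
  proof
    assume "Re z = \<sigma>\<^sub>1"
    hence "z = \<gamma> (Im z)"
      using assms T lo[of "Im z"] by (auto simp: complex_eq_iff)
    thus False
      using left_not_on_contour[OF assms(1)] by blast
  qed
  ultimately have Re: "Re z > \<sigma>\<^sub>1"
    by linarith
  define w where "w = Complex (max (Re z) (B + 1)) (Im z)"
  have "closed_segment z w \<subseteq> - range \<gamma>"
  proof
    fix s assume "s \<in> closed_segment z w"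
    hence "Re s > \<sigma>\<^sub>1" "Im s = Im z"
      using Re by (auto dest!: closed_segment_Re_Im simp: w_def)
    thus "s \<in> - range \<gamma>"
      using contour_below assms(2) by force
  qed
  hence "connected_component (- range \<gamma>) z w"
    unfolding connected_component_def by (intro exI[of _ "closed_segment z w"]) auto
  moreover have "Re (\<gamma> t) < Re w" for t
    using Re_bound[of t] by (auto simp: w_def)
  ultimately have "z \<in> right_of_contour \<gamma>"
    unfolding right_of_contour_def by blast
  thus False
    using left_right_disjoint assms by blast
qed

text \<open>
  About a point to the left of a ray the winding number is 0 whatever the size of the rectangle. This
  matters for the decreasing poles, infinitely many of which lie above and below the strip
  \<open>|Im z| \<le> B\<close>: thresholds that depend on the pole would have no finite maximum.
\<close>

lemma winding_left_far:
  assumes "N \<ge> B" "\<rho> \<ge> B" "Im z > B \<and> Re z < \<sigma>\<^sub>2 \<or> Im z < -B \<and> Re z < \<sigma>\<^sub>1"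
  shows "winding_number (boxed_path N \<rho>) z = 0" "z \<notin> path_image (boxed_path N \<rho>)"
proof -
  have N: "N > 0"
    using T assms by linarith
  define w where "w = Complex (min (Re z) (-B - 1)) (Im z)"
  have disj: "closed_segment z w \<inter> path_image (boxed_path N \<rho>) = {}"
  proof (rule ccontr)
    assume "closed_segment z w \<inter> path_image (boxed_path N \<rho>) \<noteq> {}"
    then obtain s where s: "s \<in> closed_segment z w" "s \<in> path_image (boxed_path N \<rho>)"
      by blast
    have "Re s \<le> Re z" "Im s = Im z"
      using s(1) by (auto dest!: closed_segment_Re_Im simp: w_def)
    thus False
      using boxed_path_cases[OF assms(1,2) s(2)] assms contour_above contour_below sigma_bound T by auto
  qed
  have "winding_number (boxed_path N \<rho>) z = winding_number (boxed_path N \<rho>) w"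
    using disj
    by (intro winding_number_eq[of _ _ "closed_segment z w"] boxed_path_loop valid_path_imp_path valid_boxed_path N) auto
  also have "Re w < Re (\<gamma> t)" for t
    using Re_bound[of t] by (auto simp: w_def)
  hence "winding_number (boxed_path N \<rho>) w = 0"
    using assms by (intro winding_boxed_path_left)
  finally show "winding_number (boxed_path N \<rho>) z = 0" .
  show "z \<notin> path_image (boxed_path N \<rho>)"
    using disj by auto
qed

end

section \<open>Integrals along a vertical contour\<close>

lemma uniform_threshold:
  assumes "finite F" "\<And>p. p \<in> F \<Longrightarrow> \<exists>R::real. \<forall>N \<rho>. N > R \<longrightarrow> \<rho> > R \<longrightarrow> Q p N \<rho>"
  shows "\<exists>R. \<forall>p\<in>F. \<forall>N \<rho>. N > R \<longrightarrow> \<rho> > R \<longrightarrow> Q p N \<rho>"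
  using assms
proof (induction F rule: finite_induct)
  case (insert p F)
  have "\<exists>R. \<forall>p\<in>F. \<forall>N \<rho>. N > R \<longrightarrow> \<rho> > R \<longrightarrow> Q p N \<rho>"
    by (rule insert.IH) (use insert.prems in blast)
  then obtain R where R: "\<forall>p\<in>F. \<forall>N \<rho>. N > R \<longrightarrow> \<rho> > R \<longrightarrow> Q p N \<rho>"
    by blast
  obtain R' where R': "\<And>N \<rho>. N > R' \<Longrightarrow> \<rho> > R' \<Longrightarrow> Q p N \<rho>"
    using insert.prems[of p] by auto
  show ?case
    using R R' by (intro exI[of _ "max R R'"]) auto
qed simp

context vcontour
begin

text \<open>
  The residue theorem for the closed path, with winding number -1 at the poles of \<open>Rt\<close> that lie to the
  left of the line \<open>Re z = \<rho>\<close>, and 0 at all other poles. The size of the rectangle that makes this true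
  depends on the pole, but only for poles in a fixed square; elsewhere the winding number
  is known for every rectangle.
\<close>

theorem contour_integral_boxed_path:
  assumes holo: "f holomorphic_on (- P)"
    and fin: "\<And>K. compact K \<Longrightarrow> finite (P \<inter> K)"
    and P: "P \<subseteq> Rt \<union> Lt" "Rt \<subseteq> P"
    and Rt: "Rt \<subseteq> right_of_contour \<gamma>" and Lt: "Lt \<subseteq> left_of_contour \<gamma>"
    and Rt_bounds: "\<And>p. p \<in> Rt \<Longrightarrow> \<bar>Im p\<bar> \<le> B \<and> - B \<le> Re p"
  shows "\<exists>R. \<forall>N \<rho>. N > R \<longrightarrow> \<rho> > R \<longrightarrow> \<rho> \<notin> Re ` Rt \<longrightarrow>
           path_image (boxed_path N \<rho>) \<inter> P = {} \<and>
           contour_integral (boxed_path N \<rho>) f = - (2 * pi * \<i>) * (\<Sum>p | p \<in> Rt \<and> Re p < \<rho>. residue f p)"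
proof -
  define K0 where "K0 = cbox (Complex (-B) (-B)) (Complex B B)"
  have K0: "finite (P \<inter> K0)"
    unfolding K0_def by (intro fin compact_cbox)
  have "\<exists>R. \<forall>p\<in>Rt \<inter> (P \<inter> K0). \<forall>N \<rho>. N > R \<longrightarrow> \<rho> > R \<longrightarrow>
           p \<notin> path_image (boxed_path N \<rho>) \<and> winding_number (boxed_path N \<rho>) p = -1"
    by (intro uniform_threshold winding_right_of_contour) (use K0 Rt in auto)
  then obtain R1 where R1: "\<And>p N \<rho>. p \<in> Rt \<inter> (P \<inter> K0) \<Longrightarrow> N > R1 \<Longrightarrow> \<rho> > R1 \<Longrightarrow>
      p \<notin> path_image (boxed_path N \<rho>) \<and> winding_number (boxed_path N \<rho>) p = -1"
    by blast
  have "\<exists>R. \<forall>p\<in>Lt \<inter> (P \<inter> K0). \<forall>N \<rho>. N > R \<longrightarrow> \<rho> > R \<longrightarrow>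
           p \<notin> path_image (boxed_path N \<rho>) \<and> winding_number (boxed_path N \<rho>) p = 0"
    by (intro uniform_threshold winding_left_of_contour) (use K0 Lt in auto)
  then obtain R2 where R2: "\<And>p N \<rho>. p \<in> Lt \<inter> (P \<inter> K0) \<Longrightarrow> N > R2 \<Longrightarrow> \<rho> > R2 \<Longrightarrow>
      p \<notin> path_image (boxed_path N \<rho>) \<and> winding_number (boxed_path N \<rho>) p = 0"
    by blast
  define R where "R = max B (max R1 R2)"
  show ?thesis
  proof (rule exI[of _ R], intro allI impI)
    fix N \<rho> assume "R < N" "R < \<rho>" and \<rho>_notin: "\<rho> \<notin> Re ` Rt"
    hence NB: "N \<ge> B" "\<rho> \<ge> B" "N > B" "\<rho> > B" and NR: "N > R1" "\<rho> > R1" "N > R2" "\<rho> > R2"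
      by (auto simp: R_def)
    have N: "N > 0"
      using T NB by linarith
    let ?g = "boxed_path N \<rho>"
    have Rt_in: "winding_number ?g p = -1 \<and> p \<notin> path_image ?g" if "p \<in> Rt" "Re p < \<rho>" for p
    proof (cases "Re p \<le> B")
      case True
      hence "p \<in> Rt \<inter> (P \<inter> K0)"
        using that(1) P Rt_bounds[OF that(1)] by (auto simp: K0_def in_cbox_complex_iff)
      thus ?thesis
        using R1 NR by blast
    next
      case False
      have "Re (\<gamma> t) < Re p" for t
        using Re_bound[of t] False by linarith
      thus ?thesis
        using winding_boxed_path_inside[OF NB(1,2)] that Rt_bounds[OF that(1)] NB by auto
    qed
    have Rt_out: "winding_number ?g p = 0 \<and> p \<notin> path_image ?g" if "p \<in> Rt" "\<not> Re p < \<rho>" for p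
    proof -
      have "Re p > \<rho>"
        using that \<rho>_notin by force
      thus ?thesis
        using winding_boxed_path_far_right[OF NB(1,2)] boxed_path_bounds(2)[OF NB(1,2), of p] by auto
    qed
    have Lt_out: "winding_number ?g p = 0 \<and> p \<notin> path_image ?g" if p: "p \<in> P" "p \<notin> Rt" for p
    proof -
      have pL: "p \<in> Lt"
        using p P by blast
      consider "Im p > B" | "Im p < -B" | "\<bar>Im p\<bar> \<le> B" "Re p > B" | "Re p < -B" | "\<bar>Im p\<bar> \<le> B" "\<bar>Re p\<bar> \<le> B"
        by linarith
      thus ?thesis
      proof cases
        case 1
        thus ?thesis
          using left_high_imp_Re_less[of p] Lt pL winding_left_far[OF NB(1,2), of p] by auto
      next
        case 2
        thus ?thesis
          using left_low_imp_Re_less[of p] Lt pL winding_left_far[OF NB(1,2), of p] by auto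
      next
        case 3
        have "Re (\<gamma> t) < Re p" for t
          using Re_bound[of t] 3 by linarith
        moreover from this have "p \<notin> range \<gamma>"
          by force
        ultimately have "p \<in> right_of_contour \<gamma>"
          unfolding right_of_contour_def by (auto intro!: exI[of _ p])
        thus ?thesis
          using left_right_disjoint Lt pL by blast
      next
        case 4
        have "Re p < Re (\<gamma> t)" for t
          using Re_bound[of t] 4 by linarith
        thus ?thesis
          using winding_boxed_path_left[OF NB(1,2)] boxed_path_bounds(3)[OF NB(1,2), of p "Re p"] by auto
      next
        case 5
        hence "p \<in> Lt \<inter> (P \<inter> K0)"
          using pL p by (auto simp: K0_def in_cbox_complex_iff)
        thus ?thesis
          using R2 NR by blast
      qed
    qed
    have disj: "path_image ?g \<inter> P = {}"
      using Rt_in Rt_out Lt_out by blast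
    define K where "K = N + \<rho> + 2 * B + 1"
    define pts where "pts = P \<inter> ball 0 K"
    have "finite (P \<inter> cball 0 K)"
      by (intro fin) simp
    hence fin_pts: "finite pts"
      unfolding pts_def by (rule finite_subset[rotated]) auto
    have "contour_integral ?g f = 2 * pi * \<i> * (\<Sum>p\<in>pts. winding_number ?g p * residue f p)"
    proof (rule Residue_theorem[of "ball 0 K" pts])
      show "f holomorphic_on ball 0 K - pts"
        using holo by (rule holomorphic_on_subset) (auto simp: pts_def)
      have inball: "path_image ?g \<subseteq> ball 0 K"
      proof
        fix z assume z: "z \<in> path_image ?g"
        have "- B - 1 < Re (\<gamma> t)" for t
          using Re_bound[of t] by linarith
        hence "- B - 1 < Re z"
          by (intro boxed_path_bounds(3)[OF NB(1,2) z])
        moreover have "\<bar>Im z\<bar> \<le> N" "Re z \<le> \<rho>"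
          using boxed_path_bounds(1,2)[OF NB(1,2) z] by auto
        ultimately have "norm z < K"
          using cmod_le[of z] NB T unfolding K_def by linarith
        thus "z \<in> ball 0 K"
          by simp
      qed
      thus "path_image ?g \<subseteq> ball 0 K - pts"
        using disj by (auto simp: pts_def)
      show "\<forall>z. z \<notin> ball 0 K \<longrightarrow> winding_number ?g z = 0"
        using inball winding_number_zero_outside[OF valid_path_imp_path[OF valid_boxed_path[OF N]] convex_ball boxed_path_loop]
        by blast
    qed (auto simp: fin_pts valid_boxed_path N boxed_path_loop)
    also have "(\<Sum>p\<in>pts. winding_number ?g p * residue f p) = (\<Sum>p | p \<in> Rt \<and> Re p < \<rho>. - residue f p)"
    proof (rule sum.mono_neutral_cong_right[OF fin_pts])
      show "{p. p \<in> Rt \<and> Re p < \<rho>} \<subseteq> pts"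
      proof
        fix p assume "p \<in> {p. p \<in> Rt \<and> Re p < \<rho>}"
        hence p: "p \<in> Rt" "Re p < \<rho>"
          by auto
        hence "norm p < K"
          using cmod_le[of p] Rt_bounds[OF p(1)] NB T unfolding K_def by linarith
        thus "p \<in> pts"
          using p P by (auto simp: pts_def)
      qed
      show "\<forall>p\<in>pts - {p. p \<in> Rt \<and> Re p < \<rho>}. winding_number ?g p * residue f p = 0"
        using Rt_out Lt_out by (auto simp: pts_def)
      show "winding_number ?g p * residue f p = - residue f p" if "p \<in> {p. p \<in> Rt \<and> Re p < \<rho>}" for p
        using Rt_in that by auto
    qed
    finally show "path_image ?g \<inter> P = {} \<and>
        contour_integral ?g f = - (2 * pi * \<i>) * (\<Sum>p | p \<in> Rt \<and> Re p < \<rho>. residue f p)"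
      using disj by (simp add: sum_negf)
  qed
qed

lemma segment_path_integral:
  assumes "N > 0" "(f has_contour_integral J) (segment_path N)"
  shows "((\<lambda>t. f (\<gamma> t) * vector_derivative \<gamma> (at t)) has_integral J) {-N..N}"
proof -
  obtain S where S: "finite S" "\<gamma> C1_differentiable_on (-S)"
    using C1_contour by blast
  let ?h = "\<lambda>t. f (\<gamma> t) * vector_derivative \<gamma> (at t)"
  define m where "m x = 2 * N * x + (- N)" for x
  have "((\<lambda>x. f (segment_path N x) * vector_derivative (segment_path N) (at x)) has_integral J) {0..1}"
    using assms(2) by (simp add: has_contour_integral)
  hence "((\<lambda>x. (2 * N) *\<^sub>R ?h (m x)) has_integral J) {0..1}"
  proof (rule has_integral_spike_finite[rotated 2])
    show "finite ((\<lambda>t. (t + N) / (2 * N)) ` S)"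
      using S by simp
    fix x assume x: "x \<in> {0..1} - (\<lambda>t. (t + N) / (2 * N)) ` S"
    have "m x \<notin> S"
    proof
      assume "m x \<in> S"
      moreover have "x = (m x + N) / (2 * N)"
        using assms(1) by (simp add: m_def)
      ultimately show False
        using x by blast
    qed
    hence "\<gamma> differentiable at (m x)"
      using S(2) unfolding C1_differentiable_on_eq by auto
    hence "(\<gamma> has_vector_derivative vector_derivative \<gamma> (at (m x))) (at (m x))"
      using vector_derivative_works by blast
    moreover have "(m has_vector_derivative 2 * N) (at x)"
      unfolding m_def by (auto intro!: derivative_eq_intros)
    ultimately have "((\<gamma> \<circ> m) has_vector_derivative (2 * N) *\<^sub>R vector_derivative \<gamma> (at (m x))) (at x)"
      by (intro vector_diff_chain_at)
    moreover have "segment_path N = \<gamma> \<circ> m"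
      by (auto simp: segment_path_def m_def)
    ultimately show "(2 * N) *\<^sub>R ?h (m x) = f (segment_path N x) * vector_derivative (segment_path N) (at x)"
      by (simp add: vector_derivative_at)
  qed
  hence "((\<lambda>x. (2 * N) *\<^sub>R ?h (m ((1 / (2 * N)) *\<^sub>R x + 1 / 2))) has_integral
           (J /\<^sub>R (1 / (2 * N)) ^ DIM(real))) (cbox ((0 - 1 / 2) /\<^sub>R (1 / (2 * N))) ((1 - 1 / 2) /\<^sub>R (1 / (2 * N))))"
    using assms(1) by (intro has_integral_affinity') auto
  moreover have "m ((1 / (2 * N)) *\<^sub>R x + 1 / 2) = x" for x
    using assms(1) by (simp add: m_def field_simps)
  ultimately have "((\<lambda>x. (2 * N) *\<^sub>R ?h x) has_integral ((2 * N) *\<^sub>R J)) {-N..N}"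
    using assms(1) by (simp add: field_simps)
  hence "((\<lambda>x. (1 / (2 * N)) *\<^sub>R ((2 * N) *\<^sub>R ?h x)) has_integral ((1 / (2 * N)) *\<^sub>R ((2 * N) *\<^sub>R J))) {-N..N}"
    by (rule has_integral_cmul)
  thus ?thesis
    using assms(1) by simp
qed

text \<open>
  A parameter with nonzero velocity is isolated in its fibre.
\<close>

lemma countable_regular_fibre:
  "countable {t. (\<exists>D. (\<gamma> has_vector_derivative D) (at t) \<and> D \<noteq> 0) \<and> \<gamma> t = p}" (is "countable ?X")
proof -
  \<comment> \<open>The fibre need not be sparse in the whole line, as its points may accumulate at parameters
      with velocity 0. It is sparse in the open set of points at which it does not accumulate.\<close>
  define D where "D = - {t. t islimpt ?X}"
  have "\<not> t islimpt ?X" if tX: "t \<in> ?X" for t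
  proof
    assume lim: "t islimpt ?X"
    obtain d where d: "(\<gamma> has_vector_derivative d) (at t)" "d \<noteq> 0" and t: "\<gamma> t = p"
      using tX by blast
    have "\<forall>e>0. \<exists>\<delta>>0. \<forall>y. norm (y - t) < \<delta> \<longrightarrow> norm (\<gamma> y - \<gamma> t - (y - t) *\<^sub>R d) \<le> e * norm (y - t)"
      using d(1) unfolding has_vector_derivative_def has_derivative_at_alt by blast
    then obtain \<delta> where \<delta>: "\<delta> > 0"
      "\<And>y. norm (y - t) < \<delta> \<Longrightarrow> norm (\<gamma> y - \<gamma> t - (y - t) *\<^sub>R d) \<le> norm d / 2 * norm (y - t)"
      using d(2) by (metis half_gt_zero zero_less_norm_iff)
    obtain y where y: "y \<in> ?X" "y \<noteq> t" "dist y t < \<delta>"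
      using lim \<delta>(1) unfolding islimpt_approachable by blast
    hence "norm ((y - t) *\<^sub>R d) \<le> norm d / 2 * norm (y - t)"
      using \<delta>(2)[of y] t by (simp add: dist_norm)
    thus False
      using y(2) d(2) by simp
  qed
  hence sub: "?X \<subseteq> D"
    by (auto simp: D_def)
  have "closed {t. t islimpt ?X}"
    by (rule closed_limpts)
  hence "open D"
    by (simp add: D_def open_Compl)
  moreover have "?X sparse_in D"
    using \<open>open D\<close> by (simp add: sparse_in_open D_def)
  ultimately have "countable (D \<inter> ?X)"
    by (rule sparse_imp_countable)
  thus ?thesis
    using sub by (simp add: Int_absorb1)
qed

text \<open>
  A contour may stay at a point for a while, so the parameters at which it visits a countable set can
  have positive measure. At almost all of them the velocity, and with it the integrand,
  is 0.
\<close>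

lemma line_integrand_spike:
  assumes "countable {z. f z \<noteq> g z}"
    and "((\<lambda>t. f (\<gamma> t) * vector_derivative \<gamma> (at t)) has_integral J) A"
  shows "((\<lambda>t. g (\<gamma> t) * vector_derivative \<gamma> (at t)) has_integral J) A"
proof -
  obtain S where S: "finite S" "\<gamma> C1_differentiable_on (-S)"
    using C1_contour by blast
  define X where "X p = {t. (\<exists>D. (\<gamma> has_vector_derivative D) (at t) \<and> D \<noteq> 0) \<and> \<gamma> t = p}" for p
  have "countable (S \<union> (\<Union>p\<in>{z. f z \<noteq> g z}. X p))"
    using countable_regular_fibre unfolding X_def
    by (intro countable_Un countable_UN[OF assms(1)] countable_finite[OF S(1)])
  hence "negligible (\<Union>((\<lambda>t. {t}) ` (S \<union> (\<Union>p\<in>{z. f z \<noteq> g z}. X p))))"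
    by (intro negligible_countable_Union countable_image) auto
  hence neg: "negligible (S \<union> (\<Union>p\<in>{z. f z \<noteq> g z}. X p))"
    by simp
  show ?thesis
  proof (rule has_integral_spike[OF neg _ assms(2)])
    fix t assume "t \<in> A - (S \<union> (\<Union>p\<in>{z. f z \<noteq> g z}. X p))"
    hence t: "t \<notin> S" "f (\<gamma> t) \<noteq> g (\<gamma> t) \<Longrightarrow> t \<notin> X (\<gamma> t)"
      by auto
    have "(\<gamma> has_vector_derivative vector_derivative \<gamma> (at t)) (at t)"
      using S(2) t(1) vector_derivative_works unfolding C1_differentiable_on_eq by blast
    hence "f (\<gamma> t) \<noteq> g (\<gamma> t) \<Longrightarrow> vector_derivative \<gamma> (at t) = 0"
      using t(2) unfolding X_def by blast
    thus "g (\<gamma> t) * vector_derivative \<gamma> (at t) = f (\<gamma> t) * vector_derivative \<gamma> (at t)"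
      by (cases "f (\<gamma> t) = g (\<gamma> t)") auto
  qed
qed

end

lemma norm_integral_exp_tail:
  fixes h :: "real \<Rightarrow> complex"
  assumes "h integrable_on {a..b}" "a \<le> b" "\<And>t. t \<in> {a..b} \<Longrightarrow> norm (h t) \<le> K * exp (- t)" "K \<ge> 0"
  shows "norm (integral {a..b} h) \<le> K * exp (- a)"
proof -
  have *: "((\<lambda>t. K * exp (- t)) has_integral ((- K * exp (- b)) - (- K * exp (- a)))) {a..b}"
    using assms(2)
    by (intro fundamental_theorem_of_calculus)
       (auto intro!: derivative_eq_intros simp flip: has_real_derivative_iff_has_vector_derivative)
  have "norm (integral {a..b} h) \<le> integral {a..b} (\<lambda>t. K * exp (- t))"
    using * by (intro integral_norm_bound_integral assms) (auto simp: integrable_on_def)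
  also have "\<dots> = (- K * exp (- b)) - (- K * exp (- a))"
    using * by (rule integral_unique)
  also have "\<dots> \<le> K * exp (- a)"
    using assms(4) by simp
  finally show ?thesis .
qed

text \<open>
  The gauge integral over the line compares arbitrary large intervals \<open>[a, b]\<close> with the limit. The
  symmetric interval inside \<open>[a, b]\<close> differs from it by two tails, which the exponential
  bound controls.
\<close>

lemma has_integral_UNIV_symmetric_limit:
  fixes h :: "real \<Rightarrow> complex" and J :: "nat \<Rightarrow> complex"
  assumes J: "\<And>n. n \<ge> n0 \<Longrightarrow> (h has_integral J n) {- real n..real n}"
    and decay: "\<And>t. \<bar>t\<bar> \<ge> real n0 \<Longrightarrow> norm (h t) \<le> K * exp (- \<bar>t\<bar>)"
    and lim: "J \<longlonglongrightarrow> I"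
  shows "(h has_integral I) UNIV"
proof -
  have K: "K \<ge> 0"
    using order_trans[OF norm_ge_zero decay[of "real n0"]] by (simp add: zero_le_mult_iff)
  have int: "h integrable_on {a..b}" for a b
  proof -
    obtain n where n: "real n \<ge> max (max \<bar>a\<bar> \<bar>b\<bar>) (real n0)"
      using real_arch_simple by blast
    hence "h integrable_on {- real n..real n}"
      using J[of n] by (auto simp: integrable_on_def)
    thus ?thesis
      by (rule integrable_on_subinterval) (use n in auto)
  qed
  have tail: "norm (integral {a..b} h - J n) \<le> 2 * K * exp (- real n)"
    if n: "n \<ge> n0" and ab: "a \<le> - real n" "real n \<le> b" for a b n
  proof -
    have "integral {a..b} h = integral {a..- real n} h + (integral {- real n..real n} h + integral {real n..b} h)"
      using ab int by (simp add: Henstock_Kurzweil_Integration.integral_combine)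
    moreover have "integral {- real n..real n} h = J n"
      by (rule integral_unique[OF J[OF n]])
    moreover have "norm (integral {real n..b} h) \<le> K * exp (- real n)"
      using ab int K n by (intro norm_integral_exp_tail) (auto intro!: order_trans[OF decay])
    moreover have "norm (integral {a..- real n} h) \<le> K * exp (- real n)"
    proof -
      have "norm (integral {real n..- a} (\<lambda>t. h (- t))) \<le> K * exp (- real n)"
        using ab int[of a "- real n"] K n
          Henstock_Kurzweil_Integration.integrable_reflect_real[where f = h and a = a and b = "- real n"]
        by (intro norm_integral_exp_tail) (auto intro!: order_trans[OF decay])
      thus ?thesis
        using Henstock_Kurzweil_Integration.integral_reflect_real[where f = h and a = a and b = "- real n"] by simp
    qed
    ultimately show ?thesis
      using norm_triangle_ineq[of "integral {a..- real n} h" "integral {real n..b} h"] by (simp add: algebra_simps)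
  qed
  show ?thesis
    unfolding has_integral_alt'
  proof (intro conjI allI impI)
    show "(\<lambda>x. if x \<in> UNIV then h x else 0) integrable_on cbox a b" for a b
      using int by simp
    fix e :: real assume e: "e > 0"
    have "(\<lambda>n. norm (J n - I) + 2 * K * exp (- real n)) \<longlonglongrightarrow> 0 + 2 * K * 0"
    proof (intro tendsto_intros)
      show "(\<lambda>n. norm (J n - I)) \<longlonglongrightarrow> 0"
        using lim by (simp add: LIM_zero tendsto_norm_zero)
      show "(\<lambda>n. exp (- real n)) \<longlonglongrightarrow> 0"
        by (intro filterlim_compose[OF exp_at_bot] filterlim_uminus_at_bot_at_top[THEN filterlim_compose] filterlim_real_sequentially)
    qed
    hence "eventually (\<lambda>n. norm (J n - I) + 2 * K * exp (- real n) < e) sequentially"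
      using e by (auto dest!: order_tendstoD(2)[where a = e])
    hence "eventually (\<lambda>n. norm (J n - I) + 2 * K * exp (- real n) < e \<and> n \<ge> n0 \<and> n > 0) sequentially"
      by (intro eventually_conj eventually_ge_at_top eventually_gt_at_top)
    then obtain n where n: "norm (J n - I) + 2 * K * exp (- real n) < e" "n \<ge> n0" "n > 0"
      by (auto simp: eventually_sequentially)
    show "\<exists>B>0. \<forall>a b. ball 0 B \<subseteq> cbox a b \<longrightarrow> norm (integral (cbox a b) (\<lambda>x. if x \<in> UNIV then h x else 0) - I) < e"
    proof (rule exI[of _ "real n + 1"], intro conjI allI impI)
      fix a b :: real assume "ball 0 (real n + 1) \<subseteq> cbox a b"
      moreover have "- real n \<in> ball 0 (real n + 1)" "real n \<in> ball 0 (real n + 1)"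
        by auto
      ultimately have "a \<le> - real n" "real n \<le> b"
        by (auto simp: subset_iff)
      hence "norm (integral {a..b} h - J n) \<le> 2 * K * exp (- real n)"
        using tail n by blast
      hence "norm (integral {a..b} h - I) < e"
        using n(1) norm_triangle_ineq[of "integral {a..b} h - J n" "J n - I"] by simp
      thus "norm (integral (cbox a b) (\<lambda>x. if x \<in> UNIV then h x else 0) - I) < e"
        by simp
    qed simp
  qed
qed

section \<open>The integrand\<close>

lemma qexp_add: "qexp \<omega> (x + y) = qexp \<omega> x * qexp \<omega> y"
  and qexp_diff: "qexp \<omega> (x - y) = qexp \<omega> x / qexp \<omega> y"
  and qexp_nonzero [simp]: "qexp \<omega> x \<noteq> 0"
  by (simp_all add: qexp_def field_simps flip: exp_add exp_diff)

lemma norm_qexp: "norm (qexp \<omega> x) = exp (- \<omega> * Re x)"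
  by (simp add: qexp_def norm_exp_eq_Re)

lemma qexp_of_nat: "qexp \<omega> (of_nat n) = qexp \<omega> 1 ^ n"
  by (simp add: qexp_def exp_of_nat_mult[symmetric] mult_ac)

lemma qexp_eq_1_iff:
  assumes "\<omega> > 0"
  shows "qexp \<omega> x = 1 \<longleftrightarrow> (\<exists>m::int. x = 2 * of_real pi * \<i> * of_int m / of_real \<omega>)"
proof
  assume "qexp \<omega> x = 1"
  then obtain n :: int where n: "Re (- of_real \<omega> * x) = 0" "Im (- of_real \<omega> * x) = of_int (2 * n) * pi"
    unfolding qexp_def exp_eq_1 by blast
  have "x = 2 * of_real pi * \<i> * of_int (-n) / of_real \<omega>"
    using n assms by (simp add: complex_eq_iff field_simps)
  thus "\<exists>m::int. x = 2 * of_real pi * \<i> * of_int m / of_real \<omega>"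
    by blast
next
  assume "\<exists>m::int. x = 2 * of_real pi * \<i> * of_int m / of_real \<omega>"
  then obtain m :: int where m: "x = 2 * of_real pi * \<i> * of_int m / of_real \<omega>"
    by blast
  have "- of_real \<omega> * x = 2 * of_int (-m) * pi * \<i>"
    using assms by (simp add: m)
  thus "qexp \<omega> x = 1"
    unfolding qexp_def exp_eq_1 by (intro conjI exI[of _ "-m"]) auto
qed

lemma qexp_analytic [analytic_intros]: "f analytic_on A \<Longrightarrow> (\<lambda>s. qexp \<omega> (f s)) analytic_on A"
  unfolding qexp_def by (intro analytic_intros)

lemma sin_pi_eq_0_iff:
  fixes z :: complex
  shows "sin (of_real pi * z) = 0 \<longleftrightarrow> (\<exists>n::int. z = of_int n)"
proof -
  have "of_real pi * z = of_real (of_int n * pi) \<longleftrightarrow> z = of_int n" for n :: int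
  proof -
    have "of_real (of_int n * pi) = of_real pi * (of_int n :: complex)"
      by simp
    thus ?thesis
      using mult_cancel_left[of "of_real pi" z "of_int n"] by simp
  qed
  thus ?thesis
    unfolding sin_eq_0 by simp
qed

definition barnes_weight ::
  "complex \<Rightarrow> complex \<Rightarrow> complex \<Rightarrow> complex \<Rightarrow> complex \<Rightarrow> complex \<Rightarrow> complex \<Rightarrow> complex \<Rightarrow> complex" where
  "barnes_weight q A B C D E F u =
     aa_weight q (1 / C) (1 / D) A B u * (qpoch_inf q (E * F * u) / qpoch_inf q (F * u))"

lemma barnes_weight_swap: "barnes_weight q A B C D E F = barnes_weight q A B D C E F"
  by (simp add: barnes_weight_def aa_weight_swap[of q "1 / C"] fun_eq_iff)

lemma barnes_weight_analytic_at:
  assumes "norm q < 1" "qpoch_inf q (A * u) \<noteq> 0" "qpoch_inf q (B * u) \<noteq> 0" "qpoch_inf q (F * u) \<noteq> 0"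
  shows "barnes_weight q A B C D E F analytic_on {u}"
  unfolding barnes_weight_def aa_weight_def using assms by (intro analytic_intros) auto

lemma barnes_weight_meromorphic:
  assumes "norm q < 1"
  shows "barnes_weight q A B C D E F meromorphic_on UNIV"
  unfolding barnes_weight_def aa_weight_def
  by (intro meromorphic_intros analytic_on_imp_meromorphic_on analytic_intros assms)

lemma norm_sin_ge_Re: "norm (sin z) \<ge> \<bar>sin (Re z)\<bar>"
proof -
  have "\<bar>sin (Re z)\<bar> * 1 \<le> \<bar>sin (Re z)\<bar> * cosh (Im z)"
    by (intro mult_left_mono cosh_real_ge_1) auto
  also have "\<dots> = \<bar>Re (sin z)\<bar>"
    by (simp add: Re_sin cosh_def abs_mult add.commute abs_of_pos add_pos_pos)
  finally show ?thesis
    using abs_Re_le_cmod[of "sin z"] by simp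
qed

text \<open>
  One of \<open>exp (\<i>z)\<close> and \<open>exp (-\<i>z)\<close> has modulus \<open>exp |Im z|\<close>, the other at most half of that.
\<close>

lemma norm_sin_ge_exp:
  assumes "\<bar>Im z\<bar> \<ge> 1"
  shows "norm (sin z) \<ge> exp \<bar>Im z\<bar> / 4"
proof -
  have "exp (2 * \<bar>Im z\<bar>) \<ge> 2"
    using exp_ge_add_one_self[of "2 * \<bar>Im z\<bar>"] assms by linarith
  hence "exp (- \<bar>Im z\<bar>) * 2 \<le> exp (- \<bar>Im z\<bar>) * exp (2 * \<bar>Im z\<bar>)"
    by (intro mult_left_mono) auto
  also have "\<dots> = exp \<bar>Im z\<bar>"
    by (simp flip: exp_add)
  finally have "exp (- \<bar>Im z\<bar>) \<le> exp \<bar>Im z\<bar> / 2"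
    by simp
  hence *: "\<bar>exp (- Im z) - exp (Im z)\<bar> \<ge> exp \<bar>Im z\<bar> / 2"
    by (cases "Im z \<ge> 0") auto
  have "norm (exp (\<i> * z) - exp (- (\<i> * z))) \<ge> \<bar>norm (exp (\<i> * z)) - norm (exp (- (\<i> * z)))\<bar>"
    by (rule norm_triangle_ineq3)
  hence "norm (exp (\<i> * z) - exp (- (\<i> * z))) \<ge> exp \<bar>Im z\<bar> / 2"
    using * by simp
  moreover have "norm (sin z) = norm (exp (\<i> * z) - exp (- (\<i> * z))) / 2"
    by (simp add: sin_exp_eq norm_divide norm_mult)
  ultimately show ?thesis
    by simp
qed

locale barnes =
  fixes \<omega> :: real and a b c d e f :: complex
  assumes \<omega>: "\<omega> > 0"
    and sin_cd: "sin (of_real pi * (c - d)) \<noteq> 0"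
    and nonzero_c: "qpoch_inf (qexp \<omega> 1) (qexp \<omega> (a + c)) \<noteq> 0" "qpoch_inf (qexp \<omega> 1) (qexp \<omega> (b + c)) \<noteq> 0"
                   "qpoch_inf (qexp \<omega> 1) (qexp \<omega> (f + c)) \<noteq> 0"
    and nonzero_d: "qpoch_inf (qexp \<omega> 1) (qexp \<omega> (a + d)) \<noteq> 0" "qpoch_inf (qexp \<omega> 1) (qexp \<omega> (b + d)) \<noteq> 0"
                   "qpoch_inf (qexp \<omega> 1) (qexp \<omega> (f + d)) \<noteq> 0"
begin

abbreviation Q :: "complex \<Rightarrow> complex" where "Q \<equiv> qexp \<omega>"
abbreviation q :: complex where "q \<equiv> qexp \<omega> 1"
abbreviation F :: "complex \<Rightarrow> complex" where "F \<equiv> barnes_integrand \<omega> a b c d e f"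

definition G :: "complex \<Rightarrow> complex" where
  "G = barnes_weight q (Q a) (Q b) (Q c) (Q d) (Q e) (Q f)"

text \<open>
  The factor of the integrand that is not a function of \<open>q\<^sup>s\<close>. It provides the decay in vertical
  directions and the increasing sequences of poles.
\<close>

definition kern :: "complex \<Rightarrow> complex" where
  "kern s = of_real pi * Q s / (sin (of_real pi * (c - s)) * sin (of_real pi * (d - s)))"

lemma q: "norm q < 1"
  using \<omega> by (simp add: norm_qexp)

lemma F_eq: "F s = G (Q s) * kern s"
  unfolding barnes_integrand_def qpochs_inf_def G_def kern_def barnes_weight_def aa_weight_def
  by (simp add: qexp_add qexp_diff mult_ac)

lemma F_swap: "barnes_integrand \<omega> a b d c e f = F"
  by (simp add: fun_eq_iff barnes_integrand_def qpochs_inf_def mult_ac)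

lemma swap: "barnes \<omega> a b d c f"
proof
  show "sin (of_real pi * (d - c)) \<noteq> 0"
    using sin_cd sin_minus[of "of_real pi * (c - d)"] by (simp add: algebra_simps)
qed (use \<omega> nonzero_c nonzero_d in auto)

lemma G_swap: "barnes_weight q (Q a) (Q b) (Q d) (Q c) (Q e) (Q f) = G"
  unfolding G_def by (rule barnes_weight_swap)

lemma G_meromorphic: "G meromorphic_on UNIV"
  unfolding G_def by (rule barnes_weight_meromorphic[OF q])

lemma kern_analytic:
  assumes "sin (of_real pi * (c - s)) \<noteq> 0" "sin (of_real pi * (d - s)) \<noteq> 0"
  shows "kern analytic_on {s}"
  unfolding kern_def using assms by (intro analytic_intros) auto

lemma F_meromorphic: "F meromorphic_on A"
proof -
  have "(\<lambda>s. G (Q s) * kern s) meromorphic_on A"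
    unfolding kern_def G_def barnes_weight_def aa_weight_def
    by (intro meromorphic_intros analytic_on_imp_meromorphic_on analytic_intros q)
  thus ?thesis
    by (simp add: F_eq[abs_def])
qed

lemma G_analytic_at_Q:
  assumes "qpoch_inf q (Q (a + s)) \<noteq> 0" "qpoch_inf q (Q (b + s)) \<noteq> 0" "qpoch_inf q (Q (f + s)) \<noteq> 0"
  shows "(\<lambda>s. G (Q s)) analytic_on {s}"
proof -
  have "G analytic_on {Q s}"
    unfolding G_def using assms by (intro barnes_weight_analytic_at q) (simp_all add: qexp_add)
  hence "(G \<circ> Q) analytic_on {s}"
    using analytic_on_compose[of Q "{s}" G] qexp_analytic[of "\<lambda>s. s" "{s}" \<omega>] by simp
  thus ?thesis
    by (simp add: o_def)
qed

lemma qpoch_inf_Q_zero: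
  assumes "qpoch_inf q (Q (x + s)) = 0"
  shows "\<exists>(n::nat) (m::int). s = - x - of_nat n + 2 * of_real pi * \<i> * of_int m / of_real \<omega>"
proof -
  obtain n where "Q (x + s) * q ^ n = 1"
    using assms qpoch_inf_eq_0_iff[OF q] by blast
  hence "Q (x + s + of_nat n) = 1"
    by (simp add: qexp_add qexp_of_nat)
  then obtain m :: int where "x + s + of_nat n = 2 * of_real pi * \<i> * of_int m / of_real \<omega>"
    using qexp_eq_1_iff[OF \<omega>] by blast
  thus ?thesis
    by (intro exI[of _ n] exI[of _ m]) (simp add: algebra_simps eq_diff_eq)
qed

lemma sin_d_nonzero:
  assumes "s = c - of_int n"
  shows "sin (of_real pi * (d - s)) \<noteq> 0"
proof
  assume "sin (of_real pi * (d - s)) = 0"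
  then obtain m :: int where "d - s = of_int m"
    unfolding sin_pi_eq_0_iff by blast
  hence "c - d = of_int (n - m)"
    using assms by (simp add: algebra_simps)
  thus False
    using sin_cd unfolding sin_pi_eq_0_iff by blast
qed

lemma deriv_sin_c:
  assumes "s = c - of_int n"
  shows "((\<lambda>w. sin (of_real pi * (c - w))) has_field_derivative (- of_real pi * cos (of_real pi * of_int n))) (at s)"
  using assms by (auto intro!: derivative_eq_intros)

lemma cos_pi_nonzero: "cos (of_real pi * of_int n :: complex) \<noteq> 0"
proof -
  have "sin (of_real pi * of_int n :: complex) = 0"
    by (auto simp: sin_pi_eq_0_iff)
  thus ?thesis
    using sin_cos_squared_add[of "of_real pi * of_int n :: complex"] by auto
qed

text \<open>
  At \<open>s = c - n\<close> with \<open>n > 0\<close> the simple zero of the sine is compensated by the zero of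
  \<open>(q\<^bsup>1-c+s\<^esup>;q)\<^sub>\<infinity>\<close>.
\<close>

lemma not_pole_compensated:
  assumes s: "s = c - of_int n" "n > 0"
    and nz: "qpoch_inf q (Q (a + s)) \<noteq> 0" "qpoch_inf q (Q (b + s)) \<noteq> 0" "qpoch_inf q (Q (f + s)) \<noteq> 0"
  shows "\<not> is_pole F s"
proof -
  define P where "P w = qpoch_inf q (q * (1 / Q c) * Q w)" for w
  define r where "r w = qpoch_inf q (q * (1 / Q d) * Q w) / (qpoch_inf q (Q a * Q w) * qpoch_inf q (Q b * Q w)) *
      (qpoch_inf q (Q e * Q f * Q w) / qpoch_inf q (Q f * Q w)) * of_real pi * Q w / sin (of_real pi * (d - w))" for w
  have F: "F w = P w / sin (of_real pi * (c - w)) * r w" for w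
    unfolding F_eq G_def barnes_weight_def aa_weight_def kern_def P_def r_def by (simp add: mult_ac)
  have "r analytic_on {s}"
    unfolding r_def using nz sin_d_nonzero[OF s(1)]
    by (intro analytic_intros q) (auto simp: qexp_add)
  hence r: "r \<midarrow>s\<rightarrow> r s"
    using analytic_at_imp_isCont isContD by blast
  have "P analytic_on {s}"
    unfolding P_def by (intro analytic_intros q)
  then obtain P' where P': "(P has_field_derivative P') (at s)"
    using analytic_at_imp_isCont analytic_on_imp_differentiable_at field_differentiable_def by blast
  have "q * (1 / Q c) * Q s * q ^ (nat n - 1) = 1"
  proof -
    have "q * (1 / Q c) * Q s * q ^ (nat n - 1) = Q s * q ^ nat n / Q c"
      using s(2) by (cases "nat n") auto
    also have "\<dots> = Q (s + of_nat (nat n) - c)"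
      by (simp add: qexp_add qexp_diff qexp_of_nat)
    also have "s + of_nat (nat n) - c = 0"
      using s by simp
    finally show ?thesis
      by (simp add: qexp_def)
  qed
  hence "P s = 0"
    unfolding P_def using qpoch_inf_eq_0_iff[OF q] by blast
  moreover have "sin (of_real pi * (c - s)) = 0"
    unfolding sin_pi_eq_0_iff using s by auto
  ultimately have "(\<lambda>w. P w / sin (of_real pi * (c - w))) \<midarrow>s\<rightarrow> P' / (- of_real pi * cos (of_real pi * of_int n))"
    using cos_pi_nonzero[of n] by (intro lhopital_complex_simple[OF P' deriv_sin_c[OF s(1)]]) auto
  hence "F \<midarrow>s\<rightarrow> P' / (- of_real pi * cos (of_real pi * of_int n)) * r s"
    unfolding F by (intro tendsto_mult r)
  thus ?thesis
    unfolding is_pole_def using not_tendsto_and_filterlim_at_infinity[of "at s"] by auto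
qed

lemma pole_cases_c:
  assumes "is_pole F s" "sin (of_real pi * (c - s)) = 0"
  shows "(\<exists>n::nat. s = c + of_nat n) \<or>
    (\<exists>x\<in>{a, b, f}. \<exists>(n::nat) (m::int). s = - x - of_nat n + 2 * of_real pi * \<i> * of_int m / of_real \<omega>)"
proof -
  obtain n :: int where n: "c - s = of_int n"
    using assms(2) unfolding sin_pi_eq_0_iff by blast
  hence s: "s = c - of_int n"
    by (simp add: algebra_simps)
  show ?thesis
  proof (cases "n > 0")
    case True
    thus ?thesis
      using not_pole_compensated[OF s True] assms(1) qpoch_inf_Q_zero by blast
  next
    case False
    hence "s = c + of_nat (nat (- n))"
      using s by simp
    thus ?thesis
      by blast
  qed
qed

lemma F_regular_if_factors_nonzero:
  assumes "qpoch_inf q (Q (a + s)) \<noteq> 0" "qpoch_inf q (Q (b + s)) \<noteq> 0" "qpoch_inf q (Q (f + s)) \<noteq> 0"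
    "sin (of_real pi * (c - s)) \<noteq> 0" "sin (of_real pi * (d - s)) \<noteq> 0"
  shows "\<not> is_pole F s"
proof -
  have "(\<lambda>s. G (Q s) * kern s) analytic_on {s}"
    using assms by (intro analytic_on_mult G_analytic_at_Q kern_analytic)
  thus ?thesis
    unfolding F_eq[abs_def, symmetric] using analytic_at_imp_no_pole by blast
qed

text \<open>
  Both \<open>1 / sin \<pi>(c - s)\<close> and \<open>1 / sin \<pi>(d - s)\<close> contribute a sign \<open>(-1)\<^sup>n\<close>; the signs cancel.
  The formula also covers the points at which \<open>G\<close> vanishes and the integrand has no pole.
\<close>

lemma residue_F_c:
  "residue F (c + of_nat n) = - (Q c * q ^ n * G (Q c * q ^ n)) / sin (of_real pi * (d - c))"
proof -
  let ?s = "c + of_nat n"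
  have s: "?s = c - of_int (- int n)"
    by simp
  define U where "U w = G (Q w) * (of_real pi * Q w / sin (of_real pi * (d - w)))" for w
  have nz: "qpoch_inf q (Q (x + ?s)) \<noteq> 0" if "qpoch_inf q (Q (x + c)) \<noteq> 0" for x
  proof -
    have "Q (x + ?s) = Q (x + c) * q ^ n"
      by (simp add: qexp_add qexp_of_nat)
    thus ?thesis
      using qpoch_inf_shift_nonzero[OF q that] by simp
  qed
  have "U analytic_on {?s}"
    unfolding U_def using nonzero_c sin_d_nonzero[OF s]
    by (intro analytic_on_mult G_analytic_at_Q nz analytic_intros) auto
  hence U: "U \<midarrow>?s\<rightarrow> U ?s"
    using analytic_at_imp_isCont isContD by blast
  have cosn: "cos (of_real pi * of_int (- int n) :: complex) = (-1) ^ n"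
  proof -
    have "cos (of_real pi * of_int (- int n) :: complex) = cos (of_real (pi * real n))"
      by simp
    also have "\<dots> = (-1) ^ n"
      unfolding cos_of_real cos_npi2 by simp
    finally show ?thesis .
  qed
  have "((\<lambda>w. w - ?s) has_field_derivative 1) (at ?s)"
    by (auto intro!: derivative_eq_intros)
  moreover have "sin (of_real pi * (c - ?s)) = 0"
    unfolding sin_pi_eq_0_iff by (intro exI[of _ "- int n"]) auto
  ultimately have "(\<lambda>w. (w - ?s) / sin (of_real pi * (c - w))) \<midarrow>?s\<rightarrow> 1 / (- of_real pi * cos (of_real pi * of_int (- int n)))"
    using cos_pi_nonzero[of "- int n"] by (intro lhopital_complex_simple[OF _ deriv_sin_c[OF s]]) auto
  hence "(\<lambda>w. U w * ((w - ?s) / sin (of_real pi * (c - w)))) \<midarrow>?s\<rightarrow> U ?s * (1 / (- of_real pi * (-1) ^ n))"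
    unfolding cosn by (intro tendsto_mult U)
  moreover have "U w * ((w - ?s) / sin (of_real pi * (c - w))) = F w * (w - ?s)" for w
    by (simp add: U_def F_eq kern_def)
  ultimately have lim: "(\<lambda>w. F w * (w - ?s)) \<midarrow>?s\<rightarrow> U ?s * (1 / (- of_real pi * (-1) ^ n))"
    by simp
  have "isolated_singularity_at F ?s"
    using meromorphic_on_isolated_singularity F_meromorphic by blast
  then obtain r where r: "r > 0" "F analytic_on ball ?s r - {?s}"
    unfolding isolated_singularity_at_def by blast
  have "residue F ?s = U ?s * (1 / (- of_real pi * (-1) ^ n))"
    by (rule residue_simple'[OF open_ball _ _ lim, of _ r]) (use r analytic_imp_holomorphic in auto)
  moreover have "sin (of_real pi * (d - ?s)) = (-1) ^ n * sin (of_real pi * (d - c))"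
  proof -
    have "sin (of_real pi * (d - ?s)) = sin (of_real pi * (d - c) + of_real pi * of_int (- int n))"
      by (simp add: algebra_simps)
    also have "\<dots> = sin (of_real pi * (d - c)) * (-1) ^ n"
    proof -
      have "sin (of_real pi * of_int (- int n) :: complex) = 0"
        unfolding sin_pi_eq_0_iff by blast
      thus ?thesis
        unfolding sin_add cosn by simp
    qed
    finally show ?thesis
      by (simp only: mult.commute)
  qed
  moreover have "Q ?s = Q c * q ^ n"
    by (simp add: qexp_add qexp_of_nat)
  ultimately show ?thesis
    unfolding U_def by (cases "even n") simp_all
qed

lemma residue_F_not_pole:
  assumes "\<not> is_pole F s"
  shows "residue F s = 0"
proof -
  have iso: "isolated_singularity_at F s"
    using meromorphic_on_isolated_singularity F_meromorphic by blast
  hence "\<not> is_pole (remove_sings F) s"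
    using assms by simp
  hence "remove_sings F analytic_on {s}"
    by (intro nicely_meromorphic_on_imp_analytic_at[OF remove_sings_nicely_meromorphic[OF F_meromorphic[of UNIV]]]) auto
  then obtain S where "open S" "s \<in> S" "remove_sings F holomorphic_on S"
    unfolding analytic_at by blast
  hence "residue (remove_sings F) s = 0"
    by (intro residue_holo)
  thus ?thesis
    using iso by simp
qed

interpretation sw: barnes \<omega> a b d c e f
  by (rule swap)

lemma residue_F_d:
  "residue F (d + of_nat n) = - (Q d * q ^ n * G (Q d * q ^ n)) / sin (of_real pi * (c - d))"
  using sw.residue_F_c[of n] unfolding F_swap sw.G_def G_swap .

text \<open>
  By the symmetry in \<open>c\<close> and \<open>d\<close> it suffices to examine the zeros of one of the sines.
\<close>

lemma poles_subset:
  assumes "is_pole F s"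
  shows "s \<in> increasing_poles \<omega> a b c d e f \<union> decreasing_poles \<omega> a b c d e f"
proof -
  consider "sin (of_real pi * (c - s)) = 0" | "sin (of_real pi * (d - s)) = 0"
    | "qpoch_inf q (Q (a + s)) = 0 \<or> qpoch_inf q (Q (b + s)) = 0 \<or> qpoch_inf q (Q (f + s)) = 0"
    using F_regular_if_factors_nonzero[of s] assms by blast
  hence "(\<exists>x\<in>{c, d}. \<exists>n::nat. s = x + of_nat n) \<or>
    (\<exists>x\<in>{a, b, f}. \<exists>(n::nat) (m::int). s = - x - of_nat n + 2 * of_real pi * \<i> * of_int m / of_real \<omega>)"
  proof cases
    case 1
    thus ?thesis
      using pole_cases_c[OF assms] by blast
  next
    case 2
    thus ?thesis
      using sw.pole_cases_c[of s] assms unfolding F_swap by blast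
  next
    case 3
    thus ?thesis
      using qpoch_inf_Q_zero by blast
  qed
  thus ?thesis
    using assms unfolding increasing_poles_def decreasing_poles_def by blast
qed

end

section \<open>Evaluation of the integral\<close>

lemma less_nat_ceiling_iff: "k < nat \<lceil>x\<rceil> \<longleftrightarrow> real k < x"
  by (simp add: zless_nat_eq_int_zless less_ceiling_iff)

locale barnes_contour = barnes \<omega> a b c d e f + vcontour \<gamma> T B \<sigma>\<^sub>1 \<sigma>\<^sub>2
  for \<omega> :: real and a b c d e f :: complex and \<gamma> T B \<sigma>\<^sub>1 \<sigma>\<^sub>2 +
  assumes cd_bounds: "\<bar>Re c\<bar> \<le> B" "\<bar>Im c\<bar> \<le> B" "\<bar>Re d\<bar> \<le> B" "\<bar>Im d\<bar> \<le> B"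
    and inc: "increasing_poles \<omega> a b c d e f \<subseteq> right_of_contour \<gamma>"
    and dec: "decreasing_poles \<omega> a b c d e f \<subseteq> left_of_contour \<gamma>"
begin

definition \<sigma> :: real where "\<sigma> = min \<sigma>\<^sub>1 \<sigma>\<^sub>2"

abbreviation G' :: "complex \<Rightarrow> complex" where "G' \<equiv> remove_sings G"
abbreviation F' :: "complex \<Rightarrow> complex" where "F' \<equiv> remove_sings F"

lemma increasing_pole_bounds:
  assumes "p \<in> increasing_poles \<omega> a b c d e f"
  shows "\<bar>Im p\<bar> \<le> B \<and> - B \<le> Re p"
  using assms cd_bounds unfolding increasing_poles_def by auto

lemma eventually_Q_neq: "eventually (\<lambda>w. Q w \<noteq> Q s) (at s)"
proof -
  have "eventually (\<lambda>w. w \<in> ball s (2 * pi / \<omega>) - {s}) (at s)"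
    using \<omega> by (intro eventually_at_in_open) auto
  thus ?thesis
  proof eventually_elim
    case (elim w)
    show ?case
    proof
      assume "Q w = Q s"
      hence "Q (w - s) = 1"
        by (simp add: qexp_diff)
      then obtain m :: int where m: "w - s = 2 * of_real pi * \<i> * of_int m / of_real \<omega>"
        using qexp_eq_1_iff[OF \<omega>] by blast
      hence "norm (w - s) = 2 * pi / \<omega> * \<bar>real_of_int m\<bar>"
        using \<omega> by (simp add: norm_mult norm_divide)
      moreover have "norm (w - s) < 2 * pi / \<omega>"
        using elim by (simp add: dist_norm norm_minus_commute)
      ultimately have "2 * pi / \<omega> * \<bar>real_of_int m\<bar> < 2 * pi / \<omega> * 1"
        by simp
      hence "\<bar>real_of_int m\<bar> < 1"
        using \<omega> by (subst (asm) mult_less_cancel_left_pos) auto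
      hence "m = 0"
        by linarith
      thus False
        using m elim by simp
    qed
  qed
qed

lemma Q_tendsto: "Q \<midarrow>s\<rightarrow> Q s"
  using qexp_analytic[of "\<lambda>s. s" "{s}" \<omega>] analytic_at_imp_isCont isContD by fastforce

lemma sin_nonzero_high:
  assumes "\<bar>Im s\<bar> > B"
  shows "sin (of_real pi * (c - s)) \<noteq> 0" "sin (of_real pi * (d - s)) \<noteq> 0"
proof -
  have "x - s \<noteq> of_int n" if "\<bar>Im x\<bar> \<le> B" for x and n :: int
  proof
    assume "x - s = of_int n"
    hence "Im x = Im s"
      by (auto simp: complex_eq_iff)
    thus False
      using that assms by simp
  qed
  thus "sin (of_real pi * (c - s)) \<noteq> 0" "sin (of_real pi * (d - s)) \<noteq> 0"
    unfolding sin_pi_eq_0_iff using cd_bounds by blast+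
qed

lemma G_pole_imp_F_pole:
  assumes "is_pole G (Q s)" "\<bar>Im s\<bar> > B"
  shows "is_pole F s"
proof -
  have "is_pole (\<lambda>w. G (Q w)) s"
    by (rule is_pole_compose[OF assms(1) Q_tendsto eventually_Q_neq])
  moreover have "kern analytic_on {s}"
    by (intro kern_analytic sin_nonzero_high assms)
  moreover have "kern s \<noteq> 0"
    using sin_nonzero_high[OF assms(2)] by (simp add: kern_def)
  ultimately have "is_pole (\<lambda>w. G (Q w) * kern w) s"
    by (rule is_pole_mult_analytic_nonzero2)
  thus ?thesis
    by (simp add: F_eq[abs_def])
qed

lemma high_F_pole_is_left:
  assumes "is_pole F s" "\<bar>Im s\<bar> > B"
  shows "s \<in> left_of_contour \<gamma>"
proof -
  have "s \<notin> increasing_poles \<omega> a b c d e f"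
    using increasing_pole_bounds[of s] assms(2) by linarith
  thus ?thesis
    using poles_subset[OF assms(1)] dec by blast
qed

text \<open>
  A pole of \<open>G\<close> at \<open>q\<^sup>s\<close> is repeated by periodicity at all heights. At large heights the sines
  do not interfere, so the integrand has a decreasing pole there, and this pole lies to the left of the
  ray. Hence \<open>G\<close> has no poles in the disc that corresponds to the half-plane to the right
  of both rays.
\<close>

lemma G_no_pole:
  assumes "norm u \<le> exp (- \<omega> * \<sigma>)"
  shows "\<not> is_pole G u"
proof
  assume pole: "is_pole G u"
  have "u \<noteq> 0"
  proof
    assume "u = 0"
    hence "G analytic_on {u}"
      unfolding G_def by (intro barnes_weight_analytic_at q) auto
    thus False
      using pole analytic_at_imp_no_pole by blast
  qed
  define s0 where "s0 = - Ln u / of_real \<omega>"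
  \<comment> \<open>The preimages of \<open>u\<close> under \<open>q\<^sup>s\<close>.\<close>
  define s where "s m = s0 + 2 * of_real pi * \<i> * of_int m / of_real \<omega>" for m :: int
  have "Q s0 = u"
    using \<omega> \<open>u \<noteq> 0\<close> by (simp add: qexp_def s0_def)
  have Qs: "Q (s m) = u" for m
  proof -
    have "Q (2 * of_real pi * \<i> * of_int m / of_real \<omega>) = 1"
      using qexp_eq_1_iff[OF \<omega>] by blast
    thus ?thesis
      using \<open>Q s0 = u\<close> by (simp add: s_def qexp_add)
  qed
  have Res: "Re (s m) = Re s0" for m
    by (simp add: s_def Re_divide_of_real)
  have Ims: "Im (s m) = Im s0 + 2 * pi * m / \<omega>" for m
    by (simp add: s_def Im_divide_of_real)
  have "Re s0 \<ge> \<sigma>"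
    using assms \<omega> \<open>Q s0 = u\<close> norm_qexp[of \<omega> s0] by simp
  have left: "s m \<in> left_of_contour \<gamma>" if "\<bar>Im (s m)\<bar> > B" for m
    using pole that by (intro high_F_pole_is_left G_pole_imp_F_pole) (simp_all only: Qs)
  have rescale: "x = 2 * pi / \<omega> * (x * \<omega> / (2 * pi))" for x
    using \<omega> by simp
  have period_pos: "2 * pi / \<omega> > 0"
    using \<omega> by simp
  from \<open>Re s0 \<ge> \<sigma>\<close> consider "Re s0 \<ge> \<sigma>\<^sub>2" | "Re s0 \<ge> \<sigma>\<^sub>1"
    by (auto simp: \<sigma>_def min_def split: if_splits)
  thus False
  proof cases
    case 1
    define m where "m = \<lfloor>(B - Im s0) * \<omega> / (2 * pi)\<rfloor> + 1"
    have "(B - Im s0) * \<omega> / (2 * pi) < of_int m"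
      unfolding m_def by linarith
    hence "B - Im s0 < 2 * pi / \<omega> * of_int m"
      using mult_strict_left_mono[OF _ period_pos] rescale[of "B - Im s0"] by metis
    hence high: "Im (s m) > B"
      by (simp add: Ims)
    hence "Re (s m) < \<sigma>\<^sub>2"
      by (intro left_high_imp_Re_less left) auto
    thus False
      using 1 Res by simp
  next
    case 2
    define m where "m = \<lceil>(- B - Im s0) * \<omega> / (2 * pi)\<rceil> - 1"
    have "of_int m < (- B - Im s0) * \<omega> / (2 * pi)"
      unfolding m_def by linarith
    hence "2 * pi / \<omega> * of_int m < - B - Im s0"
      using mult_strict_left_mono[OF _ period_pos] rescale[of "- B - Im s0"] by metis
    hence low: "Im (s m) < - B"
      by (simp add: Ims)
    hence "Re (s m) < \<sigma>\<^sub>1"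
      by (intro left_low_imp_Re_less left) auto
    thus False
      using 2 Res by simp
  qed
qed

lemma G'_analytic:
  assumes "norm u \<le> exp (- \<omega> * \<sigma>)"
  shows "G' analytic_on {u}"
proof (rule nicely_meromorphic_on_imp_analytic_at[OF remove_sings_nicely_meromorphic[OF G_meromorphic]])
  have "isolated_singularity_at G u"
    using meromorphic_on_isolated_singularity meromorphic_on_subset[OF G_meromorphic] by blast
  thus "\<not> is_pole G' u"
    using G_no_pole[OF assms] by simp
qed auto

text \<open>
  The half-plane \<open>Re s \<ge> \<sigma>\<close> corresponds to a compact disc in the variable \<open>u\<close>, since \<open>u = 0\<close>,
  the image of \<open>+\<infinity>\<close>, is a regular point. So a single constant bounds the periodic factor on the
  whole half-plane.
\<close>

lemma G'_bounded: "\<exists>M\<ge>0. \<forall>u. norm u \<le> exp (- \<omega> * \<sigma>) \<longrightarrow> norm (G' u) \<le> M"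
proof -
  have "G' analytic_on cball 0 (exp (- \<omega> * \<sigma>))"
    using G'_analytic by (subst analytic_on_analytic_at) auto
  hence "compact (G' ` cball 0 (exp (- \<omega> * \<sigma>)))"
    by (intro compact_continuous_image holomorphic_on_imp_continuous_on analytic_imp_holomorphic compact_cball)
  hence "bounded (G' ` cball 0 (exp (- \<omega> * \<sigma>)))"
    by (rule compact_imp_bounded)
  then obtain M where "\<forall>x\<in>G' ` cball 0 (exp (- \<omega> * \<sigma>)). norm x \<le> M"
    unfolding bounded_iff by blast
  hence M: "norm (G' u) \<le> M" if "u \<in> cball 0 (exp (- \<omega> * \<sigma>))" for u :: complex
    using that by blast
  show ?thesis
  proof (intro exI[of _ "\<bar>M\<bar>"] conjI allI impI)
    fix u :: complex
    assume "norm u \<le> exp (- \<omega> * \<sigma>)"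
    hence "norm (G' u) \<le> M"
      by (intro M) simp
    thus "norm (G' u) \<le> \<bar>M\<bar>"
      by linarith
  qed simp
qed

lemma F'_eq:
  assumes "Re s \<ge> \<sigma>" "sin (of_real pi * (c - s)) \<noteq> 0" "sin (of_real pi * (d - s)) \<noteq> 0"
  shows "F' s = G' (Q s) * kern s"
proof (rule remove_sings_eqI)
  have "norm (Q s) \<le> exp (- \<omega> * \<sigma>)"
    using assms(1) \<omega> by (simp add: norm_qexp)
  hence "isCont G' (Q s)"
    by (rule analytic_at_imp_isCont[OF G'_analytic])
  hence "(\<lambda>w. G' (Q w)) \<midarrow>s\<rightarrow> G' (Q s)"
    by (rule isCont_tendsto_compose[OF _ Q_tendsto])
  moreover have "kern \<midarrow>s\<rightarrow> kern s"
    by (rule isContD[OF analytic_at_imp_isCont[OF kern_analytic[OF assms(2,3)]]])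
  ultimately have lim: "(\<lambda>w. G' (Q w) * kern w) \<midarrow>s\<rightarrow> G' (Q s) * kern s"
    by (rule tendsto_mult)
  have "isolated_singularity_at G (Q s)"
    using meromorphic_on_isolated_singularity meromorphic_on_subset[OF G_meromorphic] by blast
  hence "eventually (\<lambda>u. G' u = G u) (at (Q s))"
    by (rule eventually_remove_sings_eq_at)
  moreover have "filterlim Q (at (Q s)) (at s)"
    unfolding filterlim_at using Q_tendsto[of s] eventually_Q_neq[of s] by auto
  ultimately have "eventually (\<lambda>w. G' (Q w) = G (Q w)) (at s)"
    by (rule eventually_compose_filterlim)
  hence "eventually (\<lambda>w. G' (Q w) * kern w = F w) (at s)"
    by (rule eventually_mono) (simp only: F_eq)
  with lim show "F \<midarrow>s\<rightarrow> G' (Q s) * kern s"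
    by (rule Lim_transform_eventually)
qed

lemma norm_F'_le:
  assumes M: "\<And>u. norm u \<le> exp (- \<omega> * \<sigma>) \<Longrightarrow> norm (G' u) \<le> M"
    and s: "Re s \<ge> \<sigma>" and \<delta>: "0 < \<delta>\<^sub>c" "0 < \<delta>\<^sub>d"
    and sin: "\<delta>\<^sub>c \<le> norm (sin (of_real pi * (c - s)))" "\<delta>\<^sub>d \<le> norm (sin (of_real pi * (d - s)))"
  shows "norm (F' s) \<le> M * pi * exp (- \<omega> * Re s) / (\<delta>\<^sub>c * \<delta>\<^sub>d)"
proof -
  have nz: "sin (of_real pi * (c - s)) \<noteq> 0" "sin (of_real pi * (d - s)) \<noteq> 0"
    using sin \<delta> by auto
  have "norm (F' s) = norm (G' (Q s)) * (pi * exp (- \<omega> * Re s) /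
      (norm (sin (of_real pi * (c - s))) * norm (sin (of_real pi * (d - s)))))"
    unfolding F'_eq[OF s nz] kern_def by (simp add: norm_mult norm_divide norm_qexp)
  also have "\<dots> \<le> M * (pi * exp (- \<omega> * Re s) / (\<delta>\<^sub>c * \<delta>\<^sub>d))"
  proof (rule mult_mono)
    show GM: "norm (G' (Q s)) \<le> M"
      using s \<omega> by (intro M) (simp add: norm_qexp)
    thus "0 \<le> M"
      by (rule order_trans[OF norm_ge_zero])
    show "pi * exp (- \<omega> * Re s) / (norm (sin (of_real pi * (c - s))) * norm (sin (of_real pi * (d - s))))
            \<le> pi * exp (- \<omega> * Re s) / (\<delta>\<^sub>c * \<delta>\<^sub>d)"
      using sin \<delta> by (intro divide_left_mono mult_mono mult_pos_pos) auto
  qed (use \<delta> in auto)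
  finally show ?thesis
    by simp
qed

text \<open>
  The exponential growth of one sine is enough; the other one only has to stay away from 0.
\<close>

lemma norm_F'_high:
  assumes M: "\<And>u. norm u \<le> exp (- \<omega> * \<sigma>) \<Longrightarrow> norm (G' u) \<le> M"
    and s: "Re s \<ge> \<sigma>" "\<bar>Im s\<bar> \<ge> B + 1"
  shows "norm (F' s) \<le> 16 * M * pi * exp (- \<omega> * \<sigma>) * exp B * exp (- \<bar>Im s\<bar>)"
proof -
  have sin_ge: "exp (\<bar>Im s\<bar> - B) / 4 \<le> norm (sin (of_real pi * (x - s))) \<and> \<bar>Im s\<bar> - B \<ge> 1"
    if "\<bar>Im x\<bar> \<le> B" for x
  proof -
    have "\<bar>Im s\<bar> - B \<le> 1 * \<bar>Im (x - s)\<bar>"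
      using that by simp
    also have "\<dots> \<le> pi * \<bar>Im (x - s)\<bar>"
      using pi_ge_two by (intro mult_right_mono) auto
    also have "\<dots> = \<bar>Im (of_real pi * (x - s))\<bar>"
      by (simp add: abs_mult)
    finally have *: "\<bar>Im s\<bar> - B \<le> \<bar>Im (of_real pi * (x - s))\<bar>" .
    hence "exp (\<bar>Im s\<bar> - B) / 4 \<le> exp \<bar>Im (of_real pi * (x - s))\<bar> / 4"
      by simp
    also have "\<dots> \<le> norm (sin (of_real pi * (x - s)))"
      using * s(2) by (intro norm_sin_ge_exp) linarith
    finally show ?thesis
      using s(2) by simp
  qed
  have "1 / 4 \<le> exp (\<bar>Im s\<bar> - B) / 4"
    using s(2) by simp
  also have "\<dots> \<le> norm (sin (of_real pi * (d - s)))"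
    using sin_ge[of d] cd_bounds by blast
  finally have "norm (F' s) \<le> M * pi * exp (- \<omega> * Re s) / ((exp (\<bar>Im s\<bar> - B) / 4) * (1 / 4))"
    using sin_ge[of c] cd_bounds by (intro norm_F'_le M s) auto
  also have "\<dots> = 16 * M * pi * exp B * exp (- \<bar>Im s\<bar>) * exp (- \<omega> * Re s)"
  proof -
    have "exp (\<bar>Im s\<bar> - B) * (exp B * exp (- \<bar>Im s\<bar>)) = 1"
      by (simp flip: exp_add)
    hence "1 / exp (\<bar>Im s\<bar> - B) = exp B * exp (- \<bar>Im s\<bar>)"
      by (simp add: divide_eq_eq mult.commute)
    moreover have "M * pi * exp (- \<omega> * Re s) / ((exp (\<bar>Im s\<bar> - B) / 4) * (1 / 4)) =
        16 * M * pi * exp (- \<omega> * Re s) * (1 / exp (\<bar>Im s\<bar> - B))"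
      by simp
    ultimately show ?thesis
      by (simp only: mult_ac)
  qed
  also have "\<dots> \<le> 16 * M * pi * exp B * exp (- \<bar>Im s\<bar>) * exp (- \<omega> * \<sigma>)"
  proof (intro mult_left_mono)
    have "0 \<le> M"
      using order_trans[OF norm_ge_zero M[of 0]] by simp
    thus "0 \<le> 16 * M * pi * exp B * exp (- \<bar>Im s\<bar>)"
      by simp
  qed (use s \<omega> in auto)
  finally show ?thesis
    by (simp only: mult_ac)
qed


lemma poles_sparse: "{p. is_pole F p} sparse_in UNIV"
  using meromorphic_on_imp_not_pole_cosparse[OF F_meromorphic[of UNIV]]
  by (simp add: eventually_cosparse)

lemma open_not_pole: "open (- {p. is_pole F p})"
  by (intro open_Compl sparse_in_UNIV_imp_closed poles_sparse)

lemma F'_holomorphic: "F' holomorphic_on (- {p. is_pole F p})"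
proof (rule analytic_imp_holomorphic)
  have "F' analytic_on {z}" if "\<not> is_pole F z" for z
  proof (rule nicely_meromorphic_on_imp_analytic_at[OF remove_sings_nicely_meromorphic[OF F_meromorphic[of UNIV]]])
    have "isolated_singularity_at F z"
      using meromorphic_on_isolated_singularity F_meromorphic by blast
    thus "\<not> is_pole F' z"
      using that by simp
  qed auto
  thus "F' analytic_on (- {p. is_pole F p})"
    by (subst analytic_on_analytic_at) auto
qed

lemma finite_poles:
  assumes "compact K"
  shows "finite ({p. is_pole F p} \<inter> K)"
proof -
  have "{p. is_pole F p} sparse_in K"
    using poles_sparse by (rule sparse_in_subset) auto
  from sparse_in_compact_finite[OF this assms] show ?thesis
    by (simp add: Int_commute)
qed

lemma countable_F_neq_F': "countable {z. F' z \<noteq> F z}"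
proof -
  have "eventually (\<lambda>z. F' z = F z) (cosparse UNIV)"
    by (rule eventually_remove_sings_eq[OF F_meromorphic])
  hence "{z. F' z \<noteq> F z} sparse_in UNIV"
    by (simp add: eventually_cosparse)
  from sparse_imp_countable[OF open_UNIV this] show ?thesis
    by simp
qed

lemma residue_F': "residue F' p = residue F p"
proof -
  have "isolated_singularity_at F p"
    using meromorphic_on_isolated_singularity F_meromorphic by blast
  thus ?thesis
    by simp
qed

text \<open>
  Points \<open>c + k\<close> and \<open>d + k\<close> that are not poles have residue 0, so they may be added to the sum.
\<close>

lemma sum_residues:
  "(\<Sum>p | p \<in> increasing_poles \<omega> a b c d e f \<and> Re p < \<rho>. residue F' p) =
     (\<Sum>k<nat \<lceil>\<rho> - Re c\<rceil>. residue F (c + of_nat k)) + (\<Sum>k<nat \<lceil>\<rho> - Re d\<rceil>. residue F (d + of_nat k))"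
proof -
  define X where "X x = (\<lambda>k. x + of_nat k) ` {..<nat \<lceil>\<rho> - Re x\<rceil>}" for x :: complex
  have X_iff: "x + of_nat k \<in> X x \<longleftrightarrow> Re (x + of_nat k) < \<rho>" for x k
    unfolding X_def by (auto simp: less_nat_ceiling_iff image_iff)
  have X_Re: "Re p < \<rho>" if "p \<in> X x" for p x
    using that unfolding X_def by (auto simp: less_nat_ceiling_iff)
  have disj: "X c \<inter> X d = {}"
  proof (rule ccontr)
    assume "X c \<inter> X d \<noteq> {}"
    then obtain j k :: nat where "c + of_nat j = d + of_nat k"
      unfolding X_def by blast
    hence "c - d = of_int (int k - int j)"
      by (simp add: algebra_simps)
    thus False
      using sin_cd unfolding sin_pi_eq_0_iff by blast
  qed
  have sum_X: "(\<Sum>p\<in>X x. residue F p) = (\<Sum>k<nat \<lceil>\<rho> - Re x\<rceil>. residue F (x + of_nat k))" for x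
    unfolding X_def by (subst sum.reindex) (auto simp: inj_on_def)
  have "(\<Sum>p | p \<in> increasing_poles \<omega> a b c d e f \<and> Re p < \<rho>. residue F' p) = (\<Sum>p\<in>X c \<union> X d. residue F p)"
    unfolding residue_F'
  proof (rule sum.mono_neutral_left)
    show "finite (X c \<union> X d)"
      by (simp add: X_def)
    show "{p. p \<in> increasing_poles \<omega> a b c d e f \<and> Re p < \<rho>} \<subseteq> X c \<union> X d"
      unfolding increasing_poles_def using X_iff by auto
    show "\<forall>p\<in>X c \<union> X d - {p. p \<in> increasing_poles \<omega> a b c d e f \<and> Re p < \<rho>}. residue F p = 0"
    proof
      fix p assume p: "p \<in> X c \<union> X d - {p. p \<in> increasing_poles \<omega> a b c d e f \<and> Re p < \<rho>}"
      hence "Re p < \<rho>"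
        using X_Re by blast
      hence "p \<notin> increasing_poles \<omega> a b c d e f"
        using p by blast
      moreover have "\<exists>x\<in>{c, d}. \<exists>n::nat. p = x + of_nat n"
        using p unfolding X_def by blast
      ultimately have "\<not> is_pole F p"
        unfolding increasing_poles_def by blast
      thus "residue F p = 0"
        by (rule residue_F_not_pole)
    qed
  qed
  also have "\<dots> = (\<Sum>p\<in>X c. residue F p) + (\<Sum>p\<in>X d. residue F p)"
    using disj by (intro sum.union_disjoint) (auto simp: X_def)
  finally show ?thesis
    unfolding sum_X .
qed

lemma residues_sums:
  "(\<lambda>k. residue F (c + of_nat k)) sums (- jackson q G (Q c) / sin (of_real pi * (d - c)))"
  "(\<lambda>k. residue F (d + of_nat k)) sums (- jackson q G (Q d) / sin (of_real pi * (c - d)))"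
proof -
  have "jconv q G x" for x
  proof -
    have "(\<lambda>n. aa_weight q (1 / Q c) (1 / Q d) (Q a) (Q b) (x * q ^ n) *
        (qpoch_inf q (Q e * Q f * (x * q ^ n)) / qpoch_inf q (Q f * (x * q ^ n)))) \<longlonglongrightarrow>
          1 * (qpoch_inf q (Q e * Q f * 0) / qpoch_inf q (Q f * 0))"
      by (intro tendsto_intros aa_weight_tendsto tendsto_mult_qpower_zero q) auto
    thus ?thesis
      unfolding jconv_def G_def barnes_weight_def by (rule convergentI)
  qed
  hence "(\<lambda>k. x * q ^ k * G (x * q ^ k)) sums jackson q G x" for x
    unfolding jackson_def by (intro summable_sums jackson_summable q) auto
  thus "(\<lambda>k. residue F (c + of_nat k)) sums (- jackson q G (Q c) / sin (of_real pi * (d - c)))"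
    "(\<lambda>k. residue F (d + of_nat k)) sums (- jackson q G (Q d) / sin (of_real pi * (c - d)))"
    unfolding residue_F_c residue_F_d by (intro sums_divide sums_minus; blast)+
qed

lemma sum_residues_tendsto:
  "(\<lambda>n. \<Sum>p | p \<in> increasing_poles \<omega> a b c d e f \<and> Re p < \<rho> + real n. residue F' p) \<longlonglongrightarrow>
     - jackson_between q G (Q c) (Q d) / sin (of_real pi * (d - c))"
proof -
  have lim: "filterlim (\<lambda>n. nat \<lceil>\<rho> + real n - x\<rceil>) at_top sequentially" for x :: real
  proof (rule filterlim_at_top_mono)
    show "filterlim (\<lambda>n. n - nat \<lceil>x - \<rho>\<rceil>) at_top sequentially"
      by (rule filterlim_minus_const_nat_at_top)
    have "n - nat \<lceil>x - \<rho>\<rceil> \<le> nat \<lceil>\<rho> + real n - x\<rceil>" for n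
      by linarith
    thus "eventually (\<lambda>n. n - nat \<lceil>x - \<rho>\<rceil> \<le> nat \<lceil>\<rho> + real n - x\<rceil>) sequentially"
      by simp
  qed
  note r = residues_sums[unfolded sums_def]
  have "(\<lambda>n. (\<Sum>k<nat \<lceil>\<rho> + real n - Re c\<rceil>. residue F (c + of_nat k)) +
             (\<Sum>k<nat \<lceil>\<rho> + real n - Re d\<rceil>. residue F (d + of_nat k))) \<longlonglongrightarrow>
          - jackson q G (Q c) / sin (of_real pi * (d - c)) + - jackson q G (Q d) / sin (of_real pi * (c - d))"
    by (intro tendsto_add filterlim_compose[OF r(1) lim] filterlim_compose[OF r(2) lim])
  also have "sin (of_real pi * (c - d)) = - sin (of_real pi * (d - c))"
    using sin_minus[of "of_real pi * (d - c)"] by (simp add: algebra_simps)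
  finally show ?thesis
    unfolding sum_residues jackson_between_def by (simp add: diff_divide_distrib)
qed

text \<open>
  The rectangle of stage \<open>n\<close> reaches from height \<open>-n\<close> to \<open>n\<close> and has its right side at \<open>\<rho>\<^sub>0 + n\<close>. The integral over its
  horizontal sides is at most of order \<open>n exp (-n)\<close>, by the growth of the sines, and the one over the
  vertical side of order \<open>n q\<^sup>n\<close>.
\<close>

theorem has_line_integral_barnes:
  "has_line_integral F (2 * of_real pi * \<i> * (jackson_between q G (Q c) (Q d) / sin (of_real pi * (d - c)))) \<gamma>"
proof -
  let ?inc = "increasing_poles \<omega> a b c d e f"
  obtain M where M: "M \<ge> 0" "\<And>u. norm u \<le> exp (- \<omega> * \<sigma>) \<Longrightarrow> norm (G' u) \<le> M"
    using G'_bounded by blast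
  have "\<exists>R. \<forall>N \<rho>. N > R \<longrightarrow> \<rho> > R \<longrightarrow> \<rho> \<notin> Re ` ?inc \<longrightarrow>
           path_image (boxed_path N \<rho>) \<inter> {p. is_pole F p} = {} \<and>
           contour_integral (boxed_path N \<rho>) F' = - (2 * pi * \<i>) * (\<Sum>p | p \<in> ?inc \<and> Re p < \<rho>. residue F' p)"
    by (rule contour_integral_boxed_path[where Lt = "decreasing_poles \<omega> a b c d e f"])
       (use poles_subset increasing_pole_bounds inc dec finite_poles F'_holomorphic in
        \<open>auto simp: increasing_poles_def\<close>)
  then obtain R where R: "\<And>N \<rho>. N > R \<Longrightarrow> \<rho> > R \<Longrightarrow> \<rho> \<notin> Re ` ?inc \<Longrightarrow>
           path_image (boxed_path N \<rho>) \<inter> {p. is_pole F p} = {} \<and>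
           contour_integral (boxed_path N \<rho>) F' = - (2 * pi * \<i>) * (\<Sum>p | p \<in> ?inc \<and> Re p < \<rho>. residue F' p)"
    by blast
  \<comment> \<open>With the right sides at \<open>\<rho>\<^sub>0 + n\<close> the distance to the zeros of the sines is the same at every stage.\<close>
  obtain \<rho>\<^sub>0 :: real where \<rho>\<^sub>0: "\<rho>\<^sub>0 \<notin> range (\<lambda>k::int. Re c + of_int k) \<union> range (\<lambda>k::int. Re d + of_int k)"
  proof -
    have "countable (range (\<lambda>k::int. Re c + of_int k) \<union> range (\<lambda>k::int. Re d + of_int k))"
      by (intro countable_Un countable_image) auto
    hence "range (\<lambda>k::int. Re c + of_int k) \<union> range (\<lambda>k::int. Re d + of_int k) \<noteq> UNIV"
      using uncountable_UNIV_real by metis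
    thus ?thesis
      using that by blast
  qed
  define \<delta> where "\<delta> x = \<bar>sin (pi * (x - \<rho>\<^sub>0))\<bar>" for x
  have \<delta>_pos: "\<delta> (Re c) > 0" "\<delta> (Re d) > 0"
  proof -
    have "\<delta> x > 0" if "\<rho>\<^sub>0 \<notin> range (\<lambda>k::int. x + of_int k)" for x
    proof -
      have "sin (pi * (x - \<rho>\<^sub>0)) \<noteq> 0"
      proof
        assume "sin (pi * (x - \<rho>\<^sub>0)) = 0"
        then obtain k :: int where "pi * (x - \<rho>\<^sub>0) = of_int k * pi"
          unfolding sin_zero_iff_int2 by blast
        hence "\<rho>\<^sub>0 = x + of_int (- k)"
          by (simp add: algebra_simps) (metis add_diff_cancel_left' diff_add_cancel mult_cancel_left pi_neq_zero right_diff_distrib)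
        thus False
          using that by blast
      qed
      thus ?thesis
        by (simp add: \<delta>_def)
    qed
    thus "\<delta> (Re c) > 0" "\<delta> (Re d) > 0"
      using \<rho>\<^sub>0 by auto
  qed
  have \<delta>_le: "\<delta> (Re x) \<le> norm (sin (of_real pi * (x - s)))" if "Re s = \<rho>\<^sub>0 + real n" for x s n
  proof -
    have "sin (Re (of_real pi * (x - s))) = sin (pi * (Re x - \<rho>\<^sub>0) - pi * real n)"
      using that by (simp add: algebra_simps)
    also have "\<bar>\<dots>\<bar> = \<delta> (Re x)"
      unfolding sin_diff by (simp add: \<delta>_def abs_mult sin_npi2)
    finally show ?thesis
      using norm_sin_ge_Re[of "of_real pi * (x - s)"] by simp
  qed
  define n0 where "n0 = nat \<lceil>max (max (B + 1) R) (max R B - \<rho>\<^sub>0)\<rceil> + 1"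
  have n0: "real n \<ge> B + 1" "real n > R" "\<rho>\<^sub>0 + real n > R" "\<rho>\<^sub>0 + real n \<ge> B" if "n \<ge> n0" for n
  proof -
    have "max (max (B + 1) R) (max R B - \<rho>\<^sub>0) < real n"
      using that unfolding n0_def by linarith
    thus "real n \<ge> B + 1" "real n > R" "\<rho>\<^sub>0 + real n > R" "\<rho>\<^sub>0 + real n \<ge> B"
      by auto
  qed
  define K where "K = 16 * M * pi * exp (- \<omega> * \<sigma>) * exp B"
  have K: "K \<ge> 0"
    using M(1) by (simp add: K_def)
  have high: "norm (F' s) \<le> K * exp (- \<bar>Im s\<bar>)" if "Re s \<ge> \<sigma>" "\<bar>Im s\<bar> \<ge> B + 1" for s
    using norm_F'_high[OF M(2) that] by (simp add: K_def)
  define J where "J n = contour_integral (segment_path (real n)) F'" for n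
  define ret where "ret n = contour_integral (return_path (real n) (\<rho>\<^sub>0 + real n)) F'" for n
  define S where "S n = (\<Sum>p | p \<in> ?inc \<and> Re p < \<rho>\<^sub>0 + real n. residue F' p)" for n
  define bd where "bd n = K * exp (- real n) * (\<bar>\<rho>\<^sub>0\<bar> + real n + B) +
      M * pi * exp (- \<omega> * (\<rho>\<^sub>0 + real n)) / (\<delta> (Re c) * \<delta> (Re d)) * (2 * real n) +
      K * exp (- real n) * (\<bar>\<rho>\<^sub>0\<bar> + real n + B)" for n
  have main: "(F' has_contour_integral J n) (segment_path (real n)) \<and> J n = - (2 * pi * \<i>) * S n - ret n \<and> norm (ret n) \<le> bd n"
    if n: "n \<ge> n0" for n
  proof -
    let ?N = "real n" and ?\<rho> = "\<rho>\<^sub>0 + real n"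
    have N: "?N \<ge> B" "?\<rho> \<ge> B" "?N > 0"
      using n0[OF n] T by auto
    have "?\<rho> \<notin> Re ` ?inc"
    proof
      assume "?\<rho> \<in> Re ` ?inc"
      then obtain p where p: "p \<in> ?inc" "?\<rho> = Re p"
        by blast
      then obtain x and k :: nat where x: "x \<in> {c, d}" "p = x + of_nat k"
        unfolding increasing_poles_def by blast
      hence "\<rho>\<^sub>0 = Re x + of_int (int k - int n)"
        using p(2) by simp
      thus False
        using \<rho>\<^sub>0 x(1) by blast
    qed
    note box = R[OF n0(2,3)[OF n] this]
    have path: "path_image (boxed_path ?N ?\<rho>) = path_image (segment_path ?N) \<union> path_image (return_path ?N ?\<rho>)"
      unfolding boxed_path_def by (rule path_image_join) simp
    have int1: "F' contour_integrable_on segment_path ?N"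
      using box path
      by (intro contour_integrable_holomorphic_simple[OF F'_holomorphic open_not_pole] valid_segment_path N) auto
    have ret_sub: "path_image (return_path ?N ?\<rho>) \<subseteq> - {p. is_pole F p}"
      using box path by auto
    have int2: "F' contour_integrable_on return_path ?N ?\<rho>"
      by (intro contour_integrable_holomorphic_simple[OF F'_holomorphic open_not_pole] valid_return_path ret_sub)
    have "contour_integral (boxed_path ?N ?\<rho>) F' = J n + ret n"
      unfolding boxed_path_def J_def ret_def
      by (intro contour_integral_join int1 int2 valid_segment_path valid_return_path N)
    hence eq: "J n = - (2 * pi * \<i>) * S n - ret n"
      using box unfolding S_def by (simp add: eq_diff_eq)
    have seg_int: "F' contour_integrable_on linepath x y" if "closed_segment x y \<subseteq> path_image (return_path ?N ?\<rho>)" for x y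
      using that ret_sub
      by (intro contour_integrable_holomorphic_simple[OF F'_holomorphic open_not_pole]) auto
    let ?p1 = "\<gamma> ?N" and ?p2 = "Complex ?\<rho> ?N" and ?p3 = "Complex ?\<rho> (- ?N)" and ?p4 = "\<gamma> (- ?N)"
    have i1: "F' contour_integrable_on linepath ?p1 ?p2" and i2: "F' contour_integrable_on linepath ?p2 ?p3"
      and i3: "F' contour_integrable_on linepath ?p3 ?p4"
      by (rule seg_int, unfold path_image_return_path, blast)+
    have ret_eq: "ret n = contour_integral (linepath ?p1 ?p2) F' +
        (contour_integral (linepath ?p2 ?p3) F' + contour_integral (linepath ?p3 ?p4) F')"
      unfolding ret_def return_path_def using i1 i2 i3
      by (simp add: contour_integrable_join)
    have sig: "\<sigma> \<le> \<sigma>\<^sub>1" "\<sigma> \<le> \<sigma>\<^sub>2" "\<sigma> \<le> B"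
      using sigma_bound by (auto simp: \<sigma>_def)
    have b1: "norm (contour_integral (linepath ?p1 ?p2) F') \<le> K * exp (- ?N) * norm (?p2 - ?p1)"
    proof (rule contour_integral_bound_linepath[OF i1])
      fix s assume "s \<in> closed_segment ?p1 ?p2"
      hence s: "Re s \<ge> \<sigma>" "Im s = ?N"
        using sig N contour_ends[OF N(1)] by (auto dest!: closed_segment_Re_Im)
      thus "norm (F' s) \<le> K * exp (- ?N)"
        using high[of s] n0[OF n] N by simp
    qed (use K in simp)
    have b3: "norm (contour_integral (linepath ?p3 ?p4) F') \<le> K * exp (- ?N) * norm (?p4 - ?p3)"
    proof (rule contour_integral_bound_linepath[OF i3])
      fix s assume "s \<in> closed_segment ?p3 ?p4"
      hence s: "Re s \<ge> \<sigma>" "Im s = - ?N"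
        using sig N contour_ends[OF N(1)] by (auto dest!: closed_segment_Re_Im)
      thus "norm (F' s) \<le> K * exp (- ?N)"
        using high[of s] n0[OF n] N by simp
    qed (use K in simp)
    have b2: "norm (contour_integral (linepath ?p2 ?p3) F') \<le>
        M * pi * exp (- \<omega> * ?\<rho>) / (\<delta> (Re c) * \<delta> (Re d)) * norm (?p3 - ?p2)"
    proof (rule contour_integral_bound_linepath[OF i2])
      fix s assume "s \<in> closed_segment ?p2 ?p3"
      hence s: "Re s = ?\<rho>"
        by (auto dest!: closed_segment_Re_Im)
      moreover have "Re s \<ge> \<sigma>"
        using s sig N by simp
      ultimately show "norm (F' s) \<le> M * pi * exp (- \<omega> * ?\<rho>) / (\<delta> (Re c) * \<delta> (Re d))"
        using norm_F'_le[OF M(2) _ \<delta>_pos \<delta>_le[OF s] \<delta>_le[OF s]] by simp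
    qed (use M(1) \<delta>_pos in simp)
    have l1: "norm (?p2 - ?p1) \<le> \<bar>\<rho>\<^sub>0\<bar> + ?N + B" and l3: "norm (?p4 - ?p3) \<le> \<bar>\<rho>\<^sub>0\<bar> + ?N + B"
      and l2: "norm (?p3 - ?p2) = 2 * ?N"
    proof -
      show "norm (?p2 - ?p1) \<le> \<bar>\<rho>\<^sub>0\<bar> + ?N + B"
        using cmod_le[of "?p2 - ?p1"] sigma_bound unfolding contour_ends[OF N(1)] by simp
      show "norm (?p4 - ?p3) \<le> \<bar>\<rho>\<^sub>0\<bar> + ?N + B"
        using cmod_le[of "?p4 - ?p3"] sigma_bound unfolding contour_ends[OF N(1)] by simp
      show "norm (?p3 - ?p2) = 2 * ?N"
      proof -
        have "?p3 - ?p2 = Complex 0 (- (2 * ?N))"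
          by (simp add: complex_eq_iff)
        thus ?thesis
          by (simp add: cmod_def real_sqrt_mult)
      qed
    qed
    have "norm (ret n) \<le> norm (contour_integral (linepath ?p1 ?p2) F') +
        (norm (contour_integral (linepath ?p2 ?p3) F') + norm (contour_integral (linepath ?p3 ?p4) F'))"
      unfolding ret_eq by (intro order_trans[OF norm_triangle_ineq] add_left_mono norm_triangle_ineq)
    also have "\<dots> \<le> K * exp (- ?N) * (\<bar>\<rho>\<^sub>0\<bar> + ?N + B) +
        (M * pi * exp (- \<omega> * ?\<rho>) / (\<delta> (Re c) * \<delta> (Re d)) * (2 * ?N) + K * exp (- ?N) * (\<bar>\<rho>\<^sub>0\<bar> + ?N + B))"
      using K by (intro add_mono order_trans[OF b1] order_trans[OF b3] b2[unfolded l2] mult_left_mono l1 l3) auto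
    finally have "norm (ret n) \<le> bd n"
      by (simp add: bd_def)
    moreover have "(F' has_contour_integral J n) (segment_path ?N)"
      unfolding J_def by (rule has_contour_integral_integral[OF int1])
    ultimately show ?thesis
      using eq by blast
  qed
  have "bd \<longlonglongrightarrow> 0"
  proof -
    define r where "r = \<bar>\<rho>\<^sub>0\<bar> + B"
    define L where "L = 2 * M * pi * exp (- \<omega> * \<rho>\<^sub>0) / (\<delta> (Re c) * \<delta> (Re d))"
    have lim1: "(\<lambda>n. real n * exp (- x * real n)) \<longlonglongrightarrow> 0" if "x > 0" for x :: real
      using that by real_asymp
    have lim2: "(\<lambda>n. exp (- real n)) \<longlonglongrightarrow> 0"
      by real_asymp
    have bd_eq: "bd n = 2 * K * (r * exp (- real n) + real n * exp (- 1 * real n)) + L * (real n * exp (- \<omega> * real n))" for n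
    proof -
      have "exp (- \<omega> * (\<rho>\<^sub>0 + real n)) = exp (- \<omega> * \<rho>\<^sub>0) * exp (- \<omega> * real n)"
        by (simp add: algebra_simps flip: exp_add)
      thus ?thesis
        unfolding bd_def by (simp add: r_def L_def algebra_simps)
    qed
    have "(\<lambda>n. 2 * K * (r * exp (- real n) + real n * exp (- 1 * real n)) + L * (real n * exp (- \<omega> * real n)))
        \<longlonglongrightarrow> 2 * K * (r * 0 + 0) + L * 0"
      by (intro tendsto_add tendsto_mult tendsto_const lim1 lim2) (use \<omega> in auto)
    thus ?thesis
      unfolding bd_eq[abs_def] by simp
  qed
  moreover have "eventually (\<lambda>n. norm (ret n) \<le> bd n) sequentially"
    using main by (auto simp: eventually_at_top_linorder)
  ultimately have ret: "ret \<longlonglongrightarrow> 0"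
    by (rule Lim_null_comparison[rotated])
  have "(\<lambda>n. - (2 * pi * \<i>) * S n - ret n) \<longlonglongrightarrow>
      - (2 * pi * \<i>) * (- jackson_between q G (Q c) (Q d) / sin (of_real pi * (d - c))) - 0"
    unfolding S_def by (intro tendsto_intros sum_residues_tendsto ret)
  moreover have "eventually (\<lambda>n. - (2 * pi * \<i>) * S n - ret n = J n) sequentially"
    using main unfolding eventually_at_top_linorder by metis
  ultimately have "J \<longlonglongrightarrow> - (2 * pi * \<i>) * (- jackson_between q G (Q c) (Q d) / sin (of_real pi * (d - c))) - 0"
    by (rule Lim_transform_eventually)
  hence J: "J \<longlonglongrightarrow> 2 * of_real pi * \<i> * (jackson_between q G (Q c) (Q d) / sin (of_real pi * (d - c)))"
    by simp
  have "((\<lambda>t. F' (\<gamma> t) * vector_derivative \<gamma> (at t)) has_integral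
      (2 * of_real pi * \<i> * (jackson_between q G (Q c) (Q d) / sin (of_real pi * (d - c))))) UNIV"
  proof (rule has_integral_UNIV_symmetric_limit[OF _ _ J])
    show "((\<lambda>t. F' (\<gamma> t) * vector_derivative \<gamma> (at t)) has_integral J n) {- real n..real n}" if "n \<ge> n0" for n
      using main[OF that] n0(1)[OF that] T by (intro segment_path_integral) auto
    show "norm (F' (\<gamma> t) * vector_derivative \<gamma> (at t)) \<le> K * exp (- \<bar>t\<bar>)" if "\<bar>t\<bar> \<ge> real n0" for t
    proof -
      have t: "\<bar>t\<bar> \<ge> B + 1" "\<bar>t\<bar> > T"
        using n0(1)[of n0] that T by auto
      have "vector_derivative \<gamma> (at t) = \<i>"
        using vertical_ray_derivative[OF t(2)] by (rule vector_derivative_at)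
      moreover have "Re (\<gamma> t) \<ge> \<sigma> \<and> Im (\<gamma> t) = t"
        using t lo[of t] hi[of t] by (cases "t \<ge> 0") (auto simp: \<sigma>_def)
      ultimately show ?thesis
        using high[of "\<gamma> t"] t by (simp add: norm_mult)
    qed
  qed
  thus ?thesis
    unfolding has_line_integral_def by (rule line_integrand_spike[OF countable_F_neq_F'])
qed

end

theorem theorem7p1:
  fixes \<omega> :: real and a b c d e f q :: complex and Q :: "complex \<Rightarrow> complex"
    and \<gamma> :: "real \<Rightarrow> complex"
  defines "Q \<equiv> qexp \<omega>" and "q \<equiv> qexp \<omega> 1"
  assumes "\<omega> > 0"
    and "Max {norm (Q f), norm (Q (c + f)), norm (Q (d + f))} < 1"
    and "sin (of_real pi * (c - d)) \<noteq> 0"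
    and "qpochs_inf q [Q (a + c), Q (a + d), Q (b + c), Q (b + d), Q (c + f)] \<noteq> 0"
    and "\<And>k. qpochs q [q, Q (c + e + f), Q (a + b + c + d)] k \<noteq> 0"
    and "vertical_contour \<gamma>"
    and "increasing_poles \<omega> a b c d e f \<subseteq> right_of_contour \<gamma>"
    and "decreasing_poles \<omega> a b c d e f \<subseteq> left_of_contour \<gamma>"
  shows "\<exists>I. has_line_integral (barnes_integrand \<omega> a b c d e f) I \<gamma> \<and>
    1 / (2 * of_real pi * \<i>) * I =
      Q c / sin (of_real pi * (d - c)) *
      (qpochs_inf q [q, Q (1 + c - d), Q (d - c), Q (a + b + c + d), Q (c + e + f)] /
       qpochs_inf q [Q (a + c), Q (a + d), Q (b + c), Q (b + d), Q (c + f)]) *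
      phi32 (Q e) (Q (a + c)) (Q (b + c)) (Q (c + e + f)) (Q (a + b + c + d)) q (Q (d + f))"
proof -
  have q_less: "norm q < 1" and q0: "q \<noteq> 0"
    using assms(3) by (simp_all add: q_def norm_qexp)
  have small: "norm (Q (c + f)) < 1" "norm (Q (d + f)) < 1"
    using assms(4) by auto
  have nz: "qpoch_inf q (Q (a + c)) \<noteq> 0" "qpoch_inf q (Q (a + d)) \<noteq> 0" "qpoch_inf q (Q (b + c)) \<noteq> 0"
    "qpoch_inf q (Q (b + d)) \<noteq> 0"
    using assms(6) by (auto simp: qpochs_inf_def)
  have nz_f: "qpoch_inf q (Q (c + f)) \<noteq> 0" "qpoch_inf q (Q (d + f)) \<noteq> 0"
    by (intro qpoch_inf_nonzero q_less small)+
  have ABCD: "qpoch q (Q (a + b + c + d)) k \<noteq> 0" and CEF: "qpoch q (Q (c + e + f)) k \<noteq> 0" for k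
    using assms(7)[of k] by (auto simp: qpochs_def)
  obtain T \<sigma>\<^sub>1 \<sigma>\<^sub>2 B\<^sub>0 where vc: "\<And>B. B \<ge> B\<^sub>0 \<Longrightarrow> vcontour \<gamma> T B \<sigma>\<^sub>1 \<sigma>\<^sub>2"
    using vertical_contour_imp_vcontour[OF assms(8)] by blast
  define B where "B = Max {B\<^sub>0, \<bar>Re c\<bar>, \<bar>Im c\<bar>, \<bar>Re d\<bar>, \<bar>Im d\<bar>}"
  have B: "B \<ge> B\<^sub>0" "\<bar>Re c\<bar> \<le> B" "\<bar>Im c\<bar> \<le> B" "\<bar>Re d\<bar> \<le> B" "\<bar>Im d\<bar> \<le> B"
    by (simp_all add: B_def del: Max_insert)
  interpret vcontour \<gamma> T B \<sigma>\<^sub>1 \<sigma>\<^sub>2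
    by (rule vc[OF B(1)])
  interpret barnes_contour \<omega> a b c d e f \<gamma> T B \<sigma>\<^sub>1 \<sigma>\<^sub>2
    by unfold_locales
      (use assms(3,5,9,10) B nz nz_f in \<open>auto simp: q_def Q_def add.commute[of f]\<close>)
  let ?JB = "jackson_between q G (Q c) (Q d)"
  have G: "G = (\<lambda>u. aa_weight q (1 / Q c) (1 / Q d) (Q a) (Q b) u * (qpoch_inf q (Q e * Q f * u) / qpoch_inf q (Q f * u)))"
    by (simp add: G_def barnes_weight_def fun_eq_iff Q_def q_def)
  have "?JB = Q c * qpoch_inf q q * qpoch_inf q (Q d / Q c) * qpoch_inf q (q * Q c / Q d) *
      qpoch_inf q (Q a * Q b * Q c * Q d) * qpoch_inf q (Q c * Q e * Q f) /
     (qpoch_inf q (Q a * Q c) * qpoch_inf q (Q a * Q d) * qpoch_inf q (Q b * Q c) * qpoch_inf q (Q b * Q d) *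
      qpoch_inf q (Q f * Q c)) *
     phi32 (Q e) (Q a * Q c) (Q b * Q c) (Q c * Q e * Q f) (Q a * Q b * Q c * Q d) q (Q f * Q d)"
    unfolding G using nz small ABCD CEF
    by (intro jackson_between_eq_phi32 q_less q0) (simp_all add: Q_def qexp_add mult_ac)
  also have "\<dots> = Q c *
      (qpochs_inf q [q, Q (1 + c - d), Q (d - c), Q (a + b + c + d), Q (c + e + f)] /
       qpochs_inf q [Q (a + c), Q (a + d), Q (b + c), Q (b + d), Q (c + f)]) *
      phi32 (Q e) (Q (a + c)) (Q (b + c)) (Q (c + e + f)) (Q (a + b + c + d)) q (Q (d + f))"
    by (simp add: Q_def q_def qexp_add qexp_diff qpochs_inf_def mult_ac)
  finally have JB: "?JB = \<dots>" .
  show ?thesis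
  proof (intro exI conjI)
    show "has_line_integral (barnes_integrand \<omega> a b c d e f)
            (2 * of_real pi * \<i> * (?JB / sin (of_real pi * (d - c)))) \<gamma>"
      using has_line_integral_barnes by (simp add: Q_def q_def)
    show "1 / (2 * of_real pi * \<i>) * (2 * of_real pi * \<i> * (?JB / sin (of_real pi * (d - c)))) =
      Q c / sin (of_real pi * (d - c)) *
      (qpochs_inf q [q, Q (1 + c - d), Q (d - c), Q (a + b + c + d), Q (c + e + f)] /
       qpochs_inf q [Q (a + c), Q (a + d), Q (b + c), Q (b + d), Q (c + f)]) *
      phi32 (Q e) (Q (a + c)) (Q (b + c)) (Q (c + e + f)) (Q (a + b + c + d)) q (Q (d + f))"
      unfolding JB by simp
  qed
qed

end
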